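(* Let $U$ be a CR quaternionic vector space. Then there exists a CR quaternionic linear isomorphism between $U$ and a direct sum in which each term is of the form $U_k$ or $U'_k$ for some natural number $k\geq0$; moreover, the terms are unique, up to order. Furthermore, for $n>1$, let $W_n$ be the CR quaternionic vector subspace of $U$ corresponding to the direct sum of all terms up to $U_{(n/2)-1}$ or $U'_{(n-1)/2}$ (in the ordering $U'_0,U_0,U'_1,U_1,U'_2,U_2,\ldots$), according to $n$ even or odd, respectively. Then the filtration $\{W_n\}_{n>1}$ is canonical (that is, it does not depend on the isomorphism).
   Context: All vector spaces are real and finite dimensional. Let $\mathbb{H}$ be the quaternions, $\mathrm{Aut}(\mathbb{H})=\mathrm{SO}(3)$. A linear quaternionic structure on a vector space $E$ is an equivalence class of morphisms of associative algebras $\sigma:\mathbb{H}\to\mathrm{End}(E)$, where $\sigma\sim\tau$ if $\tau=\sigma\circ a$ for some $a\in\mathrm{SO}(3)$. The unit sphere $Z\cong S^2$ of $\sigma(\mathrm{Im}\,\mathbb{H})$ is the space of admissible linear complex structures of $E$. $\mathbb{H}^m$ is quaternionic via left multiplication. A linear CR quaternionic structure on $U$ is a pair $(E,\iota)$ with $E$ a quaternionic vector space and $\iota:U\to E$ injective linear such that $\mathrm{im}\,\iota+J(\mathrm{im}\,\iota)=E$ for all $J\in Z$; then $(U,E,\iota)$ is a CR quaternionic vector space. A linear map $\widetilde t:E\to E'$ between quaternionic vector spaces is quaternionic with respect to $T:Z\to Z'$ if $\widetilde t\circ J=T(J)\circ\widetilde t$ for all $J\in Z$. A map $t:(U,E,\iota)\to(U',E',\iota')$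 is CR quaternionic linear (with respect to $T$) if there is $\widetilde t:E\to E'$ quaternionic with respect to $T$ with $\iota'\circ t=\widetilde t\circ\iota$. A CR quaternionic vector subspace is one whose inclusion is an injective CR quaternionic linear map. Direct sum: given CR quaternionic vector spaces $(U_i,E_i,\iota_i)$, $i=1,2$, and an orientation preserving isometry $Z_1=Z_2$, $U_1\oplus U_2$ is a CR quaternionic vector space via $(E_1\oplus E_2,\iota_1\oplus\iota_2)$, where each $J\in Z_1=Z_2$ acts diagonally on $E_1\oplus E_2$. The spaces $U_k$: let $q_1,\ldots,q_{k+1}\in S^2\subset\mathrm{Im}\,\mathbb{H}$ with $q_i\neq\pm q_j$ for $i\neq j$, and for $j=1,\ldots,k$ let $e_j\in\mathbb{H}^{k+1}$ have $j$-th entry $q_j$, $(j+1)$-th entry $q_{j+1}$ and all other entries $0$. Put $V_0=\mathbb{R}\subset\mathbb{H}$ and, for $k\geq1$, $V_k=\mathbb{R}^{k+1}+\mathbb{R}e_1+\cdots+\mathbb{R}e_k\subset\mathbb{H}^{k+1}$. Then $U_k=V_k^{\perp}$ (orthogonal complement in $\mathbb{H}^{k+1}$), with the inclusion $U_k\subset\mathbb{H}^{k+1}$ (so $U_0=\mathrm{Im}\,\mathbb{H}$). The spaces $U'_k$: $V'_0=\{0\}\subset\mathbb{H}$ and, for $k\geq1$, $V'_k\subset\mathbb{H}^{2k+1}$ is the set of all vectors $(z_1,\ \overline{z_1}+z_2\mathrm{j},\ z_3-\overline{z_2}\mathrm{j},\ \ldots,\ \overline{z_{2k-1}}+z_{2k}\mathrm{j},\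 -\overline{z_{2k}}\mathrm{j})$ with $z_1,\ldots,z_{2k}\in\mathbb{C}$. Then $U'_k=(V'_k)^{\perp}$ with the inclusion $U'_k\subset\mathbb{H}^{2k+1}$ (so $U'_0=\mathbb{H}$). With the indicated ordering, $W_n$ is the part corresponding to the sum of all terms $U_k$ with $2k+2\leq n$ and all terms $U'_k$ with $2k+1\leq n$. *)

theory Defs
  imports "HOL-Analysis.Analysis" "HOL-Analysis.Finite_Function_Topology" "HOL-Library.FuncSet" "HOL-Library.Multiset"
begin

section \<open>Quaternions\<close>

datatype quat = Quat (qRe: real) (qI: real) (qJ: real) (qK: real)

lemma quat_eqI: "qRe x = qRe y \<Longrightarrow> qI x = qI y \<Longrightarrow> qJ x = qJ y \<Longrightarrow> qK x = qK y \<Longrightarrow> x = y"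
  by (rule quat.expand) simp

instantiation quat :: real_algebra_1
begin

definition "0 = Quat 0 0 0 0"
definition "1 = Quat 1 0 0 0"
definition "x + y = Quat (qRe x + qRe y) (qI x + qI y) (qJ x + qJ y) (qK x + qK y)"
definition "- x = Quat (- qRe x) (- qI x) (- qJ x) (- qK x)"
definition "x - (y::quat) = x + (- y)"
definition "r *\<^sub>R x = Quat (r * qRe x) (r * qI x) (r * qJ x) (r * qK x)"
definition "x * y = Quat
  (qRe x * qRe y - qI x * qI y - qJ x * qJ y - qK x * qK y)
  (qRe x * qI y + qI x * qRe y + qJ x * qK y - qK x * qJ y)
  (qRe x * qJ y - qI x * qK y + qJ x * qRe y + qK x * qI y)
  (qRe x * qK y + qI x * qJ y - qJ x * qI y + qK x * qRe y)"

instance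
  by standard
    (auto simp: zero_quat_def one_quat_def plus_quat_def uminus_quat_def minus_quat_def
      scaleR_quat_def times_quat_def algebra_simps intro!: quat_eqI)

end

instantiation quat :: real_inner
begin

definition "x \<bullet> y = qRe x * qRe y + qI x * qI y + qJ x * qJ y + qK x * qK y"
definition "norm (x::quat) = sqrt (x \<bullet> x)"
definition "sgn (x::quat) = x /\<^sub>R norm x"
definition "dist x (y::quat) = norm (x - y)"
definition "(uniformity :: (quat \<times> quat) filter) = (INF e\<in>{0<..}. principal {(x, y). dist x y < e})"
definition "open (U :: quat set) \<longleftrightarrow> (\<forall>x\<in>U. eventually (\<lambda>(x', y). x' = x \<longrightarrow> y \<in> U) uniformity)"

instance
proof
  fix x y z :: quat and r :: real
  show "dist x y = norm (x - y)" by (fact dist_quat_def)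
  show "sgn x = x /\<^sub>R norm x" by (fact sgn_quat_def)
  show "(uniformity :: (quat \<times> quat) filter) = (INF e\<in>{0<..}. principal {(x, y). dist x y < e})"
    by (fact uniformity_quat_def)
  show "open U \<longleftrightarrow> (\<forall>x\<in>U. eventually (\<lambda>(x', y). x' = x \<longrightarrow> y \<in> U) uniformity)" for U :: "quat set"
    by (fact open_quat_def)
  show "x \<bullet> y = y \<bullet> x" by (simp add: inner_quat_def mult.commute)
  show "(x + y) \<bullet> z = x \<bullet> z + y \<bullet> z" by (simp add: inner_quat_def plus_quat_def algebra_simps)
  show "(r *\<^sub>R x) \<bullet> y = r * (x \<bullet> y)" by (simp add: inner_quat_def scaleR_quat_def algebra_simps)
  show "0 \<le> x \<bullet> x" by (simp add: inner_quat_def)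
  show "x \<bullet> x = 0 \<longleftrightarrow> x = 0"
  proof
    assume "x \<bullet> x = 0"
    then have "(qRe x)\<^sup>2 + (qI x)\<^sup>2 + (qJ x)\<^sup>2 + (qK x)\<^sup>2 = 0"
      by (simp add: inner_quat_def power2_eq_square)
    moreover have "0 \<le> (qRe x)\<^sup>2" "0 \<le> (qI x)\<^sup>2" "0 \<le> (qJ x)\<^sup>2" "0 \<le> (qK x)\<^sup>2"
      by simp_all
    ultimately have "(qRe x)\<^sup>2 = 0" "(qI x)\<^sup>2 = 0" "(qJ x)\<^sup>2 = 0" "(qK x)\<^sup>2 = 0"
      by linarith+
    then show "x = 0" by (intro quat_eqI) (simp_all add: zero_quat_def)
  qed (simp add: inner_quat_def zero_quat_def)
  show "norm x = sqrt (x \<bullet> x)" by (fact norm_quat_def)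
qed

end

definition quat_j :: quat where
  "quat_j = Quat 0 0 1 0"

definition quat_of_complex :: "complex \<Rightarrow> quat" where
  "quat_of_complex z = Quat (Re z) (Im z) 0 0"

definition Im_quat_sphere :: "quat set" where
  "Im_quat_sphere = {p. qRe p = 0 \<and> norm p = 1}"

text \<open>The group \<open>Aut(\<H>)\<close> of automorphisms of the real associative algebra \<open>\<H>\<close>; it is \<open>SO(3)\<close>,
  acting on the imaginary quaternions.\<close>

definition Aut_quat :: "(quat \<Rightarrow> quat) set" where
  "Aut_quat = {a. linear a \<and> bij a \<and> a 1 = 1 \<and> (\<forall>x y. a (x * y) = a x * a y)}"


section \<open>Linear quaternionic structures\<close>

text \<open>A finite-dimensional real vector space is rendered as a finite-dimensional subspace of some
  real vector space type, so that the zero space is included. Endomorphisms of \<open>E\<close> are extensional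
  functions, so that they are equal as soon as they agree on \<open>E\<close>.\<close>

definition fin_dim :: "'a::real_vector set \<Rightarrow> bool" where
  "fin_dim S \<longleftrightarrow> (\<exists>B. finite B \<and> S = span B)"

definition linear_on :: "'a::real_vector set \<Rightarrow> ('a \<Rightarrow> 'b::real_vector) \<Rightarrow> bool" where
  "linear_on S f \<longleftrightarrow>
     (\<forall>x\<in>S. \<forall>y\<in>S. f (x + y) = f x + f y) \<and> (\<forall>c. \<forall>x\<in>S. f (c *\<^sub>R x) = c *\<^sub>R f x)"

definition End :: "'a::real_vector set \<Rightarrow> ('a \<Rightarrow> 'a) set" where
  "End E = {f \<in> E \<rightarrow>\<^sub>E E. linear_on E f}"

definition quat_morphisms :: "'e::real_vector set \<Rightarrow> (quat \<Rightarrow> 'e \<Rightarrow> 'e) set" where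
  "quat_morphisms E = {\<sigma>. (\<forall>p. \<sigma> p \<in> End E) \<and>
     (\<forall>p r. \<forall>x\<in>E. \<sigma> (p + r) x = \<sigma> p x + \<sigma> r x) \<and>
     (\<forall>c p. \<forall>x\<in>E. \<sigma> (c *\<^sub>R p) x = c *\<^sub>R \<sigma> p x) \<and>
     (\<forall>p r. \<forall>x\<in>E. \<sigma> (p * r) x = \<sigma> p (\<sigma> r x)) \<and>
     (\<forall>x\<in>E. \<sigma> 1 x = x)}"

definition quat_equiv :: "'e::real_vector set \<Rightarrow> ((quat \<Rightarrow> 'e \<Rightarrow> 'e) \<times> (quat \<Rightarrow> 'e \<Rightarrow> 'e)) set" where
  "quat_equiv E = {(\<sigma>, \<tau>). \<sigma> \<in> quat_morphisms E \<and> \<tau> \<in> quat_morphisms E \<and>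
     (\<exists>a\<in>Aut_quat. \<tau> = \<sigma> \<circ> a)}"

definition quat_structures :: "'e::real_vector set \<Rightarrow> (quat \<Rightarrow> 'e \<Rightarrow> 'e) set set" where
  "quat_structures E = quat_morphisms E // quat_equiv E"

definition admissible :: "(quat \<Rightarrow> 'e \<Rightarrow> 'e) set \<Rightarrow> ('e \<Rightarrow> 'e) set" where
  "admissible Q = (\<Union>\<sigma>\<in>Q. \<sigma> ` Im_quat_sphere)"

text \<open>\<open>quaternionic_wrt E Q E' Q' T f\<close>: \<open>f\<close> is a quaternionic linear map from \<open>(E, Q)\<close> to
  \<open>(E', Q')\<close> with respect to \<open>T : Z \<rightarrow> Z'\<close>.\<close>

definition quaternionic_wrt ::
  "'e::real_vector set \<Rightarrow> (quat \<Rightarrow> 'e \<Rightarrow> 'e) set \<Rightarrow> 'f::real_vector set \<Rightarrow> (quat \<Rightarrow> 'f \<Rightarrow> 'f) set \<Rightarrow>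
   (('e \<Rightarrow> 'e) \<Rightarrow> ('f \<Rightarrow> 'f)) \<Rightarrow> ('e \<Rightarrow> 'f) \<Rightarrow> bool" where
  "quaternionic_wrt E Q E' Q' T f \<longleftrightarrow>
     f \<in> E \<rightarrow> E' \<and> linear_on E f \<and> T \<in> admissible Q \<rightarrow> admissible Q' \<and>
     (\<forall>J\<in>admissible Q. \<forall>x\<in>E. f (J x) = T J (f x))"


section \<open>CR quaternionic vector spaces\<close>

record ('u, 'e) crq =
  crq_U :: "'u set"
  crq_E :: "'e set"
  crq_Q :: "(quat \<Rightarrow> 'e \<Rightarrow> 'e) set"
  crq_\<iota> :: "'u \<Rightarrow> 'e"

definition crq_vector_space :: "('u::real_vector, 'e::real_vector) crq \<Rightarrow> bool" where
  "crq_vector_space X \<longleftrightarrow>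
     subspace (crq_U X) \<and> fin_dim (crq_U X) \<and> subspace (crq_E X) \<and> fin_dim (crq_E X) \<and>
     crq_Q X \<in> quat_structures (crq_E X) \<and>
     crq_\<iota> X \<in> crq_U X \<rightarrow> crq_E X \<and> linear_on (crq_U X) (crq_\<iota> X) \<and> inj_on (crq_\<iota> X) (crq_U X) \<and>
     (\<forall>J\<in>admissible (crq_Q X).
        {x + J y | x y. x \<in> crq_\<iota> X ` crq_U X \<and> y \<in> crq_\<iota> X ` crq_U X} = crq_E X)"

definition crq_linear ::
  "('u::real_vector, 'e::real_vector) crq \<Rightarrow> ('v::real_vector, 'f::real_vector) crq \<Rightarrow>
   ('u \<Rightarrow> 'v) \<Rightarrow> bool" where
  "crq_linear X Y t \<longleftrightarrow>
     t \<in> crq_U X \<rightarrow> crq_U Y \<and> linear_on (crq_U X) t \<and>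
     (\<exists>T t'. quaternionic_wrt (crq_E X) (crq_Q X) (crq_E Y) (crq_Q Y) T t' \<and>
        (\<forall>u\<in>crq_U X. crq_\<iota> Y (t u) = t' (crq_\<iota> X u)))"

text \<open>A bijective CR quaternionic linear map need not have a CR quaternionic linear inverse (the
  map between the ambient quaternionic spaces may fail to be injective).\<close>

definition crq_iso ::
  "('u::real_vector, 'e::real_vector) crq \<Rightarrow> ('v::real_vector, 'f::real_vector) crq \<Rightarrow>
   ('u \<Rightarrow> 'v) \<Rightarrow> bool" where
  "crq_iso X Y t \<longleftrightarrow>
     crq_linear X Y t \<and> bij_betw t (crq_U X) (crq_U Y) \<and> crq_linear Y X (inv_into (crq_U X) t)"

definition crq_subspace ::
  "('u::real_vector, 'e::real_vector) crq \<Rightarrow> ('u, 'f::real_vector) crq \<Rightarrow> bool" where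
  "crq_subspace W X \<longleftrightarrow>
     crq_vector_space W \<and> crq_U W \<subseteq> crq_U X \<and> crq_linear W X (\<lambda>u. u)"

text \<open>Direct sum of the family \<open>X i\<close>, \<open>i \<in> I\<close>, realized as finitely supported families. The
  orientation preserving isometries identifying the spheres of admissible complex structures
  are given by representatives \<open>\<sigma> i\<close> of the quaternionic structures \<open>crq_Q (X i)\<close>:
  \<open>\<sigma> i p\<close> is identified with \<open>\<sigma> j p\<close> for all \<open>p\<close> in the unit sphere of \<open>Im \<H>\<close>. Changing the
  representatives by elements of \<open>SO(3)\<close> yields all orientation preserving isometries.\<close>

definition family_sum :: "nat set \<Rightarrow> (nat \<Rightarrow> 'a::zero set) \<Rightarrow> (nat \<Rightarrow>\<^sub>0 'a) set" where
  "family_sum I S = {v. Poly_Mapping.keys v \<subseteq> I \<and> (\<forall>i\<in>I. Poly_Mapping.lookup v i \<in> S i)}"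

definition crq_direct_sum ::
  "nat set \<Rightarrow> (nat \<Rightarrow> ('u::real_vector, 'e::real_vector) crq) \<Rightarrow> (nat \<Rightarrow> quat \<Rightarrow> 'e \<Rightarrow> 'e) \<Rightarrow>
   (nat \<Rightarrow>\<^sub>0 'u, nat \<Rightarrow>\<^sub>0 'e) crq" where
  "crq_direct_sum I X \<sigma> =
    (let E = family_sum I (\<lambda>i. crq_E (X i)) in
     \<lparr> crq_U = family_sum I (\<lambda>i. crq_U (X i)),
       crq_E = E,
       crq_Q = quat_equiv E `` {\<lambda>p. restrict (Poly_Mapping.mapp (\<lambda>i. \<sigma> i p)) E},
       crq_\<iota> = Poly_Mapping.mapp (\<lambda>i. crq_\<iota> (X i)) \<rparr>)"


section \<open>The spaces \<open>U\<^sub>k\<close> and \<open>U'\<^sub>k\<close>\<close>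

text \<open>Coordinates in \<open>\<H>\<^sup>m\<close> are numbered from \<open>0\<close>.\<close>

definition quat_space :: "nat \<Rightarrow> (nat \<Rightarrow>\<^sub>0 quat) set" where
  "quat_space m = {v. Poly_Mapping.keys v \<subseteq> {..<m}}"

definition left_mult :: "nat \<Rightarrow> quat \<Rightarrow> (nat \<Rightarrow>\<^sub>0 quat) \<Rightarrow> (nat \<Rightarrow>\<^sub>0 quat)" where
  "left_mult m p = restrict (Poly_Mapping.map (\<lambda>x. p * x)) (quat_space m)"

definition orth_compl :: "nat \<Rightarrow> (nat \<Rightarrow>\<^sub>0 quat) set \<Rightarrow> (nat \<Rightarrow>\<^sub>0 quat) set" where
  "orth_compl m V = {u \<in> quat_space m.
     \<forall>v\<in>V. (\<Sum>i<m. Poly_Mapping.lookup u i \<bullet> Poly_Mapping.lookup v i) = 0}"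

text \<open>The quaternions \<open>q\<^sub>1, \<dots>, q\<^sub>k\<^sub>+\<^sub>1\<close> used for \<open>U\<^sub>k\<close> are \<open>q k 0, \<dots>, q k k\<close>.\<close>

definition admissible_choice :: "(nat \<Rightarrow> nat \<Rightarrow> quat) \<Rightarrow> bool" where
  "admissible_choice q \<longleftrightarrow>
     (\<forall>k. (\<forall>i\<le>k. q k i \<in> Im_quat_sphere) \<and>
          (\<forall>i\<le>k. \<forall>j\<le>k. i \<noteq> j \<longrightarrow> q k i \<noteq> q k j \<and> q k i \<noteq> - q k j))"

definition V_vec :: "(nat \<Rightarrow> nat \<Rightarrow> quat) \<Rightarrow> nat \<Rightarrow> nat \<Rightarrow> (nat \<Rightarrow>\<^sub>0 quat)" where
  "V_vec q k j = Poly_Mapping.single j (q k j) + Poly_Mapping.single (j + 1) (q k (j + 1))"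

definition V_space :: "(nat \<Rightarrow> nat \<Rightarrow> quat) \<Rightarrow> nat \<Rightarrow> (nat \<Rightarrow>\<^sub>0 quat) set" where
  "V_space q k = {x + (\<Sum>j<k. c j *\<^sub>R V_vec q k j) | x c.
     x \<in> quat_space (k + 1) \<and> (\<forall>i. Poly_Mapping.lookup x i \<in> \<real>)}"

text \<open>With \<open>z 0 = z (2 * k + 1) = 0\<close> the first and the last coordinate of the vectors of \<open>V'\<^sub>k\<close>, and
  the case \<open>k = 0\<close>, follow the same pattern as the others.\<close>

definition V'_space :: "nat \<Rightarrow> (nat \<Rightarrow>\<^sub>0 quat) set" where
  "V'_space k = {v \<in> quat_space (2 * k + 1). \<exists>z :: nat \<Rightarrow> complex.
     z 0 = 0 \<and> z (2 * k + 1) = 0 \<and>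
     (\<forall>n\<le>2 * k. Poly_Mapping.lookup v n =
        (if even n then quat_of_complex (z (n + 1)) - quat_of_complex (cnj (z n)) * quat_j
         else quat_of_complex (cnj (z n)) + quat_of_complex (z (n + 1)) * quat_j))}"

datatype crq_label = Lab_U nat | Lab_U' nat

fun label_dim :: "crq_label \<Rightarrow> nat" where
  "label_dim (Lab_U k) = k + 1"
| "label_dim (Lab_U' k) = 2 * k + 1"

fun label_U :: "(nat \<Rightarrow> nat \<Rightarrow> quat) \<Rightarrow> crq_label \<Rightarrow> (nat \<Rightarrow>\<^sub>0 quat) set" where
  "label_U q (Lab_U k) = orth_compl (k + 1) (V_space q k)"
| "label_U q (Lab_U' k) = orth_compl (2 * k + 1) (V'_space k)"

definition crq_term :: "(nat \<Rightarrow> nat \<Rightarrow> quat) \<Rightarrow> crq_label \<Rightarrow> (nat \<Rightarrow>\<^sub>0 quat, nat \<Rightarrow>\<^sub>0 quat) crq" where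
  "crq_term q l =
     \<lparr> crq_U = label_U q l,
       crq_E = quat_space (label_dim l),
       crq_Q = quat_equiv (quat_space (label_dim l)) `` {left_mult (label_dim l)},
       crq_\<iota> = (\<lambda>u. u) \<rparr>"


section \<open>Decompositions and the filtration\<close>

text \<open>The sum of the terms labelled \<open>ls ! i\<close>, \<open>i \<in> I\<close>. The automorphisms \<open>a i\<close> record the
  identifications between the spheres of admissible complex structures of the terms; if they are
  all the identity, then all spheres are identified with \<open>S\<^sup>2 \<subseteq> Im \<H>\<close> through left multiplication.\<close>

definition term_sum ::
  "(nat \<Rightarrow> nat \<Rightarrow> quat) \<Rightarrow> (nat \<Rightarrow> quat \<Rightarrow> quat) \<Rightarrow> crq_label list \<Rightarrow> nat set \<Rightarrow>
   (nat \<Rightarrow>\<^sub>0 nat \<Rightarrow>\<^sub>0 quat, nat \<Rightarrow>\<^sub>0 nat \<Rightarrow>\<^sub>0 quat) crq" where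
  "term_sum q a ls I =
     crq_direct_sum I (\<lambda>i. crq_term q (ls ! i)) (\<lambda>i. left_mult (label_dim (ls ! i)) \<circ> a i)"

definition crq_decomposition ::
  "(nat \<Rightarrow> nat \<Rightarrow> quat) \<Rightarrow> ('u::real_vector, 'e::real_vector) crq \<Rightarrow> (nat \<Rightarrow> quat \<Rightarrow> quat) \<Rightarrow>
   crq_label list \<Rightarrow> ('u \<Rightarrow> (nat \<Rightarrow>\<^sub>0 nat \<Rightarrow>\<^sub>0 quat)) \<Rightarrow> bool" where
  "crq_decomposition q X a ls \<phi> \<longleftrightarrow>
     (\<forall>i<length ls. a i \<in> Aut_quat) \<and> crq_iso X (term_sum q a ls {..<length ls}) \<phi>"

text \<open>Position in the ordering \<open>U'\<^sub>0, U\<^sub>0, U'\<^sub>1, U\<^sub>1, \<dots>\<close>, starting from \<open>1\<close>.\<close>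

fun label_pos :: "crq_label \<Rightarrow> nat" where
  "label_pos (Lab_U k) = 2 * k + 2"
| "label_pos (Lab_U' k) = 2 * k + 1"

text \<open>\<open>W\<^sub>n\<close>, with the CR quaternionic structure transported from the partial direct sum.\<close>

definition crq_W ::
  "(nat \<Rightarrow> nat \<Rightarrow> quat) \<Rightarrow> ('u::real_vector, 'e::real_vector) crq \<Rightarrow> (nat \<Rightarrow> quat \<Rightarrow> quat) \<Rightarrow>
   crq_label list \<Rightarrow> ('u \<Rightarrow> (nat \<Rightarrow>\<^sub>0 nat \<Rightarrow>\<^sub>0 quat)) \<Rightarrow> nat \<Rightarrow>
   ('u, nat \<Rightarrow>\<^sub>0 nat \<Rightarrow>\<^sub>0 quat) crq" where
  "crq_W q X a ls \<phi> n =
    (let S = term_sum q a ls {i. i < length ls \<and> label_pos (ls ! i) \<le> n} in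
     \<lparr> crq_U = {u \<in> crq_U X. \<phi> u \<in> crq_U S},
       crq_E = crq_E S,
       crq_Q = crq_Q S,
       crq_\<iota> = crq_\<iota> S \<circ> \<phi> \<rparr>)"

end

theory Submission
  imports Defs "HOL-Computational_Algebra.Fundamental_Theorem_Algebra"
begin

text \<open>By orthogonal complements, CR quaternionic vector spaces correspond to pairs \<open>(V, E)\<close> of a
  quaternionic vector space \<open>E\<close> and a real subspace \<open>V\<close> with \<open>V \<inter> J V = 0\<close> for all \<open>J\<close>. The proof is
  by descent along the syzygy functor: with \<open>G = ker (\<H> \<otimes> V \<rightarrow> E)\<close> and \<open>G\<^sub>0 \<subseteq> G\<close> the
  elements without real part, \<open>(G\<^sub>0, G)\<close> is again such a pair, and it is strictly smaller because
  \<open>2 dim V < dim E\<close> (otherwise an eigenvector of a complex linear endomorphism would produce a point of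
  \<open>V \<inter> J V\<close>). Up to summands \<open>(0, \<H>)\<close> and \<open>(\<real>, \<H>)\<close>, which split off, \<open>(V, E)\<close> is recovered from \<open>(G\<^sub>0, G)\<close>
  as \<open>V = G / G\<^sub>0\<close> and \<open>E = (\<H> \<otimes> V) / G\<close>. On the models the functor lowers \<open>k\<close> by one, so the
  classification of indecomposable pairs, the uniqueness of each model, and the vanishing of the
  morphisms from a model to one that comes earlier in the ordering all follow by induction.
  Dualizing, a morphism between sums of models has no component from a term to a later one, which
  makes the filtration canonical; the multiplicities are then determined by the dimensions of its
  steps.\<close>

section \<open>Dimension counts for subspaces of arbitrary real vector spaces\<close>

section \<open>Finite-dimensional subspaces\<close>

text \<open>The inequality \<open>2 dim V < dim E\<close> acts twice. For \<open>(V, E)\<close> it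
  makes the syzygies smaller; for the syzygies themselves it bounds how far the maps onto
  \<open>E\<close> and \<open>V\<close> can be from surjective. At the dimensions of the models this
  excludes any defect, with a parity argument in the case of \<open>U'\<close>. Hence the models are
  handled through invariants (dimensions and, for \<open>U'\<close>, a commuting complex structure),
  and their formulas enter in just one verification per type. These invariants survive a rotation of
  the imaginary quaternions, which disposes of both the choice of \<open>q\<close> and the
  identifications between the spheres of the terms. Another obstacle is the notion of morphism: the
  map \<open>T\<close> of spheres is an arbitrary function. When the ambient map is onto,
  \<open>T\<close> may be replaced by an automorphism of the quaternions, and from then on only
  semilinear maps occur. For an isomorphism the ambient map is onto because \<open>U\<close> and
  \<open>J U\<close> generate \<open>E\<close>.\<close>

lemma fin_dim_subspace: "fin_dim S \<Longrightarrow> subspace S"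
  by (auto simp: fin_dim_def)

lemma fin_dim_basis:
  fixes S :: "'a::real_vector set"
  assumes "fin_dim S"
  obtains B where "finite B" "B \<subseteq> S" "independent B" "S = span B" "card B = dim S"
proof -
  obtain C where C: "finite C" "S = span C" using assms by (auto simp: fin_dim_def)
  obtain B where B: "B \<subseteq> S" "independent B" "S \<subseteq> span B" "card B = dim S"
    using basis_exists by metis
  have "finite B" using independent_span_bound[OF C(1) B(2) B(1)[unfolded C(2)]] by blast
  moreover have "S = span B"
    by (rule subset_antisym[OF B(3) span_minimal[OF B(1) fin_dim_subspace[OF assms]]])
  ultimately show ?thesis using B that by blast
qed

lemma fin_dim_subset:
  fixes S :: "'a::real_vector set"
  assumes "fin_dim S" "subspace T" "T \<subseteq> S"
  shows "fin_dim T" "dim T \<le> dim S"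
proof -
  obtain C where C: "finite C" "S = span C" "card C = dim S"
    using fin_dim_basis[OF assms(1)] by metis
  obtain B where B: "B \<subseteq> T" "independent B" "T \<subseteq> span B" "card B = dim T"
    using basis_exists by metis
  have *: "finite B \<and> card B \<le> card C"
    using independent_span_bound[OF C(1) B(2) subset_trans[OF B(1) assms(3)[unfolded C(2)]]] .
  have "T = span B" by (rule subset_antisym[OF B(3) span_minimal[OF B(1) assms(2)]])
  then show "fin_dim T" "dim T \<le> dim S" using * B C by (auto simp: fin_dim_def)
qed

lemma fin_dim_subset_eq:
  fixes S :: "'a::real_vector set"
  assumes "fin_dim S" "subspace T" "T \<subseteq> S" "dim S \<le> dim T"
  shows "T = S"
proof -
  obtain B where B: "finite B" "B \<subseteq> T" "independent B" "T = span B" "card B = dim T"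
    using fin_dim_basis[OF fin_dim_subset(1)[OF assms(1-3)]] by metis
  obtain C where C: "finite C" "S = span C" "card C = dim S"
    using fin_dim_basis[OF assms(1)] by metis
  have "x \<in> T" if "x \<in> S" for x
  proof (rule ccontr)
    assume "x \<notin> T"
    then have i: "independent (insert x B)" and x: "x \<notin> B"
      using B(3) span_base[of x B] unfolding B(4) by (auto simp: independent_insert)
    have "insert x B \<subseteq> S" using B(2) assms(3) that by blast
    then have "card (insert x B) \<le> card C"
      using independent_span_bound[OF C(1) i] unfolding C(2) by blast
    then show False using x B(1,5) C(3) assms(4) by simp
  qed
  then show ?thesis using assms(3) by blast
qed

lemma fin_dim_0 [simp]: "fin_dim {0::'a::real_vector}" "dim {0::'a::real_vector} = 0"
proof -
  show "fin_dim {0::'a}" unfolding fin_dim_def by (rule exI[of _ "{}"]) simp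
  have "dim (span {} :: 'a set) = card ({}::'a set)"
    by (rule dim_span_eq_card_independent) (simp add: independent_empty)
  then show "dim {0::'a} = 0" by simp
qed

lemma fin_dim_eq_0:
  fixes S :: "'a::real_vector set"
  assumes "fin_dim S" shows "dim S = 0 \<longleftrightarrow> S = {0}"
proof
  assume d: "dim S = 0"
  obtain B where B: "finite B" "S = span B" "card B = dim S" using fin_dim_basis[OF assms] by metis
  then have "B = {}" using d by simp
  then show "S = {0}" using B(2) by simp
qed simp

lemma linear_on_zero: "linear_on S f \<Longrightarrow> subspace S \<Longrightarrow> f 0 = 0"
  unfolding linear_on_def using subspace_0[of S] scaleR_zero_left[of 0] scaleR_zero_left[of "f 0"] by metis

lemma linear_on_diff:
  assumes "linear_on S f" "subspace S" "x \<in> S" "y \<in> S"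
  shows "f (x - y) = f x - f y"
proof -
  have "f (x + (-1) *\<^sub>R y) = f x + (-1) *\<^sub>R f y"
    using assms subspace_scale[OF assms(2,4), of "-1"] unfolding linear_on_def by metis
  then show ?thesis by simp
qed

lemma linear_on_sum:
  assumes "linear_on S f" "subspace S" "\<And>i. i \<in> I \<Longrightarrow> g i \<in> S"
  shows "f (\<Sum>i\<in>I. g i) = (\<Sum>i\<in>I. f (g i))"
proof (cases "finite I")
  case True
  then show ?thesis using assms(3)
  proof (induction I rule: finite_induct)
    case empty
    then show ?case using linear_on_zero[OF assms(1,2)] by simp
  next
    case (insert x F)
    then have "g x \<in> S" "sum g F \<in> S" using assms(2) by (auto intro: subspace_sum)
    then show ?case using insert assms(1) by (simp add: linear_on_def)
  qed
next
  case False
  then show ?thesis using linear_on_zero[OF assms(1,2)] by simp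
qed

lemma linear_on_subset: "linear_on S f \<Longrightarrow> T \<subseteq> S \<Longrightarrow> linear_on T f"
  unfolding linear_on_def by blast

lemma linear_imp_linear_on: "linear f \<Longrightarrow> linear_on S f"
  unfolding linear_on_def by (simp add: linear_add linear_scale)

lemma linear_on_extend:
  fixes f :: "'a::real_vector \<Rightarrow> 'b::real_vector"
  assumes "subspace S" "linear_on S f"
  obtains g where "linear g" "\<And>x. x \<in> S \<Longrightarrow> g x = f x"
proof -
  obtain B where B: "B \<subseteq> S" "independent B" "S \<subseteq> span B" using basis_exists[of S] by metis
  obtain g where g: "linear g" "\<forall>x\<in>B. g x = f x" using linear_independent_extend[OF B(2), of f] by blast
  have "x \<in> S \<and> g x = f x" if "x \<in> span B" for x
    using that
  proof (induction rule: span_induct_alt)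
    case base
    then show ?case using linear_on_zero[OF assms(2,1)] g assms(1) by (simp add: linear_0 subspace_0)
  next
    case (step c x y)
    then have "x \<in> S" "c *\<^sub>R x \<in> S" using B(1) assms(1) by (auto intro: subspace_scale)
    then show ?case
      using step g assms unfolding linear_on_def
      by (auto simp: linear_add linear_scale intro: subspace_add)
  qed
  then show ?thesis using that g B(3) by blast
qed

lemma linear_on_image_subspace:
  assumes "subspace S" "linear_on S f" shows "subspace (f ` S)"
proof -
  obtain g where g: "linear g" "\<And>x. x \<in> S \<Longrightarrow> g x = f x" using linear_on_extend[OF assms] by metis
  have "f ` S = g ` S" using g(2) by auto
  then show ?thesis using linear_subspace_image[OF g(1) assms(1)] by simp
qed

lemma linear_on_kernel_subspace:
  assumes "subspace S" "linear_on S f" shows "subspace {x\<in>S. f x = 0}"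
  unfolding subspace_def
  using assms linear_on_zero[OF assms(2,1)]
  by (auto simp: linear_on_def subspace_add subspace_scale subspace_0)

text \<open>The linear map that kills \<open>A\<close> and fixes \<open>B\<close> pointwise sends
  \<open>x\<close> both to \<open>0\<close> and to itself.\<close>

lemma span_Int_disjoint:
  fixes A :: "'a::real_vector set"
  assumes "independent (A \<union> B)" "A \<inter> B = {}" "x \<in> span A" "x \<in> span B" shows "x = 0"
proof -
  obtain h :: "'a \<Rightarrow> 'a" where h: "linear h" "\<forall>y\<in>A\<union>B. h y = (if y \<in> A then 0 else y)"
    using linear_independent_extend[OF assms(1), of "\<lambda>y. if y \<in> A then 0 else y"] by blast
  have "h y = 0" if "y \<in> A" for y using h(2) that by simp
  then have 1: "h x = 0" using linear_eq_0_on_span[OF h(1) _ assms(3)] by blast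
  have "h y = id y" if "y \<in> B" for y using h(2) that assms(2) by auto
  then have "h x = id x" using linear_eq_on_span[OF h(1) linear_id _ assms(4)] by blast
  then show ?thesis using 1 by simp
qed

text \<open>A basis \<open>A\<close> of the kernel extends to a basis \<open>B\<close> of
  \<open>S\<close>, and the images of \<open>B - A\<close> form a basis of the image. Since
  \<open>f\<close> is linear only on \<open>S\<close>, it is first replaced by a globally linear
  \<open>g\<close> that agrees with it there.\<close>

lemma fin_dim_rank_nullity:
  fixes f :: "'a::real_vector \<Rightarrow> 'b::real_vector"
  assumes "fin_dim S" "linear_on S f"
  shows "fin_dim (f ` S)" "dim S = dim (f ` S) + dim {x\<in>S. f x = 0}"
proof -
  have sub: "subspace S" using assms(1) by (rule fin_dim_subspace)
  obtain g where g: "linear g" "\<And>x. x \<in> S \<Longrightarrow> g x = f x"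
    using linear_on_extend[OF sub assms(2)] by metis
  define K where "K = {x\<in>S. f x = 0}"
  have K: "subspace K" "K \<subseteq> S" using linear_on_kernel_subspace[OF sub assms(2)] by (auto simp: K_def)
  obtain A where A: "finite A" "A \<subseteq> K" "independent A" "K = span A" "card A = dim K"
    using fin_dim_basis[OF fin_dim_subset(1)[OF assms(1) K]] by metis
  obtain B where B: "A \<subseteq> B" "B \<subseteq> S" "independent B" "S \<subseteq> span B"
    using maximal_independent_subset_extend[of A S] A(2,3) K(2) by blast
  obtain C where C: "finite C" "S = span C" using assms(1) by (auto simp: fin_dim_def)
  have finB: "finite B" using independent_span_bound[OF C(1) B(3) B(2)[unfolded C(2)]] by blast
  have SB: "S = span B" by (rule subset_antisym[OF B(4) span_minimal[OF B(2) sub]])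
  have cB: "card B = dim S" unfolding SB using dim_span_eq_card_independent[OF B(3)] by simp
  let ?D = "B - A"
  have inj: "inj_on g (span ?D)"
  proof (rule inj_onI)
    fix x y assume xy: "x \<in> span ?D" "y \<in> span ?D" "g x = g y"
    have d: "x - y \<in> span ?D" using xy by (simp add: span_diff)
    then have dS: "x - y \<in> S" using SB span_mono[of ?D B] by auto
    have "g (x - y) = 0" using xy g by (simp add: linear_diff)
    then have "x - y \<in> span A" using dS g(2) A(4) K_def by auto
    then have "x - y = 0" using d span_Int_disjoint[of A ?D "x - y"] B by (simp add: Un_absorb1)
    then show "x = y" by simp
  qed
  have ind: "independent (g ` ?D)"
    using linear_independent_injective_image[OF g(1) independent_mono[OF B(3)] inj] by blast
  have "f ` S = g ` S" using g(2) by auto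
  also have "\<dots> = span (g ` B)" using SB linear_span_image[OF g(1)] by simp
  also have "\<dots> = span (g ` ?D)"
  proof -
    have "g x = 0" if "x \<in> A" for x using that A(2) K_def g(2) by auto
    then have "g ` B \<subseteq> insert 0 (g ` ?D)" by auto
    then have "span (g ` B) \<subseteq> span (g ` ?D)" by (metis span_insert_0 span_mono)
    then show ?thesis by (simp add: span_mono image_mono subset_antisym)
  qed
  finally have im: "f ` S = span (g ` ?D)" .
  show "fin_dim (f ` S)" unfolding fin_dim_def by (rule exI[of _ "g ` ?D"]) (use im finB in auto)
  have "dim (f ` S) = card (g ` ?D)" using im dim_span_eq_card_independent[OF ind] by simp
  also have "\<dots> = card ?D" by (rule card_image) (meson inj inj_on_subset span_superset)
  also have "\<dots> = dim S - dim K" using A B finB cB by (metis card_Diff_subset)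
  finally show "dim S = dim (f ` S) + dim {x\<in>S. f x = 0}"
    using fin_dim_subset(2)[OF assms(1) K] K_def by simp
qed

lemma fin_dim_image_inj:
  fixes f :: "'a::real_vector \<Rightarrow> 'b::real_vector"
  assumes "fin_dim S" "linear_on S f" "\<And>x. x \<in> S \<Longrightarrow> f x = 0 \<Longrightarrow> x = 0"
  shows "dim (f ` S) = dim S" "inj_on f S"
proof -
  have sub: "subspace S" using assms(1) by (rule fin_dim_subspace)
  have "{x\<in>S. f x = 0} = {0}" using assms(3) linear_on_zero[OF assms(2) sub] sub by (auto simp: subspace_0)
  then show "dim (f ` S) = dim S" using fin_dim_rank_nullity(2)[OF assms(1,2)] by simp
  show "inj_on f S"
  proof (rule inj_onI)
    fix x y assume xy: "x \<in> S" "y \<in> S" "f x = f y"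
    then have "f (x - y) = 0" using linear_on_diff[OF assms(2) sub] by simp
    then have "x - y = 0" using assms(3) subspace_diff[OF sub xy(1,2)] by blast
    then show "x = y" by simp
  qed
qed

lemma linear_on_inj_dim:
  fixes f :: "'a::real_vector \<Rightarrow> 'b::real_vector"
  assumes "fin_dim S" "linear_on S f" "inj_on f S" shows "dim (f ` S) = dim S"
proof (rule fin_dim_image_inj(1)[OF assms(1,2)])
  have sub: "subspace S" using assms(1) by (rule fin_dim_subspace)
  fix x assume "x \<in> S" "f x = 0"
  then show "x = 0"
    using inj_onD[OF assms(3), of x 0] linear_on_zero[OF assms(2) sub] subspace_0[OF sub] by simp
qed

text \<open>A projection \<open>h\<close> of the sum with kernel \<open>S\<close> is injective on
  \<open>T\<close> and has the same image on \<open>T\<close> as on the whole sum; rank-nullity for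
  \<open>h\<close> then gives the formula.\<close>

lemma fin_dim_sum:
  fixes S :: "'a::real_vector set"
  assumes "fin_dim S" "fin_dim T" "S \<inter> T = {0}"
  shows "fin_dim {x + y | x y. x \<in> S \<and> y \<in> T}" "dim {x + y | x y. x \<in> S \<and> y \<in> T} = dim S + dim T"
proof -
  let ?W = "{x + y | x y. x \<in> S \<and> y \<in> T}"
  obtain A where A: "finite A" "A \<subseteq> S" "independent A" "S = span A" "card A = dim S"
    using fin_dim_basis[OF assms(1)] by metis
  obtain B where B: "finite B" "B \<subseteq> T" "independent B" "T = span B" "card B = dim T"
    using fin_dim_basis[OF assms(2)] by metis
  have W: "?W = span (A \<union> B)" using A B by (auto simp: span_Un)
  then show fW: "fin_dim ?W" unfolding fin_dim_def using A B by blast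
  have AW: "A \<subseteq> ?W" unfolding W using span_superset[of "A \<union> B"] by simp
  obtain C where C: "A \<subseteq> C" "C \<subseteq> ?W" "independent C" "?W \<subseteq> span C"
    by (rule maximal_independent_subset_extend[OF AW A(3)])
  obtain h where h: "linear h" "\<forall>y\<in>C. h y = (if y \<in> A then 0 else y)"
    using linear_independent_extend[OF C(3), of "\<lambda>y. if y \<in> A then 0 else y"] by blast
  have hS: "h x = 0" if "x \<in> S" for x
  proof -
    have "h y = 0" if "y \<in> A" for y using h(2) C(1) that by auto
    then show ?thesis using linear_eq_0_on_span[OF h(1) _ that[unfolded A(4)]] by blast
  qed
  have hC: "h x = x" if "x \<in> span (C - A)" for x
  proof -
    have "h y = id y" if "y \<in> C - A" for y using h(2) that by auto
    then have "h x = id x" using linear_eq_on_span[OF h(1) linear_id _ that] by blast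
    then show ?thesis by simp
  qed
  have ker: "x \<in> S" if "x \<in> span C" "h x = 0" for x
  proof -
    have "C = A \<union> (C - A)" using C(1) by auto
    then have "x \<in> {y + z | y z. y \<in> span A \<and> z \<in> span (C - A)}"
      using that(1) span_Un[of A "C - A"] by simp
    then obtain y z where yz: "x = y + z" "y \<in> span A" "z \<in> span (C - A)" by blast
    then have "z = 0" using that(2) hS[of y] hC[of z] A(4) h(1) by (simp add: linear_add)
    then show ?thesis using yz A(4) by simp
  qed
  have WC: "?W = span C" using C W by (metis (no_types, lifting) span_minimal subset_antisym subspace_span)
  have "{x\<in>?W. h x = 0} = S"
  proof
    show "{x\<in>?W. h x = 0} \<subseteq> S" using ker WC by auto
    show "S \<subseteq> {x\<in>?W. h x = 0}"
    proof
      fix x assume "x \<in> S"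
      moreover have "0 \<in> T" using assms(3) by auto
      ultimately have "x + 0 \<in> ?W" by blast
      then show "x \<in> {x\<in>?W. h x = 0}" using hS[OF \<open>x \<in> S\<close>] by simp
    qed
  qed
  then have 1: "dim ?W = dim (h ` ?W) + dim S"
    using fin_dim_rank_nullity(2)[OF fW linear_imp_linear_on[OF h(1)]] by simp
  have "h ` ?W = h ` T"
  proof
    show "h ` ?W \<subseteq> h ` T" using hS h(1) by (auto simp: linear_add)
    have "0 \<in> S" using assms(3) by auto
    then have "T \<subseteq> ?W" by force
    then show "h ` T \<subseteq> h ` ?W" by blast
  qed
  moreover have "dim (h ` T) = dim T"
  proof (rule fin_dim_image_inj(1)[OF assms(2) linear_imp_linear_on[OF h(1)]])
    fix x assume x: "x \<in> T" "h x = 0"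
    then have "x \<in> span C" using B(4) W WC span_mono[of B "A \<union> B"] by auto
    then show "x = 0" using ker x assms(3) by auto
  qed
  ultimately show "dim ?W = dim S + dim T" using 1 by simp
qed

text \<open>An \<open>R\<close>-stable subspace of maximal even dimension must be everything: a
  vector \<open>w\<close> outside it would contribute the \<open>R\<close>-stable plane spanned by
  \<open>w\<close> and \<open>R w\<close>. The parity is what settles regularity for the type
  \<open>U'\<close>.\<close>

lemma even_dim_complex_structure:
  fixes S :: "'a::real_vector set"
  assumes "fin_dim S" "linear_on S R" "R ` S \<subseteq> S" "\<And>x. x \<in> S \<Longrightarrow> R (R x) = - x"
  shows "even (dim S)"
proof -
  have sub: "subspace S" using assms(1) by (rule fin_dim_subspace)
  define P where "P T \<longleftrightarrow> subspace T \<and> T \<subseteq> S \<and> R ` T \<subseteq> T \<and> even (dim T)" for T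
  have P0: "P {0}"
    using sub linear_on_zero[OF assms(2) sub] by (simp add: P_def subspace_0)
  obtain T where T: "P T" and mx: "\<And>T'. P T' \<Longrightarrow> dim T' \<le> dim T"
  proof -
    have "\<forall>T'. P T' \<longrightarrow> dim T' < Suc (dim S)"
      using fin_dim_subset(2)[OF assms(1)] by (auto simp: P_def less_Suc_eq_le)
    from ex_has_greatest_nat[OF P0 this] show ?thesis using that by blast
  qed
  have Tsub: "subspace T" "T \<subseteq> S" "R ` T \<subseteq> T" using T by (auto simp: P_def)
  have fT: "fin_dim T" using fin_dim_subset(1)[OF assms(1) Tsub(1,2)] .
  have "T = S"
  proof (rule ccontr)
    assume "T \<noteq> S"
    then obtain w where w: "w \<in> S" "w \<notin> T" using Tsub by blast
    have Rw: "R w \<in> S" using assms(3) w by auto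
    let ?L = "span {w, R w}"
    have L: "?L = {a *\<^sub>R w + b *\<^sub>R R w | a b. True}"
    proof (intro set_eqI iffI)
      fix x assume "x \<in> ?L"
      then obtain a b where "x - a *\<^sub>R w = b *\<^sub>R R w"
        unfolding span_insert[of w] span_singleton by auto
      then have "x = a *\<^sub>R w + b *\<^sub>R R w" by (simp add: algebra_simps)
      then show "x \<in> {a *\<^sub>R w + b *\<^sub>R R w | a b. True}" by blast
    next
      fix x assume "x \<in> {a *\<^sub>R w + b *\<^sub>R R w | a b. True}"
      then obtain a b where "x = a *\<^sub>R w + b *\<^sub>R R w" by blast
      then show "x \<in> ?L" by (simp add: span_add span_scale span_base)
    qed
    have fL: "fin_dim ?L" unfolding fin_dim_def by (rule exI[of _ "{w, R w}"]) simp
    have LS: "?L \<subseteq> S" using w Rw sub by (intro span_minimal) auto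
    have RL: "R (a *\<^sub>R w + b *\<^sub>R R w) = (- b) *\<^sub>R w + a *\<^sub>R R w" for a b
      using assms(2,4) w Rw sub unfolding linear_on_def by (simp add: subspace_scale)
    have key: "a = 0 \<and> b = 0" if "a *\<^sub>R w + b *\<^sub>R R w \<in> T" for a b
    proof (rule ccontr)
      assume ab: "\<not> (a = 0 \<and> b = 0)"
      have "R (a *\<^sub>R w + b *\<^sub>R R w) \<in> T" using that Tsub(3) by blast
      \<comment> \<open>For \<open>y = a w + b R w\<close> the combination
        \<open>a y - b R y\<close> eliminates \<open>R w\<close> and leaves
        \<open>(a*a + b*b) w\<close>.\<close>
      then have "a *\<^sub>R (a *\<^sub>R w + b *\<^sub>R R w) - b *\<^sub>R ((- b) *\<^sub>R w + a *\<^sub>R R w) \<in> T"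
        unfolding RL using that Tsub(1) by (intro subspace_diff subspace_scale)
      then have "(a*a + b*b) *\<^sub>R w \<in> T" by (simp add: algebra_simps)
      moreover have "a*a + b*b \<noteq> 0" using ab by (simp add: sum_squares_eq_zero_iff)
      ultimately have "w \<in> T" using Tsub(1) subspace_scale[of T "(a*a + b*b) *\<^sub>R w" "inverse (a*a + b*b)"] by simp
      then show False using w by simp
    qed
    have int: "T \<inter> ?L = {0}"
    proof -
      have "x = 0" if "x \<in> T" "x \<in> ?L" for x
      proof -
        obtain a b where ab: "x = a *\<^sub>R w + b *\<^sub>R R w" using \<open>x \<in> ?L\<close> L by blast
        then show "x = 0" using key[of a b] that(1) by simp
      qed
      then show ?thesis using subspace_0[OF Tsub(1)] span_zero by blast
    qed
    have "R w \<noteq> c *\<^sub>R w" for c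
      using key[of c "-1"] Tsub(1) by (auto simp: subspace_0)
    then have nin: "R w \<notin> span {w}" by (auto simp: span_singleton)
    have w0: "w \<noteq> 0" using w Tsub(1) subspace_0 by auto
    have dL: "dim ?L = 2"
    proof -
      have "independent {R w, w}" using nin w0 by (simp add: independent_insert)
      moreover have "R w \<noteq> w" using nin by (metis span_base singletonI)
      ultimately show ?thesis
        using dim_span_eq_card_independent[of "{R w, w}"] by (simp add: insert_commute)
    qed
    let ?W = "{x + y | x y. x \<in> T \<and> y \<in> ?L}"
    have "P ?W" unfolding P_def
    proof (intro conjI)
      show "subspace ?W" using Tsub(1) by (intro subspace_sums) auto
      show "?W \<subseteq> S" using Tsub LS sub by (auto intro!: subspace_add)
      show "even (dim ?W)" using fin_dim_sum(2)[OF fT fL int] T dL by (simp add: P_def)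
      have "R y \<in> ?L" if "y \<in> ?L" for y proof -
      obtain a b where y: "y = a *\<^sub>R w + b *\<^sub>R R w" using \<open>y \<in> ?L\<close> L by blast
      show ?thesis unfolding y RL L by blast
    qed
      moreover have "R (x + y) = R x + R y" if "x \<in> T" "y \<in> ?L" for x y
        using that assms(2) Tsub LS unfolding linear_on_def by blast
      ultimately show "R ` ?W \<subseteq> ?W" using Tsub(3) by fastforce
    qed
    from mx[OF this] show False using fin_dim_sum(2)[OF fT fL int] dL by simp
  qed
  then show ?thesis using T by (simp add: P_def)
qed

section \<open>Direct sums realized as finitely supported families\<close>

section \<open>Families with values in subspaces\<close>

abbreviation lk :: "('a \<Rightarrow>\<^sub>0 'b::zero) \<Rightarrow> 'a \<Rightarrow> 'b" where "lk \<equiv> Poly_Mapping.lookup"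
abbreviation sg :: "'a \<Rightarrow> 'b \<Rightarrow> 'a \<Rightarrow>\<^sub>0 'b::zero" where "sg \<equiv> Poly_Mapping.single"

lemma lk_scaleR [simp]: "lk (c *\<^sub>R v) i = c *\<^sub>R lk v i" for v :: "'a \<Rightarrow>\<^sub>0 'b::real_vector"
proof -
  have "finite {i. c *\<^sub>R lk v i \<noteq> 0}"
    by (rule finite_subset[OF _ finite_lookup[of v]]) auto
  then show ?thesis by (simp add: scaleR_poly_mapping_def)
qed

declare lookup_add [simp] lookup_minus [simp]

lemma lk_sg: "lk (sg i x) j = (if i = j then x else 0)"
  by (simp add: lookup_single when_def)

lemma linear_sg: "linear (sg i :: 'b::real_vector \<Rightarrow> 'a \<Rightarrow>\<^sub>0 'b)"
  by (intro linearI poly_mapping_eqI) (auto simp: lk_sg)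

lemma family_sum_alt:
  fixes S :: "nat \<Rightarrow> 'a::real_vector set"
  assumes "\<And>i. i \<in> I \<Longrightarrow> 0 \<in> S i"
  shows "v \<in> family_sum I S \<longleftrightarrow> (\<forall>i. i \<notin> I \<longrightarrow> lk v i = 0) \<and> (\<forall>i\<in>I. lk v i \<in> S i)"
  unfolding family_sum_def by (auto simp: in_keys_iff)

lemma subspace_family_sum:
  fixes S :: "nat \<Rightarrow> 'a::real_vector set"
  assumes "\<And>i. i \<in> I \<Longrightarrow> subspace (S i)" shows "subspace (family_sum I S)"
proof -
  have 0: "0 \<in> S i" if "i \<in> I" for i using assms[OF that] by (rule subspace_0)
  show ?thesis unfolding subspace_def using assms
    by (auto simp: family_sum_alt[of I S, OF 0] subspace_add subspace_scale subspace_0)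
qed

lemma family_sum_eq_sum_single:
  fixes S :: "nat \<Rightarrow> 'a::real_vector set"
  assumes "v \<in> family_sum I S" "finite I" shows "v = (\<Sum>i\<in>I. sg i (lk v i))"
proof (rule poly_mapping_eqI)
  fix j
  have "lk (\<Sum>i\<in>I. sg i (lk v i)) j = (if j \<in> I then lk v j else 0)"
    using assms(2) by (simp add: lookup_sum lk_sg sum.delta')
  then show "lk v j = lk (\<Sum>i\<in>I. sg i (lk v i)) j"
    using assms(1) by (auto simp: family_sum_def in_keys_iff)
qed

lemma dim_family_sum:
  fixes S :: "nat \<Rightarrow> 'a::real_vector set"
  assumes "finite I" "\<And>i. i \<in> I \<Longrightarrow> fin_dim (S i)"
  shows "fin_dim (family_sum I S) \<and> dim (family_sum I S) = (\<Sum>i\<in>I. dim (S i))"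
  using assms
proof (induction I rule: finite_induct)
  case empty
  have "family_sum {} S = {0}" by (auto simp: family_sum_def)
  then show ?case by simp
next
  case (insert i I)
  have S0: "0 \<in> S j" if "j \<in> insert i I" for j
    using fin_dim_subspace[OF insert.prems[OF that]] by (rule subspace_0)
  have S0': "0 \<in> S j" if "j \<in> I" for j using S0 that by simp
  have fam: "v \<in> family_sum (insert i I) S \<longleftrightarrow>
      (\<forall>j. j \<notin> insert i I \<longrightarrow> lk v j = 0) \<and> (\<forall>j\<in>insert i I. lk v j \<in> S j)"
    "v \<in> family_sum I S \<longleftrightarrow> (\<forall>j. j \<notin> I \<longrightarrow> lk v j = 0) \<and> (\<forall>j\<in>I. lk v j \<in> S j)" for v
    by (rule family_sum_alt, erule S0) (rule family_sum_alt, erule S0')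
  let ?A = "sg i ` S i"
  have fA: "fin_dim ?A" using fin_dim_rank_nullity(1)[OF insert.prems[of i] linear_imp_linear_on[OF linear_sg]] by simp
  have dA: "dim ?A = dim (S i)"
    by (rule fin_dim_image_inj(1)[OF insert.prems[of i] linear_imp_linear_on[OF linear_sg]])
      (auto, metis lk_sg lookup_zero)
  have int: "?A \<inter> family_sum I S = {0}"
  proof
    show "{0} \<subseteq> ?A \<inter> family_sum I S" using S0[of i] by (auto simp: family_sum_def S0 intro!: image_eqI[of _ _ 0])
    show "?A \<inter> family_sum I S \<subseteq> {0}"
    proof
      fix x assume x: "x \<in> ?A \<inter> family_sum I S"
      then obtain y where y: "x = sg i y" by auto
      have "lk x i = 0" using x insert.hyps(2) unfolding family_sum_def Int_iff mem_Collect_eq by (metis in_keys_iff subsetD)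
      then have "y = 0" using y by (simp add: lk_sg)
      then show "x \<in> {0}" using y by simp
    qed
  qed
  have "family_sum (insert i I) S = {x + y | x y. x \<in> ?A \<and> y \<in> family_sum I S}"
  proof (intro set_eqI iffI)
    fix v assume v: "v \<in> family_sum (insert i I) S"
    have "v = sg i (lk v i) + (v - sg i (lk v i))" by simp
    moreover have "v - sg i (lk v i) \<in> family_sum I S"
      using v insert.hyps(2) by (auto simp: fam lk_sg)
    moreover have "sg i (lk v i) \<in> ?A" using v by (auto simp: fam)
    ultimately show "v \<in> {x + y | x y. x \<in> ?A \<and> y \<in> family_sum I S}" by blast
  next
    fix v assume "v \<in> {x + y | x y. x \<in> ?A \<and> y \<in> family_sum I S}"
    then obtain a y where "v = sg i a + y" "a \<in> S i" "y \<in> family_sum I S" by auto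
    then show "v \<in> family_sum (insert i I) S"
      using insert.hyps(2) by (auto simp: fam lk_sg)
  qed
  then show ?case
    using fin_dim_sum[OF fA _ int] insert dA by simp
qed

section \<open>Eigenvectors of complex linear maps on real spaces with a complex structure\<close>

section \<open>Eigenvectors\<close>

lemma fin_dim_real: "fin_dim (UNIV :: real set)"
  unfolding fin_dim_def by (rule exI[of _ "{1}"]) (auto simp: span_singleton image_def)

definition cact :: "('a::real_vector \<Rightarrow> 'a) \<Rightarrow> complex \<Rightarrow> 'a \<Rightarrow> 'a" where
  "cact I z x = Re z *\<^sub>R x + Im z *\<^sub>R I x"

text \<open>The vector \<open>p(T) v\<close> evaluated by Horner's scheme, complex coefficients
  acting through the complex structure \<open>I\<close>.\<close>

definition poly_apply :: "('a::real_vector \<Rightarrow> 'a) \<Rightarrow> ('a \<Rightarrow> 'a) \<Rightarrow> 'a \<Rightarrow> complex poly \<Rightarrow> 'a" where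
  "poly_apply I T v p = fold_coeffs (\<lambda>a w. cact I a v + T w) p 0"

context
  fixes E :: "'a::real_vector set" and I T :: "'a \<Rightarrow> 'a"
  assumes E: "fin_dim E"
    and linI: "linear_on E I" and I: "\<And>x. x \<in> E \<Longrightarrow> I x \<in> E" and II: "\<And>x. x \<in> E \<Longrightarrow> I (I x) = - x"
    and linT: "linear_on E T" and T: "\<And>x. x \<in> E \<Longrightarrow> T x \<in> E" and TI: "\<And>x. x \<in> E \<Longrightarrow> T (I x) = I (T x)"
begin

private lemma subE: "subspace E" using E by (rule fin_dim_subspace)

private lemma cact_in: "x \<in> E \<Longrightarrow> cact I z x \<in> E"
  unfolding cact_def by (intro subspace_add[OF subE] subspace_scale[OF subE] I)

private lemma I_lin: "x \<in> E \<Longrightarrow> y \<in> E \<Longrightarrow> I (x + y) = I x + I y" "x \<in> E \<Longrightarrow> I (c *\<^sub>R x) = c *\<^sub>R I x"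
  using linI unfolding linear_on_def by blast+

private lemma T_lin: "x \<in> E \<Longrightarrow> y \<in> E \<Longrightarrow> T (x + y) = T x + T y" "x \<in> E \<Longrightarrow> T (c *\<^sub>R x) = c *\<^sub>R T x"
  using linT unfolding linear_on_def by blast+

private lemma cact_mult: "x \<in> E \<Longrightarrow> cact I z (cact I w x) = cact I (z * w) x"
  unfolding cact_def using I subspace_scale[OF subE]
  by (simp add: I_lin II algebra_simps)

private lemma cact_add: "x \<in> E \<Longrightarrow> y \<in> E \<Longrightarrow> cact I z (x + y) = cact I z x + cact I z y"
  unfolding cact_def by (simp add: I_lin algebra_simps)

private lemma T_cact: "x \<in> E \<Longrightarrow> T (cact I z x) = cact I z (T x)"
  unfolding cact_def using I T subspace_scale[OF subE] by (simp add: T_lin TI)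

private lemma poly_apply_pCons:
  "poly_apply I T v (pCons a p) = cact I a v + T (poly_apply I T v p)"
proof (cases "a = 0 \<and> p = 0")
  case True
  then show ?thesis using linear_on_zero[OF linT subE] by (simp add: poly_apply_def cact_def)
next
  case False
  then show ?thesis
    by (cases "p = 0") (auto simp: poly_apply_def)
qed

private lemma poly_apply_0: "poly_apply I T v 0 = 0"
  by (simp add: poly_apply_def)

context fixes v assumes v: "v \<in> E"
begin

private lemma poly_apply_in: "poly_apply I T v p \<in> E"
  by (induction p) (auto simp: poly_apply_0 poly_apply_pCons subspace_0[OF subE] v cact_in T
      intro!: subspace_add[OF subE])

private lemma poly_apply_add: "poly_apply I T v (p + q) = poly_apply I T v p + poly_apply I T v q"
proof (induction p q rule: poly_induct2)
  case 0
  then show ?case by (simp add: poly_apply_0)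
next
  case (pCons a p b q)
  have "cact I (a + b) v = cact I a v + cact I b v" by (simp add: cact_def algebra_simps)
  then show ?case using pCons by (simp add: poly_apply_pCons T_lin poly_apply_in)
qed

private lemma poly_apply_smult: "poly_apply I T v (smult c p) = cact I c (poly_apply I T v p)"
proof (induction p)
  case 0
  then show ?case using linear_on_zero[OF linI subE] by (simp add: poly_apply_0 cact_def)
next
  case (pCons a p)
  then show ?case
    by (simp add: poly_apply_pCons cact_add cact_in v T poly_apply_in cact_mult T_cact)
qed

private lemma poly_apply_monom: "poly_apply I T v (monom (of_real c) n) = c *\<^sub>R (T ^^ n) v"
proof (induction n)
  case 0
  then show ?case using linear_on_zero[OF linT subE]
    by (simp add: monom_0 poly_apply_pCons poly_apply_0 cact_def)
next
  case (Suc n)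
  have "(T ^^ n) v \<in> E" for n by (induction n) (auto simp: v T)
  then show ?case using Suc by (simp add: monom_Suc poly_apply_pCons cact_def T_lin)
qed

private lemma poly_apply_sum: "poly_apply I T v (\<Sum>i\<in>A. f i) = (\<Sum>i\<in>A. poly_apply I T v (f i))"
  by (induction A rule: infinite_finite_induct) (auto simp: poly_apply_0 poly_apply_add)

text \<open>The \<open>dim E + 1\<close> vectors \<open>(T ^^ n) v\<close> are linearly dependent
  over the reals: the map \<open>f\<close> that forms their combinations has too large a source to
  be injective. A real relation already suffices as a complex polynomial.\<close>

lemma annihilating_poly: "\<exists>p. p \<noteq> 0 \<and> poly_apply I T v p = 0"
proof -
  let ?F = "family_sum {..<Suc (dim E)} (\<lambda>_. UNIV :: real set)"
  define f where "f c = (\<Sum>n<Suc (dim E). lk c n *\<^sub>R (T ^^ n) v)" for c :: "nat \<Rightarrow>\<^sub>0 real"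
  have Tn: "(T ^^ n) v \<in> E" for n by (induction n) (auto simp: v T)
  have F: "fin_dim ?F" "dim ?F = Suc (dim E)"
    using dim_family_sum[of "{..<Suc (dim E)}" "\<lambda>_. UNIV :: real set"] fin_dim_real by auto
  have lf: "linear_on ?F f"
    by (intro linear_imp_linear_on linearI)
      (simp_all add: f_def scaleR_add_left sum.distrib scaleR_sum_right del: sum.lessThan_Suc)
  have "f ` ?F \<subseteq> E" unfolding f_def
    by (intro image_subsetI subspace_sum[OF subE] subspace_scale[OF subE] Tn)
  then have "dim (f ` ?F) \<le> dim E"
    using fin_dim_subset(2)[OF E linear_on_image_subspace[OF fin_dim_subspace[OF F(1)] lf]] by blast
  then obtain c where c: "c \<in> ?F" "f c = 0" "c \<noteq> 0"
    using fin_dim_image_inj(1)[OF F(1) lf] F(2) by fastforce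
  define p where "p = (\<Sum>n<Suc (dim E). monom (of_real (lk c n) :: complex) n)"
  have "coeff p n = (if n < Suc (dim E) then of_real (lk c n) else 0)" for n
    by (simp add: p_def coeff_sum when_def sum.delta del: sum.lessThan_Suc lessThan_Suc_eq_insert_0 cong: if_cong)
  moreover obtain n where "lk c n \<noteq> 0" using c(3) by (metis lookup_zero poly_mapping_eqI)
  moreover from this have "n < Suc (dim E)" using c(1) by (auto simp: family_sum_def in_keys_iff)
  ultimately have "coeff p n \<noteq> 0" by simp
  then have "p \<noteq> 0" by auto
  moreover have "poly_apply I T v p = 0"
    using c(2) unfolding p_def poly_apply_sum poly_apply_monom f_def .
  ultimately show ?thesis by blast
qed

text \<open>Split off a root, \<open>p = (X - z) q\<close>. Either \<open>q(T) v\<close> is nonzero,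
  and then it is an eigenvector for \<open>z\<close>, or \<open>q\<close> is an annihilating
  polynomial of smaller degree. A nonzero constant cannot annihilate \<open>v\<close>.\<close>

lemma eigenvector_of_annihilating_poly:
  assumes "v \<noteq> 0" "p \<noteq> 0" "poly_apply I T v p = 0"
  shows "\<exists>x z. x \<in> E \<and> x \<noteq> 0 \<and> T x = cact I z x"
  using assms(2,3)
proof (induction "degree p" arbitrary: p)
  case 0
  then obtain c where c: "p = [:c:]" "c \<noteq> 0" by (metis degree_eq_zeroE pCons_0_0)
  then have "cact I c v = 0"
    using 0 linear_on_zero[OF linT subE] by (simp add: poly_apply_pCons poly_apply_0)
  then have "cact I (inverse c) (cact I c v) = 0"
    using linear_on_zero[OF linI subE] by (simp add: cact_def)
  then have "v = 0" using c v by (simp add: cact_mult) (simp add: cact_def)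
  then show ?case using assms(1) by simp
next
  case (Suc d)
  then have "\<not> constant (poly p)" by (simp add: constant_degree)
  then obtain z where "poly p z = 0" using fundamental_theorem_of_algebra by blast
  then obtain q where q: "p = [:-z, 1:] * q" by (metis dvdE poly_eq_0_iff_dvd)
  have q0: "q \<noteq> 0" using Suc q by auto
  have "degree p = degree [:-z, 1:] + degree q"
    unfolding q by (rule degree_mult_eq) (use q0 in auto)
  then have deg: "d = degree q" using Suc.hyps(2) by simp
  have "p = smult (-z) q + pCons 0 q" using q by simp
  then have "poly_apply I T v (smult (-z) q) + poly_apply I T v (pCons 0 q) = 0"
    using Suc.prems(2) poly_apply_add[of "smult (-z) q" "pCons 0 q"] by simp
  then have "cact I (-z) (poly_apply I T v q) + T (poly_apply I T v q) = 0"
    unfolding poly_apply_smult by (simp add: poly_apply_pCons cact_def)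
  then have eq: "T (poly_apply I T v q) = cact I z (poly_apply I T v q)"
    by (simp add: cact_def add_eq_0_iff)
  show ?case
  proof (cases "poly_apply I T v q = 0")
    case True
    then show ?thesis using Suc.hyps(1)[OF deg q0] by blast
  next
    case False
    then show ?thesis using eq poly_apply_in by blast
  qed
qed

end

lemma complex_eigenvector_exists:
  assumes "E \<noteq> {0}"
  obtains x z where "x \<in> E" "x \<noteq> 0" "T x = cact I z x"
proof -
  obtain v where "v \<in> E" "v \<noteq> 0" using assms subspace_0[OF subE] by blast
  then show ?thesis
    using annihilating_poly[of v] eigenvector_of_annihilating_poly[of v] that by blast
qed

end

section \<open>Arithmetic of quaternions and the sphere of imaginary units\<close>

section \<open>Quaternions\<close>

lemma quat_eq_iff: "x = y \<longleftrightarrow> qRe x = qRe y \<and> qI x = qI y \<and> qJ x = qJ y \<and> qK x = qK y"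
  by (auto intro: quat_eqI)

lemma quat_sel [simp]:
  "qRe 0 = 0" "qI 0 = 0" "qJ 0 = 0" "qK 0 = 0"
  "qRe 1 = 1" "qI 1 = 0" "qJ 1 = 0" "qK 1 = 0"
  "qRe (x + y) = qRe x + qRe y" "qI (x + y) = qI x + qI y"
  "qJ (x + y) = qJ x + qJ y" "qK (x + y) = qK x + qK y"
  "qRe (- x) = - qRe x" "qI (- x) = - qI x" "qJ (- x) = - qJ x" "qK (- x) = - qK x"
  "qRe (x - y) = qRe x - qRe y" "qI (x - y) = qI x - qI y"
  "qJ (x - y) = qJ x - qJ y" "qK (x - y) = qK x - qK y"
  "qRe (c *\<^sub>R x) = c * qRe x" "qI (c *\<^sub>R x) = c * qI x"
  "qJ (c *\<^sub>R x) = c * qJ x" "qK (c *\<^sub>R x) = c * qK x"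
  by (simp_all add: zero_quat_def one_quat_def plus_quat_def uminus_quat_def minus_quat_def
      scaleR_quat_def)

lemma quat_mult_sel:
  "qRe (x * y) = qRe x * qRe y - qI x * qI y - qJ x * qJ y - qK x * qK y"
  "qI (x * y) = qRe x * qI y + qI x * qRe y + qJ x * qK y - qK x * qJ y"
  "qJ (x * y) = qRe x * qJ y - qI x * qK y + qJ x * qRe y + qK x * qI y"
  "qK (x * y) = qRe x * qK y + qI x * qJ y - qJ x * qI y + qK x * qRe y"
  by (simp_all add: times_quat_def)

definition qi :: quat where "qi = Quat 0 1 0 0"
definition qk :: quat where "qk = Quat 0 0 0 1"
abbreviation qj :: quat where "qj \<equiv> quat_j"

lemma quat_unit_sel [simp]:
  "qRe qi = 0" "qI qi = 1" "qJ qi = 0" "qK qi = 0"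
  "qRe qj = 0" "qI qj = 0" "qJ qj = 1" "qK qj = 0"
  "qRe qk = 0" "qI qk = 0" "qJ qk = 0" "qK qk = 1"
  by (simp_all add: qi_def quat_j_def qk_def)

definition qcnj :: "quat \<Rightarrow> quat" where "qcnj x = Quat (qRe x) (- qI x) (- qJ x) (- qK x)"

lemma qcnj_sel [simp]:
  "qRe (qcnj x) = qRe x" "qI (qcnj x) = - qI x" "qJ (qcnj x) = - qJ x" "qK (qcnj x) = - qK x"
  by (simp_all add: qcnj_def)

lemma qcnj_qcnj [simp]: "qcnj (qcnj x) = x" by (simp add: quat_eq_iff)

lemma mult_qcnj: "x * qcnj x = (x \<bullet> x) *\<^sub>R 1" "qcnj x * x = (x \<bullet> x) *\<^sub>R 1"
  by (simp_all add: quat_eq_iff quat_mult_sel inner_quat_def)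

lemma quat_inverse:
  assumes "x \<noteq> 0" obtains y :: quat where "y * x = 1" "x * y = 1"
proof -
  have "x \<bullet> x \<noteq> 0" using assms by simp
  then have "(inverse (x \<bullet> x) *\<^sub>R qcnj x) * x = 1" "x * (inverse (x \<bullet> x) *\<^sub>R qcnj x) = 1"
    by (simp_all add: mult_qcnj)
  then show ?thesis using that by blast
qed

lemma inner_mult_left: "(p * x) \<bullet> y = x \<bullet> (qcnj p * y)" "(x * p) \<bullet> y = x \<bullet> (y * qcnj p)"
  by (simp_all add: inner_quat_def quat_mult_sel algebra_simps)

lemma sphere_iff: "p \<in> Im_quat_sphere \<longleftrightarrow> qRe p = 0 \<and> p \<bullet> p = 1"
  by (simp add: Im_quat_sphere_def norm_quat_def)

text \<open>This algebraic form of the sphere makes its invariance under conjugation and under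
  automorphisms immediate. A square root of \<open>-1\<close> with nonzero real part would have
  vanishing imaginary part, hence be real.\<close>

lemma sphere_iff_square: "p \<in> Im_quat_sphere \<longleftrightarrow> p * p = - 1"
proof
  assume "p \<in> Im_quat_sphere"
  then have "qRe p = 0" "qI p * qI p + qJ p * qJ p + qK p * qK p = 1"
    by (auto simp: sphere_iff inner_quat_def)
  then show "p * p = - 1" by (simp add: quat_eq_iff quat_mult_sel algebra_simps)
next
  assume "p * p = - 1"
  then have *: "qRe p * qRe p - qI p * qI p - qJ p * qJ p - qK p * qK p = - 1"
    "qRe p * qI p = 0" "qRe p * qJ p = 0" "qRe p * qK p = 0"
    by (auto simp: quat_eq_iff quat_mult_sel)
  have "qRe p = 0"
  proof (rule ccontr)
    assume "qRe p \<noteq> 0"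
    then have "qRe p * qRe p = - 1" using * by auto
    then show False by (metis not_square_less_zero neg_less_0_iff_less zero_less_one)
  qed
  then show "p \<in> Im_quat_sphere" using * by (simp add: sphere_iff inner_quat_def)
qed

lemma unit_in_sphere [simp]: "qi \<in> Im_quat_sphere" "qj \<in> Im_quat_sphere" "qk \<in> Im_quat_sphere"
  by (simp_all add: sphere_iff inner_quat_def)

lemma sphere_nz: "p \<in> Im_quat_sphere \<Longrightarrow> p \<noteq> 0"
  by (auto simp: sphere_iff)

lemma sphere_qcnj: "p \<in> Im_quat_sphere \<Longrightarrow> qcnj p = - p"
  by (simp add: sphere_iff quat_eq_iff)

lemma dim_quat: "fin_dim (UNIV :: quat set)" "dim (UNIV :: quat set) = 4"
proof -
  let ?F = "family_sum {..<4} (\<lambda>_. UNIV :: real set)"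
  define f where "f c = Quat (lk c 0) (lk c 1) (lk c 2) (lk c 3)" for c :: "nat \<Rightarrow>\<^sub>0 real"
  have F: "fin_dim ?F" "dim ?F = 4"
    using dim_family_sum[of "{..<4}" "\<lambda>_. UNIV :: real set"] fin_dim_real by auto
  have lf: "linear_on ?F f"
    by (intro linear_imp_linear_on linearI) (simp_all add: f_def quat_eq_iff)
  have inj: "c = 0" if "c \<in> ?F" "f c = 0" for c
  proof (rule poly_mapping_eqI)
    fix n
    have "lk c n = 0" if "\<not> n < 4"
      using \<open>c \<in> ?F\<close> that by (auto simp: family_sum_def in_keys_iff)
    moreover have "lk c n = 0" if "n < 4"
    proof -
      have "n = 0 \<or> n = 1 \<or> n = 2 \<or> n = 3" using that by auto
      then show ?thesis using \<open>f c = 0\<close> by (auto simp: f_def quat_eq_iff)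
    qed
    ultimately show "lk c n = lk 0 n" by (cases "n < 4") auto
  qed
  have "f ` ?F = UNIV"
  proof (intro set_eqI iffI UNIV_I)
    fix p
    let ?c = "sg 0 (qRe p) + sg 1 (qI p) + sg 2 (qJ p) + sg (3::nat) (qK p)"
    have "?c \<in> ?F" by (subst family_sum_alt) (auto simp: lk_sg)
    moreover have "f ?c = p" by (simp add: f_def quat_eq_iff lk_sg)
    ultimately show "p \<in> f ` ?F" by (rule image_eqI[OF sym, rotated])
  qed
  then show "fin_dim (UNIV :: quat set)" "dim (UNIV :: quat set) = 4"
    using fin_dim_rank_nullity(1)[OF F(1) lf] fin_dim_image_inj(1)[OF F(1) lf inj] F(2) by auto
qed

lemma quat_space_family_sum: "quat_space m = family_sum {..<m} (\<lambda>_. UNIV)"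
  by (simp add: quat_space_def family_sum_def)

lemma quat_space_iff: "v \<in> quat_space m \<longleftrightarrow> (\<forall>i\<ge>m. lk v i = 0)"
  unfolding quat_space_def by (auto simp: subset_iff in_keys_iff) (metis not_le)

lemma quat_space_subspace: "subspace (quat_space m)"
  unfolding quat_space_family_sum by (rule subspace_family_sum) auto

lemma dim_quat_space: "fin_dim (quat_space m)" "dim (quat_space m) = 4 * m"
  using dim_family_sum[of "{..<m}" "\<lambda>_. UNIV :: quat set"] dim_quat
  by (simp_all add: quat_space_family_sum)

section \<open>Left quaternionic subspaces, and the pairs dual to CR quaternionic spaces\<close>

section \<open>Quaternionic vectors\<close>

type_synonym qvec = "nat \<Rightarrow>\<^sub>0 quat"

definition hsm :: "quat \<Rightarrow> qvec \<Rightarrow> qvec" (infixr "\<star>" 75) where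
  "p \<star> v = Poly_Mapping.map (\<lambda>x. p * x) v"

lemma lk_hsm [simp]: "lk (p \<star> v) i = p * lk v i"
  by (simp add: hsm_def Poly_Mapping.map.rep_eq when_def)

lemma hsm_simps:
  "p \<star> (x + y) = p \<star> x + p \<star> y" "(p + q) \<star> x = p \<star> x + q \<star> x"
  "p \<star> (x - y) = p \<star> x - p \<star> y" "(p - q) \<star> x = p \<star> x - q \<star> x"
  "p \<star> (- x) = - (p \<star> x)" "(- p) \<star> x = - (p \<star> x)"
  "p \<star> (c *\<^sub>R x) = c *\<^sub>R (p \<star> x)" "(c *\<^sub>R p) \<star> x = c *\<^sub>R (p \<star> x)"
  "p \<star> (q \<star> x) = (p * q) \<star> x" "1 \<star> x = x" "0 \<star> x = 0" "p \<star> 0 = 0"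
  by (rule poly_mapping_eqI; simp add: algebra_simps)+

lemma linear_hsm: "linear (\<lambda>x. p \<star> x)" by (rule linearI) (simp_all add: hsm_simps)

lemma hsm_sum: "p \<star> (\<Sum>i\<in>A. f i) = (\<Sum>i\<in>A. p \<star> f i)"
  using linear_sum[OF linear_hsm] by simp

lemma hsm_eq_0: "p \<star> x = 0 \<longleftrightarrow> p = 0 \<or> x = 0"
proof
  assume *: "p \<star> x = 0"
  show "p = 0 \<or> x = 0"
  proof (rule ccontr)
    assume n: "\<not> (p = 0 \<or> x = 0)"
    then obtain y where "y * p = 1" using quat_inverse by blast
    then have "x = y \<star> (p \<star> x)" by (simp add: hsm_simps)
    then show False using * n by (simp add: hsm_simps)
  qed
qed (auto simp: hsm_simps)

lemma hsm_quat_space: "v \<in> quat_space m \<Longrightarrow> p \<star> v \<in> quat_space m"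
  by (simp add: quat_space_iff)

text \<open>The bound by some \<open>quat_space m\<close> ensures finite dimension and places
  \<open>E\<close> inside a space with an inner product.\<close>

definition hsub :: "qvec set \<Rightarrow> bool" where
  "hsub E \<longleftrightarrow> subspace E \<and> (\<exists>m. E \<subseteq> quat_space m) \<and> (\<forall>p. \<forall>x\<in>E. p \<star> x \<in> E)"

definition gpair :: "qvec set \<Rightarrow> qvec set \<Rightarrow> bool" where
  "gpair V E \<longleftrightarrow> hsub E \<and> subspace V \<and> V \<subseteq> E \<and>
     (\<forall>J\<in>Im_quat_sphere. \<forall>x\<in>V. J \<star> x \<in> V \<longrightarrow> x = 0)"

definition hlin :: "qvec set \<Rightarrow> (qvec \<Rightarrow> qvec) \<Rightarrow> bool" where
  "hlin E f \<longleftrightarrow> (\<forall>x\<in>E. \<forall>y\<in>E. f (x + y) = f x + f y) \<and> (\<forall>p. \<forall>x\<in>E. f (p \<star> x) = p \<star> f x)"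

lemma hlinD: "hlin E f \<Longrightarrow> x \<in> E \<Longrightarrow> y \<in> E \<Longrightarrow> f (x + y) = f x + f y"
    "hlin E f \<Longrightarrow> x \<in> E \<Longrightarrow> f (p \<star> x) = p \<star> f x"
  by (simp_all add: hlin_def)

lemma hlin_linear_on: "hlin E f \<Longrightarrow> linear_on E f"
proof -
  assume f: "hlin E f"
  have "f (c *\<^sub>R x) = c *\<^sub>R f x" if "x \<in> E" for c x
    using hlinD(2)[OF f that, of "c *\<^sub>R 1"] by (simp add: hsm_simps)
  then show ?thesis using f by (simp add: hlin_def linear_on_def)
qed

lemma hlin_compose: "hlin E f \<Longrightarrow> f ` E \<subseteq> F \<Longrightarrow> hlin F g \<Longrightarrow> hlin E (\<lambda>x. g (f x))"
  unfolding hlin_def by (simp add: image_subset_iff)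

lemma hsubD:
  assumes "hsub E"
  shows "subspace E" "fin_dim E" "x \<in> E \<Longrightarrow> p \<star> x \<in> E"
proof -
  obtain m where "E \<subseteq> quat_space m" "subspace E" using assms by (auto simp: hsub_def)
  then show "subspace E" "fin_dim E" using fin_dim_subset(1)[OF dim_quat_space(1)] by blast+
  show "x \<in> E \<Longrightarrow> p \<star> x \<in> E" using assms by (auto simp: hsub_def)
qed

lemma hsub_subset: "hsub E \<Longrightarrow> subspace F \<Longrightarrow> F \<subseteq> E \<Longrightarrow> (\<And>p x. x \<in> F \<Longrightarrow> p \<star> x \<in> F) \<Longrightarrow> hsub F"
  unfolding hsub_def by blast

lemma hsub_quat_space: "hsub (quat_space m)"
  using quat_space_subspace hsm_quat_space by (auto simp: hsub_def)

lemma gpairD: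
  assumes "gpair V E"
  shows "hsub E" "subspace V" "V \<subseteq> E" "fin_dim V" "fin_dim E"
    "J \<in> Im_quat_sphere \<Longrightarrow> x \<in> V \<Longrightarrow> J \<star> x \<in> V \<Longrightarrow> x = 0"
proof -
  show 1: "hsub E" "subspace V" "V \<subseteq> E" using assms by (simp_all add: gpair_def)
  show "fin_dim E" by (rule hsubD(2)[OF 1(1)])
  then show "fin_dim V" using fin_dim_subset(1) 1 by blast
  show "J \<in> Im_quat_sphere \<Longrightarrow> x \<in> V \<Longrightarrow> J \<star> x \<in> V \<Longrightarrow> x = 0"
    using assms by (simp add: gpair_def)
qed

lemma gpair_dim_less:
  assumes g: "gpair V E" and E0: "E \<noteq> {0}"
  shows "2 * dim V < dim E"
proof (rule ccontr)
  assume "\<not> 2 * dim V < dim E"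
  then have le: "dim E \<le> 2 * dim V" by simp
  note V = gpairD(2,3,4)[OF g] and E = gpairD(5)[OF g]
  have subE: "subspace E" using E by (rule fin_dim_subspace)
  have hE: "p \<star> x \<in> E" if "x \<in> E" for p x using hsubD(3)[OF gpairD(1)[OF g]] that by blast
  let ?iV = "(\<lambda>x. qi \<star> x) ` V"
  have iV: "fin_dim ?iV" "dim ?iV = dim V"
    using fin_dim_rank_nullity(1)[OF V(3) linear_imp_linear_on[OF linear_hsm]]
      fin_dim_image_inj(1)[OF V(3) linear_imp_linear_on[OF linear_hsm[of qi]]]
      sphere_nz[OF unit_in_sphere(1)]
    by (auto simp: hsm_eq_0)
  have int: "V \<inter> ?iV = {0}"
  proof
    show "{0} \<subseteq> V \<inter> ?iV" using subspace_0[OF V(1)] by (auto simp: hsm_simps intro!: image_eqI[of _ _ 0])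
    show "V \<inter> ?iV \<subseteq> {0}" using gpairD(6)[OF g unit_in_sphere(1)] by (auto simp: hsm_eq_0)
  qed
  let ?W = "{x + y | x y. x \<in> V \<and> y \<in> ?iV}"
  \<comment> \<open>If the inequality fails, \<open>V\<close> and \<open>i V\<close>, which meet in
    \<open>0\<close>, already fill \<open>E\<close>; so every vector is uniquely
    \<open>x + i y\<close> with \<open>x\<close> and \<open>y\<close> in \<open>V\<close>.\<close>
  have W: "?W = E"
  proof (rule fin_dim_subset_eq[OF E])
    show "subspace ?W" using fin_dim_subspace[OF fin_dim_sum(1)[OF V(3) iV(1) int]] .
    show "?W \<subseteq> E" using V(2) by (auto intro!: subspace_add[OF subE] hE)
    show "dim E \<le> dim ?W" using fin_dim_sum(2)[OF V(3) iV(1) int] iV(2) le by simp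
  qed
  have uniq: "x = x' \<and> y = y'"
    if "x \<in> V" "y \<in> V" "x' \<in> V" "y' \<in> V" "x + qi \<star> y = x' + qi \<star> y'" for x y x' y'
  proof -
    have "qi \<star> (y' - y) = x - x'" using that(5) by (simp add: hsm_simps algebra_simps)
    moreover have "x - x' \<in> V" "y' - y \<in> V" using subspace_diff[OF V(1)] that by auto
    ultimately have "y' - y = 0" using gpairD(6)[OF g unit_in_sphere(1), of "y' - y"] by simp
    then show ?thesis using that(5) by simp
  qed
  define P where "P e = (SOME p. fst p \<in> V \<and> snd p \<in> V \<and> e = fst p + qi \<star> snd p)" for e
  have P: "P (x + qi \<star> y) = (x, y)" if "x \<in> V" "y \<in> V" for x y
  proof -
    have "fst (P (x + qi \<star> y)) \<in> V \<and> snd (P (x + qi \<star> y)) \<in> V \<and>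
      x + qi \<star> y = fst (P (x + qi \<star> y)) + qi \<star> snd (P (x + qi \<star> y))"
      unfolding P_def by (rule someI[of _ "(x, y)"]) (use that in auto)
    then show ?thesis using uniq[of x y "fst (P (x + qi \<star> y))" "snd (P (x + qi \<star> y))"] that
      by (auto simp: prod_eq_iff)
  qed
  \<comment> \<open>As \<open>k = - j i\<close>, this is \<open>j\<close> applied to the conjugate
    \<open>x - i y\<close> of \<open>e = x + i y\<close>. Both the conjugation and \<open>j\<close>
    anticommute with \<open>i\<close>, so \<open>T\<close> is complex linear.\<close>
  define T where "T e = qj \<star> fst (P e) + qk \<star> snd (P e)" for e
  have T: "T (x + qi \<star> y) = qj \<star> x + qk \<star> y" if "x \<in> V" "y \<in> V" for x y
    using P[OF that] by (simp add: T_def)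
  have dec: "\<exists>x\<in>V. \<exists>y\<in>V. e = x + qi \<star> y" if "e \<in> E" for e
    using that unfolding W[symmetric] by auto
  have qq: "qi * qj = qk" "qi * qk = - qj" "qi * qi = - 1"
    by (simp_all add: quat_eq_iff quat_mult_sel)
  have linT: "linear_on E T" unfolding linear_on_def
  proof (intro conjI ballI allI)
    fix e e' assume e: "e \<in> E" "e' \<in> E"
    obtain x y where xy: "x \<in> V" "y \<in> V" "e = x + qi \<star> y" using dec[OF e(1)] by blast
    obtain x' y' where xy': "x' \<in> V" "y' \<in> V" "e' = x' + qi \<star> y'" using dec[OF e(2)] by blast
    have eq: "e + e' = (x + x') + qi \<star> (y + y')" using xy xy' by (simp add: hsm_simps)
    have "T (e + e') = qj \<star> (x + x') + qk \<star> (y + y')"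
      unfolding eq using xy xy' by (intro T subspace_add[OF V(1)])
    then show "T (e + e') = T e + T e'" using xy xy' T by (simp add: hsm_simps)
  next
    fix c e assume e: "e \<in> E"
    obtain x y where xy: "x \<in> V" "y \<in> V" "e = x + qi \<star> y" using dec[OF e] by blast
    have eq: "c *\<^sub>R e = c *\<^sub>R x + qi \<star> (c *\<^sub>R y)" using xy by (simp add: hsm_simps algebra_simps)
    have "T (c *\<^sub>R e) = qj \<star> (c *\<^sub>R x) + qk \<star> (c *\<^sub>R y)"
      unfolding eq using xy by (intro T subspace_scale[OF V(1)])
    then show "T (c *\<^sub>R e) = c *\<^sub>R T e" using xy T by (simp add: hsm_simps algebra_simps)
  qed
  have TE: "T e \<in> E" if e: "e \<in> E" for e
  proof -
    obtain x y where xy: "x \<in> V" "y \<in> V" "e = x + qi \<star> y" using dec[OF e] by blast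
    then show ?thesis using T V(2) by (auto intro!: subspace_add[OF subE] hE)
  qed
  have TI: "T (qi \<star> e) = qi \<star> T e" if e: "e \<in> E" for e
  proof -
    obtain x y where xy: "x \<in> V" "y \<in> V" "e = x + qi \<star> y" using dec[OF e] by blast
    have eq: "qi \<star> e = (- y) + qi \<star> x" using xy by (simp add: hsm_simps qq)
    have "T (qi \<star> e) = qj \<star> (- y) + qk \<star> x"
      unfolding eq using xy by (intro T subspace_neg[OF V(1)])
    also have "\<dots> = qi \<star> T e" using xy T by (simp add: hsm_simps qq)
    finally show ?thesis .
  qed
  obtain e z where e: "e \<in> E" "e \<noteq> 0" "T e = cact (\<lambda>x. qi \<star> x) z e"
    by (rule complex_eigenvector_exists[OF E linear_imp_linear_on[OF linear_hsm[of qi]] _ _ linT TE TI E0])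
      (auto simp: hsm_simps qq intro: hE)
  obtain x y where xy: "x \<in> V" "y \<in> V" "e = x + qi \<star> y" using dec[OF e(1)] by blast
  \<comment> \<open>The eigenvalue equation \<open>j x + k y = z (x + i y)\<close> rearranges to
    \<open>u x = - i u y\<close> with \<open>u = j - z\<close>. Hence \<open>x = J y\<close>, where
    \<open>J\<close> is the conjugate of \<open>- i\<close> by \<open>u\<close>, again an imaginary
    unit; so \<open>y\<close> and \<open>J y\<close> both lie in \<open>V\<close>.\<close>
  define u where "u = qj - Quat (Re z) (Im z) 0 0"
  have "u \<noteq> 0" by (simp add: u_def quat_eq_iff)
  then obtain w where w: "w * u = 1" "u * w = 1" using quat_inverse by blast
  define J where "J = - (w * qi * u)"
  have "J * J = w * qi * (u * w) * qi * u" by (simp add: J_def mult.assoc)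
  also have "\<dots> = - 1" using w by (simp add: mult.assoc) (simp add: mult.assoc[symmetric] qq w)
  finally have J: "J \<in> Im_quat_sphere" by (simp add: sphere_iff_square)
  have "qj \<star> x + qk \<star> y = Quat (Re z) (Im z) 0 0 \<star> e"
  proof -
    have "Quat (Re z) (Im z) 0 0 = Re z *\<^sub>R 1 + Im z *\<^sub>R qi" by (simp add: quat_eq_iff)
    then have "Quat (Re z) (Im z) 0 0 \<star> e = cact (\<lambda>x. qi \<star> x) z e" by (simp add: cact_def hsm_simps)
    then show ?thesis using e(3) T xy by simp
  qed
  then have "qj \<star> x + qk \<star> y = Quat (Re z) (Im z) 0 0 \<star> x + (Quat (Re z) (Im z) 0 0 * qi) \<star> y"
    using xy by (simp add: hsm_simps)
  then have "u \<star> x = (Quat (Re z) (Im z) 0 0 * qi - qk) \<star> y" by (simp add: u_def hsm_simps algebra_simps)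
  moreover have "- (qi * u) = Quat (Re z) (Im z) 0 0 * qi - qk"
    by (simp add: u_def quat_eq_iff quat_mult_sel)
  ultimately have "u \<star> x = (- (qi * u)) \<star> y" by simp
  then have "w \<star> (u \<star> x) = w \<star> ((- (qi * u)) \<star> y)" by simp
  then have "x = J \<star> y" by (simp add: hsm_simps w J_def mult.assoc)
  then have "y = 0" using gpairD(6)[OF g J xy(2)] xy(1) by simp
  then show False using \<open>x = J \<star> y\<close> xy(3) e(2) by (simp add: hsm_simps)
qed

section \<open>Orthogonal complements inside the standard quaternionic spaces\<close>

section \<open>Orthogonal complements\<close>

definition ip :: "nat \<Rightarrow> qvec \<Rightarrow> qvec \<Rightarrow> real" where
  "ip m u v = (\<Sum>i<m. lk u i \<bullet> lk v i)"

lemma ip_simps: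
  "ip m (x + y) v = ip m x v + ip m y v" "ip m v (x + y) = ip m v x + ip m v y"
  "ip m (x - y) v = ip m x v - ip m y v" "ip m v (x - y) = ip m v x - ip m v y"
  "ip m (c *\<^sub>R x) v = c * ip m x v" "ip m v (c *\<^sub>R x) = c * ip m v x"
  "ip m 0 v = 0" "ip m v 0 = 0"
  by (simp_all add: ip_def inner_add_left inner_add_right inner_diff_left inner_diff_right
      sum.distrib sum_subtractf sum_distrib_left)

lemma ip_commute: "ip m u v = ip m v u"
  by (simp add: ip_def inner_commute)

lemma ip_hsm: "ip m (p \<star> u) v = ip m u (qcnj p \<star> v)"
  by (simp add: ip_def inner_mult_left)

lemma ip_self_eq_0: "u \<in> quat_space m \<Longrightarrow> ip m u u = 0 \<longleftrightarrow> u = 0"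
proof
  assume u: "u \<in> quat_space m" and "ip m u u = 0"
  then have "\<forall>i\<in>{..<m}. lk u i \<bullet> lk u i = 0"
    unfolding ip_def by (subst (asm) sum_nonneg_eq_0_iff) auto
  then have "lk u i = 0" for i using u by (cases "i < m") (auto simp: quat_space_iff)
  then show "u = 0" by (intro poly_mapping_eqI) simp
qed (simp add: ip_simps)

lemma ip_nondegenerate: "u \<in> quat_space m \<Longrightarrow> (\<And>v. v \<in> quat_space m \<Longrightarrow> ip m u v = 0) \<Longrightarrow> u = 0"
  using ip_self_eq_0 by blast

lemma orth_compl_iff: "u \<in> orth_compl m V \<longleftrightarrow> u \<in> quat_space m \<and> (\<forall>v\<in>V. ip m u v = 0)"
  by (simp add: orth_compl_def ip_def)

lemma orth_compl_subspace: "subspace (orth_compl m V)"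
  using quat_space_subspace[of m]
  by (auto simp: subspace_def orth_compl_iff ip_simps)

lemma orth_compl_fin_dim: "fin_dim (orth_compl m V)"
  by (rule fin_dim_subset(1)[OF dim_quat_space(1) orth_compl_subspace]) (auto simp: orth_compl_iff)

text \<open>Positive definiteness gives trivial intersection. Conversely the complement is the
  kernel of \<open>f\<close>, whose image lies in \<open>V\<close>, so rank-nullity bounds its
  dimension from below.\<close>

lemma
  assumes V: "subspace V" "V \<subseteq> quat_space m"
  shows orth_compl_Int: "V \<inter> orth_compl m V = {0}"
    and orth_compl_decomp: "{x + y | x y. x \<in> V \<and> y \<in> orth_compl m V} = quat_space m"
    and dim_orth_compl: "dim V + dim (orth_compl m V) = 4 * m"
proof -
  let ?C = "orth_compl m V"
  have fV: "fin_dim V" using fin_dim_subset(1)[OF dim_quat_space(1) V] .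
  show int: "V \<inter> ?C = {0}"
  proof
    have "x = 0" if "x \<in> V" "x \<in> ?C" for x
      using that ip_self_eq_0[of x m] unfolding orth_compl_iff by blast
    then show "V \<inter> ?C \<subseteq> {0}" by blast
    show "{0} \<subseteq> V \<inter> ?C" using subspace_0[OF V(1)] subspace_0[OF orth_compl_subspace] by blast
  qed
  obtain B where B: "finite B" "B \<subseteq> V" "independent B" "V = span B"
    using fin_dim_basis[OF fV] by metis
  \<comment> \<open>The basis need not be orthonormal: independence of \<open>B\<close> alone shows
    that \<open>f u = 0\<close> forces every coefficient \<open>ip m u b\<close> to vanish.\<close>
  define f where "f u = (\<Sum>b\<in>B. ip m u b *\<^sub>R b)" for u
  have lf: "linear_on (quat_space m) f"
    by (intro linear_imp_linear_on linearI)
      (simp_all add: f_def ip_simps scaleR_add_left sum.distrib scaleR_sum_right)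
  have ker: "{u \<in> quat_space m. f u = 0} = ?C"
  proof (intro set_eqI iffI)
    fix u assume u: "u \<in> {u \<in> quat_space m. f u = 0}"
    then have b: "ip m u b = 0" if "b \<in> B" for b
      using independentD[OF B(3,1) subset_refl, of "ip m u"] that by (simp add: f_def)
    have "linear (ip m u)" by (rule linearI) (simp_all add: ip_simps)
    then have "ip m u v = 0" if "v \<in> V" for v
      using linear_eq_0_on_span[of "ip m u" B v] b that B(4) by blast
    then show "u \<in> ?C" using u by (simp add: orth_compl_iff)
  next
    fix u assume "u \<in> ?C"
    then show "u \<in> {u \<in> quat_space m. f u = 0}"
      using B(2) by (auto simp: orth_compl_iff f_def intro!: sum.neutral)
  qed
  have "f ` quat_space m \<subseteq> V" unfolding f_def
    by (intro image_subsetI subspace_sum[OF V(1)] subspace_scale[OF V(1)]) (use B(2) in auto)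
  then have "dim (f ` quat_space m) \<le> dim V"
    using fin_dim_subset(2)[OF fV fin_dim_subspace[OF fin_dim_rank_nullity(1)[OF dim_quat_space(1) lf]]]
    by blast
  then have ge: "4 * m \<le> dim V + dim ?C"
    using fin_dim_rank_nullity(2)[OF dim_quat_space(1) lf] by (simp add: ker dim_quat_space)
  note s = fin_dim_sum[OF fV orth_compl_fin_dim int]
  let ?W = "{x + y | x y. x \<in> V \<and> y \<in> ?C}"
  have "?W \<subseteq> quat_space m"
    using V(2) by (auto simp: orth_compl_iff intro!: subspace_add[OF quat_space_subspace])
  then show W: "?W = quat_space m"
    using ge s by (intro fin_dim_subset_eq[OF dim_quat_space(1)]) (auto simp: dim_quat_space fin_dim_subspace)
  show "dim V + dim ?C = 4 * m" using s(2) dim_quat_space(2)[of m] unfolding W by simp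
qed

lemma orth_compl_orth_compl:
  assumes V: "subspace V" "V \<subseteq> quat_space m"
  shows "orth_compl m (orth_compl m V) = V"
proof -
  have s: "orth_compl m V \<subseteq> quat_space m" by (auto simp: orth_compl_iff)
  have "V \<subseteq> orth_compl m (orth_compl m V)"
    using V(2) ip_commute by (force simp: orth_compl_iff)
  then show ?thesis
    using dim_orth_compl[OF V] dim_orth_compl[OF orth_compl_subspace s]
    by (intro fin_dim_subset_eq[OF orth_compl_fin_dim V(1), symmetric]) auto
qed

text \<open>The adjoint of left multiplication by \<open>p\<close> is left multiplication by its
  conjugate, so the orthogonal complement of a left quaternionic subspace is one too.\<close>

lemma hsub_complement:
  assumes "hsub A" "hsub E" "A \<subseteq> E"
  obtains C where "hsub C" "C \<subseteq> E" "A \<inter> C = {0}" "E = {x + y | x y. x \<in> A \<and> y \<in> C}"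
proof -
  obtain m where m: "E \<subseteq> quat_space m" using assms by (auto simp: hsub_def)
  note A = hsubD[OF assms(1)] and E = hsubD[OF assms(2)]
  have Am: "A \<subseteq> quat_space m" using m assms by blast
  let ?C = "orth_compl m A \<inter> E"
  have sC: "subspace ?C" by (rule subspace_inter[OF orth_compl_subspace E(1)])
  have "p \<star> x \<in> ?C" if "x \<in> ?C" for p x
    using that E(3) A(3) by (auto simp: orth_compl_iff ip_hsm hsm_quat_space)
  then have "hsub ?C" by (intro hsub_subset[OF assms(2) sC]) auto
  moreover have "A \<inter> ?C = {0}"
    using orth_compl_Int[OF A(1) Am] subspace_0[OF E(1)] by blast
  moreover have "E = {x + y | x y. x \<in> A \<and> y \<in> ?C}"
  proof
    show "{x + y | x y. x \<in> A \<and> y \<in> ?C} \<subseteq> E"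
      using assms(3) by (auto intro!: subspace_add[OF E(1)])
    show "E \<subseteq> {x + y | x y. x \<in> A \<and> y \<in> ?C}"
    proof
      fix e assume e: "e \<in> E"
      then obtain x y where xy: "e = x + y" "x \<in> A" "y \<in> orth_compl m A"
        using m orth_compl_decomp[OF A(1) Am] by blast
      then have "y = e - x" by simp
      then have "y \<in> E" using xy(2) assms(3) e subspace_diff[OF E(1)] by blast
      then show "e \<in> {x + y | x y. x \<in> A \<and> y \<in> ?C}" using xy by blast
    qed
  qed
  ultimately show ?thesis using that[of ?C] by blast
qed

section \<open>The syzygy construction and its inverse on regular pairs\<close>

section \<open>Syzygies\<close>

text \<open>Indexing the basis by \<open>l < d\<close> lets elements of the tensor product of the
  quaternions with \<open>V\<close> be coefficient vectors in \<open>quat_space d\<close>.\<close>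

definition bas :: "nat \<Rightarrow> (nat \<Rightarrow> 'a::real_vector) \<Rightarrow> 'a set \<Rightarrow> bool" where
  "bas d b V \<longleftrightarrow> (\<forall>c. (\<Sum>l<d. c l *\<^sub>R b l) = 0 \<longrightarrow> (\<forall>l<d. c l = 0)) \<and> V = {\<Sum>l<d. c l *\<^sub>R b l | c. True}"

lemma bas_exists:
  fixes V :: "'a::real_vector set"
  assumes "fin_dim V" obtains b where "bas (dim V) b V"
proof -
  obtain B where B: "finite B" "B \<subseteq> V" "independent B" "V = span B" "card B = dim V"
    using fin_dim_basis[OF assms] by metis
  obtain b where b: "bij_betw b {0..<card B} B" using ex_bij_betw_nat_finite[OF B(1)] by blast
  then have b: "bij_betw b {..<dim V} B" using B(5) by (simp add: atLeast0LessThan)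
  have sum: "(\<Sum>l<dim V. c (b l) *\<^sub>R b l) = (\<Sum>x\<in>B. c x *\<^sub>R x)" for c
    by (rule sum.reindex_bij_betw[OF b])
  have inv: "inv_into {..<dim V} b (b l) = l" if "l < dim V" for l
    using bij_betw_inv_into_left[OF b] that by simp
  have sum': "(\<Sum>l<dim V. c l *\<^sub>R b l) = (\<Sum>x\<in>B. c (inv_into {..<dim V} b x) *\<^sub>R x)" for c
    unfolding sum[symmetric] using inv by (intro sum.cong) auto
  have "bas (dim V) b V" unfolding bas_def
  proof (intro conjI allI impI)
    fix c l assume c: "(\<Sum>l<dim V. c l *\<^sub>R b l) = 0" and l: "l < dim V"
    have "b l \<in> B" using b l by (auto simp: bij_betw_def)
    then have "c (inv_into {..<dim V} b (b l)) = 0"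
      using independentD[OF B(3,1) subset_refl c[unfolded sum']] by blast
    then show "c l = 0" using inv[OF l] by simp
  next
    have "V = range (\<lambda>c. \<Sum>x\<in>B. c x *\<^sub>R x)" using B(4) span_finite[OF B(1)] by simp
    also have "\<dots> = {\<Sum>l<dim V. c l *\<^sub>R b l | c. True}"
    proof (intro set_eqI iffI)
      fix x assume "x \<in> range (\<lambda>c. \<Sum>x\<in>B. c x *\<^sub>R x)"
      then obtain c where "x = (\<Sum>l<dim V. c (b l) *\<^sub>R b l)" unfolding sum by blast
      then show "x \<in> {\<Sum>l<dim V. c l *\<^sub>R b l | c. True}" by (intro CollectI exI[of _ "\<lambda>l. c (b l)"]) simp
    next
      fix x assume "x \<in> {\<Sum>l<dim V. c l *\<^sub>R b l | c. True}"
      then obtain c where "x = (\<Sum>l<dim V. c l *\<^sub>R b l)" by blast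
      then show "x \<in> range (\<lambda>c. \<Sum>x\<in>B. c x *\<^sub>R x)"
        unfolding sum' by (intro range_eqI[of _ _ "\<lambda>x. c (inv_into {..<dim V} b x)"]) simp
    qed
    finally show "V = {\<Sum>l<dim V. c l *\<^sub>R b l | c. True}" .
  qed
  then show ?thesis by (rule that)
qed

lemma basD:
  assumes "bas d b V"
  shows "(\<Sum>l<d. c l *\<^sub>R b l) = 0 \<Longrightarrow> l < d \<Longrightarrow> c l = 0"
    "v \<in> V \<Longrightarrow> \<exists>c. v = (\<Sum>l<d. c l *\<^sub>R b l)" "(\<Sum>l<d. c l *\<^sub>R b l) \<in> V"
  using assms unfolding bas_def by blast+

lemma bas_in:
  assumes "bas d b V" "l < d" shows "b l \<in> V"
proof -
  have "(\<Sum>i<d. (if i = l then 1 else 0) *\<^sub>R b i) = b l"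
    using assms(2) by (simp add: if_distrib[of "\<lambda>x. x *\<^sub>R _"] sum.delta cong: if_cong)
  then show ?thesis using basD(3)[OF assms(1), of "\<lambda>i. if i = l then 1 else 0"] by simp
qed

text \<open>A basis \<open>b\<close> of \<open>V\<close> identifies \<open>\<H> \<otimes> V\<close> with \<open>\<H>\<^sup>d\<close>; then \<open>kap\<close> is the map \<open>\<H> \<otimes> V \<rightarrow> E\<close> and \<open>rho\<close> is
  the real part \<open>\<H> \<otimes> V \<rightarrow> V\<close>.\<close>

definition kap :: "nat \<Rightarrow> (nat \<Rightarrow> qvec) \<Rightarrow> qvec \<Rightarrow> qvec" where
  "kap d b g = (\<Sum>l<d. lk g l \<star> b l)"

definition rho :: "nat \<Rightarrow> (nat \<Rightarrow> qvec) \<Rightarrow> qvec \<Rightarrow> qvec" where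
  "rho d b g = (\<Sum>l<d. qRe (lk g l) *\<^sub>R b l)"

lemma linear_rho: "linear (rho d b)"
  by (rule linearI) (simp_all add: rho_def scaleR_add_left sum.distrib scaleR_sum_right)

lemma rho_simps: "rho d b (x + y) = rho d b x + rho d b y" "rho d b (x - y) = rho d b x - rho d b y"
  "rho d b 0 = 0" "rho d b (- x) = - rho d b x" "rho d b (c *\<^sub>R x) = c *\<^sub>R rho d b x"
  using linear_rho[of d b] by (simp_all add: linear_add linear_diff linear_0 linear_neg linear_scale)

lemma kap_simps: "kap d b (x + y) = kap d b x + kap d b y" "kap d b (x - y) = kap d b x - kap d b y"
  "kap d b (p \<star> x) = p \<star> kap d b x" "kap d b 0 = 0"
  by (simp_all add: kap_def hsm_simps sum.distrib sum_subtractf hsm_sum)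

lemma hlin_kap: "hlin E (kap d b)"
  by (simp add: hlin_def kap_simps)

text \<open>Every quaternion satisfies
  \<open>x = Re x - i Re (i x) - j Re (j x) - k Re (k x)\<close>. Thus \<open>kap\<close> is
  determined by the real parts along a quaternionic orbit, and maps that respect \<open>rho\<close>
  on orbits respect \<open>kap\<close>.\<close>

lemma kap_rho:
  "kap d b g = rho d b g - qi \<star> rho d b (qi \<star> g) - qj \<star> rho d b (qj \<star> g) - qk \<star> rho d b (qk \<star> g)"
proof -
  have "lk g l \<star> b l = qRe (lk g l) *\<^sub>R b l - qi \<star> (qRe (qi * lk g l) *\<^sub>R b l)
     - qj \<star> (qRe (qj * lk g l) *\<^sub>R b l) - qk \<star> (qRe (qk * lk g l) *\<^sub>R b l)" for l
  proof -
    have "lk g l = qRe (lk g l) *\<^sub>R 1 - qRe (qi * lk g l) *\<^sub>R qi - qRe (qj * lk g l) *\<^sub>R qj - qRe (qk * lk g l) *\<^sub>R qk"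
      by (simp add: quat_eq_iff quat_mult_sel)
    then have "lk g l \<star> b l = (qRe (lk g l) *\<^sub>R 1 - qRe (qi * lk g l) *\<^sub>R qi - qRe (qj * lk g l) *\<^sub>R qj - qRe (qk * lk g l) *\<^sub>R qk) \<star> b l"
      by simp
    then show ?thesis by (simp add: hsm_simps)
  qed
  then show ?thesis by (simp add: kap_def rho_def hsm_sum sum_subtractf)
qed

lemma rho_in: "bas d b V \<Longrightarrow> rho d b g \<in> V"
  unfolding rho_def by (rule basD(3))

lemma rho_eq_0: "bas d b V \<Longrightarrow> rho d b g = 0 \<Longrightarrow> l < d \<Longrightarrow> qRe (lk g l) = 0"
  unfolding rho_def using basD(1)[of d b V "\<lambda>l. qRe (lk g l)"] by blast

text \<open>With \<open>p\<close> the conjugate of the \<open>l\<close>-th coordinate, the real part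
  of \<open>p * lk g l\<close> is the squared norm of that coordinate.\<close>

lemma rho_separates:
  assumes "bas d b V" "g \<in> quat_space d" "\<And>p. rho d b (p \<star> g) = 0"
  shows "g = 0"
proof (rule poly_mapping_eqI)
  fix l
  show "lk g l = lk 0 l"
  proof (cases "l < d")
    case True
    have "qRe (p * lk g l) = 0" for p
      using rho_eq_0[OF assms(1) assms(3)[of p] True] by simp
    from this[of "qcnj (lk g l)"] have "lk g l \<bullet> lk g l = 0" by (simp add: mult_qcnj)
    then show ?thesis by simp
  next
    case False
    then show ?thesis using assms(2) by (simp add: quat_space_iff)
  qed
qed

text \<open>The lift of \<open>v\<close> is \<open>1 \<otimes> v\<close>, whose coordinates are all
  real.\<close>

lemma bas_coord:
  assumes "bas d b V" "v \<in> V"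
  obtains g where "g \<in> quat_space d" "kap d b g = v" "\<forall>p. rho d b (p \<star> g) = qRe p *\<^sub>R v"
proof -
  obtain c where c: "v = (\<Sum>l<d. c l *\<^sub>R b l)" using basD(2)[OF assms] by blast
  define g where "g = (\<Sum>l<d. sg l (c l *\<^sub>R (1::quat)))"
  have lk: "lk g l = (if l < d then c l *\<^sub>R 1 else 0)" for l
    by (simp add: g_def lookup_sum lk_sg)
  have "g \<in> quat_space d" by (simp add: quat_space_iff lk)
  moreover have "kap d b g = v" unfolding kap_def c
    by (intro sum.cong) (auto simp: lk hsm_simps)
  moreover have "\<forall>p. rho d b (p \<star> g) = qRe p *\<^sub>R v"
    unfolding rho_def c scaleR_sum_right
    by (intro allI sum.cong) (auto simp: lk mult.commute)
  ultimately show ?thesis by (rule that)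
qed

text \<open>The \<open>G\<close> of the overview, with \<open>SZ0\<close> as its
  \<open>G\<^sub>0\<close>, in coordinates with respect to the chosen basis \<open>b\<close> of
  \<open>V\<close>.\<close>

definition SZ :: "nat \<Rightarrow> (nat \<Rightarrow> qvec) \<Rightarrow> qvec set" where
  "SZ d b = {g \<in> quat_space d. kap d b g = 0}"

definition SZ0 :: "nat \<Rightarrow> (nat \<Rightarrow> qvec) \<Rightarrow> qvec set" where
  "SZ0 d b = {g \<in> SZ d b. rho d b g = 0}"

lemma kap_in: "hsub E \<Longrightarrow> V \<subseteq> E \<Longrightarrow> bas d b V \<Longrightarrow> kap d b g \<in> E"
  unfolding kap_def using bas_in by (intro subspace_sum hsubD) blast+

lemma hsub_SZ: "hsub (SZ d b)"
proof (rule hsub_subset[OF hsub_quat_space])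
  show "SZ d b \<subseteq> quat_space d" by (auto simp: SZ_def)
  show "subspace (SZ d b)"
    unfolding SZ_def by (rule linear_on_kernel_subspace[OF quat_space_subspace hlin_linear_on[OF hlin_kap]])
  show "p \<star> x \<in> SZ d b" if "x \<in> SZ d b" for p x
    using that by (simp add: SZ_def hsm_quat_space kap_simps hsm_simps)
qed

lemma subspace_SZ0: "subspace (SZ0 d b)"
  unfolding SZ0_def
  by (rule linear_on_kernel_subspace[OF hsubD(1)[OF hsub_SZ] linear_imp_linear_on[OF linear_rho]])

lemma sphere_anticommute:
  assumes "qRe w = 0" "qRe J = 0" "qRe (J * w) = 0" shows "w * J = - (J * w)"
  using assms by (simp add: quat_eq_iff quat_mult_sel algebra_simps)

text \<open>Commuting with \<open>J\<close> means that the cross product of the imaginary parts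
  vanishes, so the imaginary part of \<open>u\<close> is a multiple of \<open>J\<close>; since
  \<open>J\<close> has length one, the factor is the inner product \<open>t\<close>.\<close>

lemma sphere_centralizer:
  assumes J: "J \<in> Im_quat_sphere" and c: "u * J = J * u"
  shows "\<exists>x y. u = x *\<^sub>R 1 + y *\<^sub>R J"
proof -
  define t where "t = qI J * qI u + qJ J * qJ u + qK J * qK u"
  have J0: "qRe J = 0" and n: "qI J * qI J + qJ J * qJ J + qK J * qK J = 1"
    using J by (auto simp: sphere_iff inner_quat_def)
  have x: "qJ J * qK u = qK J * qJ u" "qK J * qI u = qI J * qK u" "qI J * qJ u = qJ J * qI u"
    using c J0 by (auto simp: quat_eq_iff quat_mult_sel algebra_simps)
  have "qI u = (qI J * qI J + qJ J * qJ J + qK J * qK J) * qI u" using n by simp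
  also have "\<dots> = t * qI J" unfolding t_def using x by algebra
  finally have 1: "qI u = t * qI J" .
  have "qJ u = (qI J * qI J + qJ J * qJ J + qK J * qK J) * qJ u" using n by simp
  also have "\<dots> = t * qJ J" unfolding t_def using x by algebra
  finally have 2: "qJ u = t * qJ J" .
  have "qK u = (qI J * qI J + qJ J * qJ J + qK J * qK J) * qK u" using n by simp
  also have "\<dots> = t * qK J" unfolding t_def using x by algebra
  finally have 3: "qK u = t * qK J" .
  have "u = qRe u *\<^sub>R 1 + t *\<^sub>R J" using 1 2 3 J0 by (simp add: quat_eq_iff)
  then show ?thesis by blast
qed

text \<open>If \<open>w\<close> and \<open>J w\<close> are both purely imaginary, all entries of \<open>w\<close> anticommute with \<open>J\<close>, so
  after multiplication by one of them the entries lie in \<open>\<real> + \<real> J\<close>.\<close>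

lemma gpair_SZ:
  assumes g: "gpair V E" and b: "bas d b V"
  shows "gpair (SZ0 d b) (SZ d b)"
  unfolding gpair_def
proof (intro conjI ballI impI)
  show "hsub (SZ d b)" by (rule hsub_SZ)
  show "subspace (SZ0 d b)" by (rule subspace_SZ0)
  show "SZ0 d b \<subseteq> SZ d b" by (auto simp: SZ0_def)
next
  fix J w assume J: "J \<in> Im_quat_sphere" and w: "w \<in> SZ0 d b" and Jw: "J \<star> w \<in> SZ0 d b"
  have wq: "w \<in> quat_space d" and wk: "kap d b w = 0" using w by (auto simp: SZ0_def SZ_def)
  have re: "qRe (lk w l) = 0" "qRe (J * lk w l) = 0" if "l < d" for l
    using rho_eq_0[OF b _ that] w Jw by (auto simp: SZ0_def) (metis lk_hsm)
  have anti: "lk w l * J = - (J * lk w l)" if "l < d" for l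
    using sphere_anticommute[OF re(1)[OF that] _ re(2)[OF that]] J by (simp add: sphere_iff)
  show "w = 0"
  proof (rule ccontr)
    assume "w \<noteq> 0"
    then obtain l0 where l0: "lk w l0 \<noteq> 0" by (metis lookup_zero poly_mapping_eqI)
    then have l0d: "l0 < d" using wq by (metis not_le quat_space_iff)
    obtain k where k: "k * lk w l0 = 1" "lk w l0 * k = 1" using quat_inverse[OF l0] by blast
    \<comment> \<open>The inverse \<open>k\<close> of an entry also anticommutes with
      \<open>J\<close>, so \<open>k\<close> times any entry commutes with \<open>J\<close>.\<close>
    have kJ: "k * J = - (J * k)"
    proof -
      have "k * J = k * J * (lk w l0 * k)" using k by simp
      also have "\<dots> = k * (J * lk w l0) * k" by (simp add: mult.assoc)
      also have "J * lk w l0 = - (lk w l0 * J)" using anti[OF l0d] by simp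
      also have "k * (- (lk w l0 * J)) * k = - ((k * lk w l0) * J * k)" by (simp add: mult.assoc)
      finally show ?thesis using k by simp
    qed
    have "\<exists>x y. k * lk w l = x *\<^sub>R 1 + y *\<^sub>R J" if "l < d" for l
    proof (rule sphere_centralizer[OF J])
      have "k * lk w l * J = - (k * J * lk w l)" using anti[OF that] by (simp add: mult.assoc)
      also have "\<dots> = J * (k * lk w l)" unfolding kJ by (simp add: mult.assoc)
      finally show "k * lk w l * J = J * (k * lk w l)" .
    qed
    then obtain x y where xy: "\<And>l. l < d \<Longrightarrow> k * lk w l = x l *\<^sub>R 1 + y l *\<^sub>R J" by metis
    have "k \<star> kap d b w = (\<Sum>l<d. (k * lk w l) \<star> b l)"
      by (simp add: kap_def hsm_sum hsm_simps)
    also have "\<dots> = (\<Sum>l<d. x l *\<^sub>R b l + J \<star> (y l *\<^sub>R b l))"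
      by (rule sum.cong) (auto simp: xy hsm_simps)
    also have "\<dots> = (\<Sum>l<d. x l *\<^sub>R b l) + J \<star> (\<Sum>l<d. y l *\<^sub>R b l)"
      by (simp add: sum.distrib hsm_sum)
    \<comment> \<open>Multiplying the relation \<open>kap d b w = 0\<close> by \<open>k\<close>
      writes it as \<open>x + J y = 0\<close> with \<open>x\<close> and \<open>y\<close> in
      \<open>V\<close>; the defining property of the pair then forces \<open>y = 0\<close>, hence
      \<open>x = 0\<close>.\<close>
    finally have eq: "J \<star> (\<Sum>l<d. y l *\<^sub>R b l) = - (\<Sum>l<d. x l *\<^sub>R b l)"
      using wk by (simp add: hsm_simps eq_neg_iff_add_eq_0 add.commute)
    have "- (\<Sum>l<d. x l *\<^sub>R b l) \<in> V" using basD(3)[OF b] gpairD(2)[OF g] by (simp add: subspace_neg)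
    then have y0: "(\<Sum>l<d. y l *\<^sub>R b l) = 0"
      using gpairD(6)[OF g J basD(3)[OF b]] eq by metis
    then have x0: "(\<Sum>l<d. x l *\<^sub>R b l) = 0" using eq by (simp add: hsm_simps)
    have "k * lk w l0 = 0" using xy[OF l0d] basD(1)[OF b x0 l0d] basD(1)[OF b y0 l0d] by simp
    then show False using k by simp
  qed
qed

lemma dim_SZ: "dim (kap d b ` quat_space d) + dim (SZ d b) = 4 * d"
  using fin_dim_rank_nullity(2)[OF dim_quat_space(1) hlin_linear_on[OF hlin_kap], of d d b]
  by (simp add: SZ_def dim_quat_space)

lemma dim_SZ0: "dim (rho d b ` SZ d b) + dim (SZ0 d b) = dim (SZ d b)"
  using fin_dim_rank_nullity(2)[OF hsubD(2)[OF hsub_SZ] linear_imp_linear_on[OF linear_rho], of d b d b]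
  by (simp add: SZ0_def)

lemma hsub_kap_image: "hsub E \<Longrightarrow> V \<subseteq> E \<Longrightarrow> bas d b V \<Longrightarrow> hsub (kap d b ` quat_space d)"
proof (rule hsub_subset)
  assume *: "hsub E" "V \<subseteq> E" "bas d b V"
  show "kap d b ` quat_space d \<subseteq> E" using kap_in[OF *] by blast
  show "subspace (kap d b ` quat_space d)"
    by (rule linear_on_image_subspace[OF quat_space_subspace hlin_linear_on[OF hlin_kap]])
  show "p \<star> x \<in> kap d b ` quat_space d" if "x \<in> kap d b ` quat_space d" for p x
    using that hsm_quat_space by (auto simp: kap_simps(3)[symmetric])
qed

lemma bas_subset_kap_image: "bas d b V \<Longrightarrow> V \<subseteq> kap d b ` quat_space d"
  by (metis bas_coord image_eqI subsetI)

text \<open>\<open>h\<close> is the identity of the quaternions tensored with \<open>f\<close> on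
  \<open>V\<close>. The matrix \<open>c\<close> of \<open>f\<close> is real, and real scalars
  commute with quaternions, so \<open>h\<close> is quaternionic linear.\<close>

lemma induced_syzygy_map:
  assumes b: "bas d b V" and b': "bas d' b' V'" and E: "hsub E" "V \<subseteq> E"
    and f: "hlin E f" "f ` V \<subseteq> V'"
  obtains h where "\<And>S. hlin S h" "\<And>x. h x \<in> quat_space d'"
    "\<And>x. rho d' b' (h x) = f (rho d b x)" "\<And>x. kap d' b' (h x) = f (kap d b x)"
proof -
  have "\<exists>c. f (b l) = (\<Sum>m<d'. c m *\<^sub>R b' m)" if "l < d" for l
    using basD(2)[OF b'] bas_in[OF b that] f(2) by blast
  then obtain c where c: "\<And>l. l < d \<Longrightarrow> f (b l) = (\<Sum>m<d'. c l m *\<^sub>R b' m)" by metis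
  define h :: "qvec \<Rightarrow> qvec" where "h x = (\<Sum>m<d'. sg m (\<Sum>l<d. c l m *\<^sub>R lk x l))" for x
  have lk: "lk (h x) m = (if m < d' then \<Sum>l<d. c l m *\<^sub>R lk x l else 0)" for x m
    by (simp add: h_def lookup_sum lk_sg)
  have bE: "b l \<in> E" if "l < d" for l using bas_in[OF b that] E(2) by blast
  have "hlin S h" for S unfolding hlin_def
    by (auto intro!: poly_mapping_eqI simp: lk scaleR_add_right sum.distrib sum_distrib_left)
  moreover have "h x \<in> quat_space d'" for x by (simp add: quat_space_iff lk)
  moreover have "rho d' b' (h x) = f (rho d b x)" for x
  proof -
    have qs: "qRe (\<Sum>l<d. c l m *\<^sub>R lk x l) = (\<Sum>l<d. c l m * qRe (lk x l))" for m
      by (induction d) auto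
    have "rho d' b' (h x) = (\<Sum>m<d'. \<Sum>l<d. (c l m * qRe (lk x l)) *\<^sub>R b' m)"
      by (simp add: rho_def lk qs scaleR_sum_left)
    also have "\<dots> = (\<Sum>l<d. qRe (lk x l) *\<^sub>R (\<Sum>m<d'. c l m *\<^sub>R b' m))"
      by (subst sum.swap) (simp add: scaleR_sum_right mult.commute)
    also have "\<dots> = (\<Sum>l<d. qRe (lk x l) *\<^sub>R f (b l))" by (simp add: c)
    also have "\<dots> = (\<Sum>l<d. f (qRe (lk x l) *\<^sub>R b l))"
      using hlin_linear_on[OF f(1)] bE by (simp add: linear_on_def)
    also have "\<dots> = f (rho d b x)" unfolding rho_def
      using linear_on_sum[OF hlin_linear_on[OF f(1)] hsubD(1)[OF E(1)], of "{..<d}" "\<lambda>l. qRe (lk x l) *\<^sub>R b l"]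
        subspace_scale[OF hsubD(1)[OF E(1)]] bE by simp
    finally show ?thesis .
  qed
  moreover have "kap d' b' (h x) = f (kap d b x)" for x
  proof -
    have hs: "(\<Sum>l<d. c l m *\<^sub>R lk x l) \<star> y = (\<Sum>l<d. c l m *\<^sub>R (lk x l \<star> y))" for m y
      by (induction d) (auto simp: hsm_simps)
    have "kap d' b' (h x) = (\<Sum>m<d'. \<Sum>l<d. lk x l \<star> (c l m *\<^sub>R b' m))"
      by (simp add: kap_def lk hs hsm_simps)
    also have "\<dots> = (\<Sum>l<d. lk x l \<star> (\<Sum>m<d'. c l m *\<^sub>R b' m))"
      by (subst sum.swap) (simp add: hsm_sum)
    also have "\<dots> = (\<Sum>l<d. lk x l \<star> f (b l))" by (simp add: c)
    also have "\<dots> = (\<Sum>l<d. f (lk x l \<star> b l))"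
      using hlinD(2)[OF f(1)] bE by simp
    also have "\<dots> = f (kap d b x)" unfolding kap_def
      using linear_on_sum[OF hlin_linear_on[OF f(1)] hsubD(1)[OF E(1)], of "{..<d}" "\<lambda>l. lk x l \<star> b l"]
        hsubD(3)[OF E(1)] bE by simp
    finally show ?thesis .
  qed
  ultimately show ?thesis by (rule that)
qed

text \<open>A pair is regular if it can be reconstructed from its syzygies.\<close>

definition reg :: "nat \<Rightarrow> (nat \<Rightarrow> qvec) \<Rightarrow> qvec set \<Rightarrow> qvec set \<Rightarrow> bool" where
  "reg d b V E \<longleftrightarrow> rho d b ` SZ d b = V \<and> kap d b ` quat_space d = E"

text \<open>Regularity allows two descents. On \<open>V\<close>, the quotient of \<open>SZ\<close>
  by \<open>SZ0\<close>, the map \<open>h\<close> induces \<open>f0\<close>. Its quaternionic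
  extension \<open>k\<close> to \<open>quat_space d\<close> kills \<open>SZ\<close>, hence descends
  to a map \<open>f\<close> on \<open>E\<close>.\<close>

lemma hom_of_SZ_map:
  assumes b: "bas d b V" and b': "bas d' b' V'" and E: "hsub E" "V \<subseteq> E" and E': "hsub E'" "V' \<subseteq> E'"
    and r: "reg d b V E" and h: "hlin (SZ d b) h" "h ` SZ d b \<subseteq> SZ d' b'" "h ` SZ0 d b \<subseteq> SZ0 d' b'"
  obtains f where "hlin E f" "f ` E \<subseteq> E'" "f ` V \<subseteq> V'" "\<forall>g\<in>SZ d b. f (rho d b g) = rho d' b' (h g)"
proof -
  define f0 where "f0 v = rho d' b' (h (SOME g. g \<in> SZ d b \<and> rho d b g = v))" for v
  have subSZ: "subspace (SZ d b)" by (rule hsubD(1)[OF hsub_SZ])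
  have f0: "f0 (rho d b g) = rho d' b' (h g)" if g: "g \<in> SZ d b" for g
  proof -
    define g' where "g' = (SOME g'. g' \<in> SZ d b \<and> rho d b g' = rho d b g)"
    have g': "g' \<in> SZ d b" "rho d b g' = rho d b g"
      unfolding g'_def using someI[of "\<lambda>g'. g' \<in> SZ d b \<and> rho d b g' = rho d b g" g] g by auto
    have "g' - g \<in> SZ0 d b"
      using g g' subspace_diff[OF subSZ] by (simp add: SZ0_def rho_simps)
    then have "rho d' b' (h (g' - g)) = 0" using h(3) by (auto simp: SZ0_def)
    then have "rho d' b' (h g') = rho d' b' (h g)"
      using linear_on_diff[OF hlin_linear_on[OF h(1)] subSZ g'(1) g] by (simp add: rho_simps)
    then show ?thesis by (simp add: f0_def g'_def)
  qed
  have f0V: "f0 v \<in> V'" for v unfolding f0_def by (rule rho_in[OF b'])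
  define k where "k x = (\<Sum>l<d. lk x l \<star> f0 (b l))" for x
  have k_rho: "k x = rho d (\<lambda>l. f0 (b l)) x - qi \<star> rho d (\<lambda>l. f0 (b l)) (qi \<star> x)
     - qj \<star> rho d (\<lambda>l. f0 (b l)) (qj \<star> x) - qk \<star> rho d (\<lambda>l. f0 (b l)) (qk \<star> x)" for x
    using kap_rho[of d "\<lambda>l. f0 (b l)" x] by (simp add: kap_def k_def)
  have k_kap: "k = kap d (\<lambda>l. f0 (b l))" by (simp add: k_def kap_def fun_eq_iff)
  have lin0: "linear_on V f0" unfolding linear_on_def
  proof (intro conjI ballI allI)
    fix x y assume "x \<in> V" "y \<in> V"
    then obtain g g' where "g \<in> SZ d b" "g' \<in> SZ d b" "x = rho d b g" "y = rho d b g'"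
      using r unfolding reg_def by blast
    then show "f0 (x + y) = f0 x + f0 y"
      using f0 f0[of "g + g'"] subspace_add[OF subSZ] hlinD(1)[OF h(1)] by (simp add: rho_simps)
  next
    fix c x assume "x \<in> V"
    then obtain g where "g \<in> SZ d b" "x = rho d b g" using r unfolding reg_def by blast
    then show "f0 (c *\<^sub>R x) = c *\<^sub>R f0 x"
      using f0 f0[of "c *\<^sub>R g"] subspace_scale[OF subSZ] hlin_linear_on[OF h(1)]
      by (simp add: rho_simps linear_on_def)
  qed
  have subV: "subspace V"
    using linear_on_image_subspace[OF subSZ linear_imp_linear_on[OF linear_rho[of d b]]] r
    by (simp add: reg_def)
  have rho0: "rho d (\<lambda>l. f0 (b l)) x = f0 (rho d b x)" for x
  proof -
    have "f0 (rho d b x) = (\<Sum>l<d. f0 (qRe (lk x l) *\<^sub>R b l))" unfolding rho_def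
      using bas_in[OF b] subspace_scale[OF subV] by (intro linear_on_sum[OF lin0 subV]) auto
    also have "\<dots> = (\<Sum>l<d. qRe (lk x l) *\<^sub>R f0 (b l))"
      using lin0 bas_in[OF b] by (simp add: linear_on_def)
    finally show ?thesis by (simp add: rho_def)
  qed
  \<comment> \<open>Along the orbit of a syzygy \<open>g\<close> the real parts taken with
    \<open>f0 (b l)\<close> equal those of \<open>h g\<close>; by \<open>kap_rho\<close> this gives
    \<open>k g = kap d' b' (h g)\<close>, which is \<open>0\<close> because \<open>h g\<close> is a
    syzygy.\<close>
  have kSZ: "k g = 0" if g: "g \<in> SZ d b" for g
  proof -
    have *: "rho d (\<lambda>l. f0 (b l)) (p \<star> g) = rho d' b' (p \<star> h g)" for p
      using rho0 f0[OF hsubD(3)[OF hsub_SZ g]] hlinD(2)[OF h(1) g] by simp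
    have "k g = kap d' b' (h g)" unfolding k_rho kap_rho[of d' b'] * using *[of 1] by (simp add: hsm_simps)
    then show ?thesis using h(2) g by (auto simp: SZ_def)
  qed
  define f where "f e = k (SOME x. x \<in> quat_space d \<and> kap d b x = e)" for e
  have f: "f (kap d b x) = k x" if x: "x \<in> quat_space d" for x
  proof -
    define y where "y = (SOME y. y \<in> quat_space d \<and> kap d b y = kap d b x)"
    have y: "y \<in> quat_space d" "kap d b y = kap d b x"
      unfolding y_def using someI[of "\<lambda>y. y \<in> quat_space d \<and> kap d b y = kap d b x" x] x by auto
    have "y - x \<in> SZ d b" using x y subspace_diff[OF quat_space_subspace] by (simp add: SZ_def kap_simps)
    then have "k (y - x) = 0" by (rule kSZ)
    then have "k y = k x" by (simp add: k_kap kap_simps)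
    then show ?thesis by (simp add: f_def y_def)
  qed
  have fV: "f v = f0 v" if "v \<in> V" for v
  proof -
    obtain g where g: "g \<in> quat_space d" "kap d b g = v" "\<And>p. rho d b (p \<star> g) = qRe p *\<^sub>R v"
      using bas_coord[OF b \<open>v \<in> V\<close>] by blast
    have z: "f0 0 = 0" using linear_on_zero[OF lin0 subV] .
    have "f v = k g" using f[OF g(1)] g(2) by simp
    also have "\<dots> = f0 v" unfolding k_rho rho0 using g(3)[of 1] by (simp add: g(3) z hsm_simps)
    finally show ?thesis .
  qed
  have "hlin E f" unfolding hlin_def
  proof (intro conjI ballI allI)
    fix x y assume "x \<in> E" "y \<in> E"
    then obtain u w where "u \<in> quat_space d" "w \<in> quat_space d" "x = kap d b u" "y = kap d b w"
      using r unfolding reg_def by blast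
    then show "f (x + y) = f x + f y"
      using f f[of "u + w"] subspace_add[OF quat_space_subspace] by (simp add: kap_simps k_kap)
  next
    fix p x assume "x \<in> E"
    then obtain u where "u \<in> quat_space d" "x = kap d b u" using r unfolding reg_def by blast
    then show "f (p \<star> x) = p \<star> f x"
      using f f[of "p \<star> u"] hsm_quat_space by (simp add: kap_simps k_kap)
  qed
  moreover have "f ` E \<subseteq> E'"
  proof -
    have "k x \<in> E'" for x unfolding k_def
      using f0V E' by (intro subspace_sum hsubD) blast+
    then show ?thesis by (auto simp: f_def)
  qed
  moreover have "f ` V \<subseteq> V'" using fV f0V by auto
  moreover have "\<forall>g\<in>SZ d b. f (rho d b g) = rho d' b' (h g)"
    using fV[OF rho_in[OF b]] f0 by simp
  ultimately show ?thesis by (rule that)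
qed

section \<open>Indecomposable pairs, their types, and maps between types\<close>

section \<open>Classification of pairs\<close>

text \<open>The numerical conditions on \<open>(V, E)\<close> determine \<open>(V\<^sub>k, \<H>\<^sup>k\<^sup>+\<^sup>1)\<close> up to isomorphism. For
  \<open>(V'\<^sub>k, \<H>\<^sup>2\<^sup>k\<^sup>+\<^sup>1)\<close> they do not; the commuting complex structure \<open>R\<close> excludes the sums of two
  terms \<open>V\<^sub>i\<close>, \<open>V\<^sub>j\<close> with \<open>i + j = 2 k - 1\<close>.\<close>

definition TU :: "nat \<Rightarrow> qvec set \<Rightarrow> qvec set \<Rightarrow> bool" where
  "TU k V E \<longleftrightarrow> gpair V E \<and> dim V = 2 * k + 1 \<and> dim E = 4 * k + 4"

definition TU' :: "nat \<Rightarrow> qvec set \<Rightarrow> qvec set \<Rightarrow> bool" where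
  "TU' k V E \<longleftrightarrow> gpair V E \<and> dim V = 4 * k \<and> dim E = 8 * k + 4 \<and>
     (\<exists>R. hlin E R \<and> R ` E \<subseteq> E \<and> R ` V \<subseteq> V \<and> (\<forall>x\<in>E. R (R x) = - x))"

fun lab_pair :: "crq_label \<Rightarrow> qvec set \<Rightarrow> qvec set \<Rightarrow> bool" where
  "lab_pair (Lab_U k) V E = TU k V E"
| "lab_pair (Lab_U' k) V E = TU' k V E"

lemma lab_pair_gpair: "lab_pair l V E \<Longrightarrow> gpair V E"
  by (cases l) (auto simp: TU_def TU'_def)

definition hline :: "qvec \<Rightarrow> qvec set" where "hline e = range (\<lambda>p. p \<star> e)"

lemma linear_hline: "linear (\<lambda>p. p \<star> e)" by (rule linearI) (simp_all add: hsm_simps)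

lemma hline_subset: "hsub E \<Longrightarrow> e \<in> E \<Longrightarrow> hline e \<subseteq> E"
  unfolding hline_def using hsubD(3) by blast

lemma hsub_hline:
  assumes "hsub E" "e \<in> E" shows "hsub (hline e)"
proof (rule hsub_subset[OF assms(1)])
  show "subspace (hline e)" unfolding hline_def
    by (rule linear_on_image_subspace[OF subspace_UNIV linear_imp_linear_on[OF linear_hline]])
  show "hline e \<subseteq> E" by (rule hline_subset[OF assms])
  show "p \<star> x \<in> hline e" if "x \<in> hline e" for p x
    using that unfolding hline_def by (auto simp: hsm_simps)
qed

lemma hline_self: "e \<in> hline e"
  unfolding hline_def by (rule range_eqI[of _ _ 1]) (simp add: hsm_simps)

lemma dim_hline:
  assumes "e \<noteq> 0" shows "dim (hline e) = 4"
  unfolding hline_def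
  using fin_dim_image_inj(1)[OF dim_quat(1) linear_imp_linear_on[OF linear_hline[of e]]] assms dim_quat(2)
  by (simp add: hsm_eq_0)

lemma hsub_dim_ge:
  assumes "hsub E" "E \<noteq> {0}" shows "4 \<le> dim E"
proof -
  obtain e where e: "e \<in> E" "e \<noteq> 0" using assms subspace_0[OF hsubD(1)[OF assms(1)]] by blast
  show ?thesis
    using fin_dim_subset(2)[OF hsubD(2)[OF assms(1)] hsubD(1)[OF hsub_hline[OF assms(1) e(1)]]
        hline_subset[OF assms(1) e(1)]] dim_hline[OF e(2)] by simp
qed

lemma hsub_sum:
  assumes "hsub E" "hsub A" "hsub B" "A \<subseteq> E" "B \<subseteq> E"
  shows "hsub {x + y | x y. x \<in> A \<and> y \<in> B}"
proof (rule hsub_subset[OF assms(1)])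
  show "subspace {x + y | x y. x \<in> A \<and> y \<in> B}"
    using hsubD(1) assms by (intro subspace_sums) auto
  show "{x + y | x y. x \<in> A \<and> y \<in> B} \<subseteq> E"
    using assms(4,5) by (auto intro!: subspace_add[OF hsubD(1)[OF assms(1)]])
  fix p z assume "z \<in> {x + y | x y. x \<in> A \<and> y \<in> B}"
  then obtain x y where "z = x + y" "x \<in> A" "y \<in> B" by blast
  then have "p \<star> z = p \<star> x + p \<star> y" "p \<star> x \<in> A" "p \<star> y \<in> B"
    using hsubD(3) assms by (auto simp: hsm_simps)
  then show "p \<star> z \<in> {x + y | x y. x \<in> A \<and> y \<in> B}" by blast
qed

lemma hsub_0: "hsub {0}"
  by (rule hsub_subset[OF hsub_quat_space[of 0]]) (auto simp: quat_space_iff hsm_simps)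

lemma gpair_mono: "gpair V E \<Longrightarrow> hsub A \<Longrightarrow> subspace W \<Longrightarrow> W \<subseteq> V \<Longrightarrow> W \<subseteq> A \<Longrightarrow> gpair W A"
  unfolding gpair_def by blast

lemma gpair_zero: "hsub A \<Longrightarrow> gpair {0} A"
  unfolding gpair_def using subspace_0[OF hsubD(1)] by simp

definition splits :: "qvec set \<Rightarrow> qvec set \<Rightarrow> bool" where
  "splits V E \<longleftrightarrow> (\<exists>V1 E1 V2 E2. gpair V1 E1 \<and> gpair V2 E2 \<and> E1 \<noteq> {0} \<and> E2 \<noteq> {0} \<and>
     E1 \<inter> E2 = {0} \<and> E = {x + y | x y. x \<in> E1 \<and> y \<in> E2} \<and> V = {x + y | x y. x \<in> V1 \<and> y \<in> V2})"

text \<open>The quaternionic subspace generated by \<open>W \<subseteq> V\<close>.\<close>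

definition HS :: "nat \<Rightarrow> (nat \<Rightarrow> qvec) \<Rightarrow> qvec set \<Rightarrow> qvec set" where
  "HS d b W = {kap d b x | x. x \<in> quat_space d \<and> (\<forall>p. rho d b (p \<star> x) \<in> W)}"

lemma
  assumes E: "hsub E" "V \<subseteq> E" and b: "bas d b V" and W: "subspace W"
  shows hsub_HS: "hsub (HS d b W)" and HS_subset: "HS d b W \<subseteq> E"
proof -
  show sub: "HS d b W \<subseteq> E" unfolding HS_def using kap_in[OF E b] by blast
  let ?S = "{x \<in> quat_space d. \<forall>p. rho d b (p \<star> x) \<in> W}"
  have HS: "HS d b W = kap d b ` ?S" by (auto simp: HS_def)
  have "subspace ?S"
    using quat_space_subspace[of d] W
    by (auto simp: subspace_def hsm_simps rho_simps)
  then have 1: "subspace (HS d b W)"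
    unfolding HS by (rule linear_on_image_subspace) (rule hlin_linear_on[OF hlin_kap])
  show "hsub (HS d b W)"
  proof (rule hsub_subset[OF E(1) 1 sub])
    fix p x assume "x \<in> HS d b W"
    then obtain y where "x = kap d b y" "y \<in> ?S" unfolding HS by blast
    then have "p \<star> x = kap d b (p \<star> y)" "p \<star> y \<in> ?S"
      by (auto simp: kap_simps hsm_simps hsm_quat_space)
    then show "p \<star> x \<in> HS d b W" unfolding HS by blast
  qed
qed

lemma HS_superset:
  assumes b: "bas d b V" and W: "subspace W" "W \<subseteq> V" shows "W \<subseteq> HS d b W"
proof
  fix v assume v: "v \<in> W"
  then have "v \<in> V" using W by blast
  then obtain g where "g \<in> quat_space d" "kap d b g = v" "\<forall>p. rho d b (p \<star> g) = qRe p *\<^sub>R v"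
    by (rule bas_coord[OF b])
  then show "v \<in> HS d b W" unfolding HS_def using subspace_scale[OF W(1) v] by (auto intro!: exI[of _ g])
qed

text \<open>When \<open>kap\<close> is onto, \<open>V\<close> generates \<open>E\<close> over the
  quaternions.\<close>

lemma hlin_eq_on:
  assumes b: "bas d b V" and E: "hsub E" "V \<subseteq> E" "kap d b ` quat_space d = E"
    and f: "hlin E f" "hlin E g" "\<And>v. v \<in> V \<Longrightarrow> f v = g v" and e: "e \<in> E"
  shows "f e = g e"
proof -
  obtain x where x: "e = kap d b x" using E(3) e by blast
  have bE: "b l \<in> E" if "l < d" for l using bas_in[OF b that] E(2) by blast
  have *: "F e = (\<Sum>l<d. lk x l \<star> F (b l))" if F: "hlin E F" for F
  proof -
    have "F e = (\<Sum>l<d. F (lk x l \<star> b l))" unfolding x kap_def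
      using linear_on_sum[OF hlin_linear_on[OF F] hsubD(1)[OF E(1)], of "{..<d}" "\<lambda>l. lk x l \<star> b l"]
        hsubD(3)[OF E(1)] bE by simp
    then show ?thesis using hlinD(2)[OF F] bE by simp
  qed
  show ?thesis unfolding *[OF f(1)] *[OF f(2)] using f(3) bas_in[OF b] by simp
qed

text \<open>The complex structure descends from the syzygies by \<open>hom_of_SZ_map\<close>. That
  it squares to \<open>-1\<close> is checked on \<open>V\<close>, as the image of the syzygies under
  \<open>rho\<close>, and extends to \<open>E\<close> because \<open>V\<close> generates.\<close>

lemma TU'_of_SZ:
  assumes g: "gpair V E" and b: "bas (dim V) b V" and r: "reg (dim V) b V E"
    and T: "TU' k (SZ0 (dim V) b) (SZ (dim V) b)"
  shows "TU' (Suc k) V E"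
proof -
  let ?d = "dim V"
  obtain R where R: "hlin (SZ ?d b) R" "R ` SZ ?d b \<subseteq> SZ ?d b" "R ` SZ0 ?d b \<subseteq> SZ0 ?d b"
    "\<forall>x\<in>SZ ?d b. R (R x) = - x" using T by (auto simp: TU'_def)
  note E = gpairD(1,3)[OF g]
  obtain f where f: "hlin E f" "f ` E \<subseteq> E" "f ` V \<subseteq> V"
    "\<forall>g\<in>SZ ?d b. f (rho ?d b g) = rho ?d b (R g)"
    by (rule hom_of_SZ_map[OF b b E E r R(1-3)])
  have V: "f (f v) = - v" if "v \<in> V" for v
  proof -
    obtain g where g: "g \<in> SZ ?d b" "v = rho ?d b g" using \<open>v \<in> V\<close> r unfolding reg_def by blast
    have "R g \<in> SZ ?d b" using g R(2) by blast
    then show ?thesis using f(4) g R(4) by (simp add: rho_simps)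
  qed
  have "hlin E (\<lambda>x. f (f x))" using hlin_compose[OF f(1,2,1)] .
  moreover have "hlin E uminus" by (simp add: hlin_def hsm_simps)
  ultimately have ff: "\<forall>x\<in>E. f (f x) = - x"
    using hlin_eq_on[OF b E] r V unfolding reg_def by blast
  have d1: "dim V + 4 * k = 8 * k + 4" "dim E + (8 * k + 4) = 4 * dim V"
    using dim_SZ0[of ?d b] dim_SZ[of ?d b] r T by (auto simp: reg_def TU'_def)
  then have "dim V = 4 * Suc k" "dim E = 8 * Suc k + 4" by auto
  then show ?thesis using g f(1-3) ff unfolding TU'_def by blast
qed

text \<open>Three cases. If \<open>V\<close> does not generate \<open>E\<close>, a quaternionic
  complement splits off and only \<open>(0, \<H>)\<close> remains. If the real parts of syzygies do
  not fill \<open>V\<close>, a copy of \<open>(\<real>, \<H>)\<close> splits off. Otherwise the pair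
  is regular, a splitting of its syzygies would lift to it, and the induction hypothesis applies to
  them.\<close>

lemma indecomposable:
  "gpair V E \<Longrightarrow> E \<noteq> {0} \<Longrightarrow> \<not> splits V E \<Longrightarrow> \<exists>l. lab_pair l V E"
proof (induction "dim E" arbitrary: V E rule: less_induct)
  case less
  note g = less.prems(1)
  note E = gpairD(1,3)[OF g] and V = gpairD(2)[OF g]
  have subE: "subspace E" by (rule hsubD(1)[OF E(1)])
  let ?d = "dim V"
  obtain b where b: "bas ?d b V" using bas_exists[OF gpairD(4)[OF g]] by metis
  define K where "K = kap ?d b ` quat_space ?d"
  have K: "hsub K" "K \<subseteq> E" "V \<subseteq> K"
    using hsub_kap_image[OF E b] kap_in[OF E b] bas_subset_kap_image[OF b] by (auto simp: K_def)
  show ?case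
  proof (cases "K = E")
    case False
    obtain C where C: "hsub C" "C \<subseteq> E" "K \<inter> C = {0}" "E = {x + y | x y. x \<in> K \<and> y \<in> C}"
      by (rule hsub_complement[OF K(1) E(1) K(2)])
    have "C \<noteq> {0}" using False C(4) by auto
    have K0: "K = {0}"
    proof (rule ccontr)
      assume "K \<noteq> {0}"
      moreover have "gpair V K" using gpair_mono[OF g K(1) V] K(3) by simp
      moreover have "V = {x + y | x y. x \<in> V \<and> y \<in> {0}}" by simp
      ultimately have "splits V E"
        unfolding splits_def using gpair_zero[OF C(1)] C(3,4) \<open>C \<noteq> {0}\<close> by blast
      then show False using less.prems by simp
    qed
    then have V0: "V = {0}" using K(3) subspace_0[OF V] by blast
    obtain e where e: "e \<in> E" "e \<noteq> 0" using less.prems(2) subspace_0[OF subE] by blast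
    note He = hsub_hline[OF E(1) e(1)] hline_subset[OF E(1) e(1)]
    obtain C' where C': "hsub C'" "C' \<subseteq> E" "hline e \<inter> C' = {0}" "E = {x + y | x y. x \<in> hline e \<and> y \<in> C'}"
      by (rule hsub_complement[OF He(1) E(1) He(2)])
    have "C' = {0}"
    proof (rule ccontr)
      assume "C' \<noteq> {0}"
      moreover have "V = {x + y | x y. x \<in> {0} \<and> y \<in> {0}}" using V0 by simp
      moreover have "hline e \<noteq> {0}" using hline_self[of e] e(2) by blast
      ultimately have "splits V E"
        unfolding splits_def using gpair_zero[OF C'(1)] gpair_zero[OF He(1)] C'(3,4) by blast
      then show False using less.prems by simp
    qed
    then have Eh: "E = hline e" using C'(4) by simp
    \<comment> \<open>Right multiplication by \<open>i\<close> in the coordinate \<open>p\<close> of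
      \<open>p \<star> e\<close>; it commutes with the left multiplications.\<close>
    define R where "R x = ((SOME p. x = p \<star> e) * qi) \<star> e" for x
    have R: "R (p \<star> e) = (p * qi) \<star> e" for p
    proof -
      have "p \<star> e = (SOME q. p \<star> e = q \<star> e) \<star> e" by (rule someI_ex) blast
      then have "(p - (SOME q. p \<star> e = q \<star> e)) \<star> e = 0" by (simp add: hsm_simps)
      then have "(SOME q. p \<star> e = q \<star> e) = p" using e(2) by (simp add: hsm_eq_0)
      then show ?thesis by (simp add: R_def)
    qed
    have Ex: "\<exists>p. x = p \<star> e" if "x \<in> E" for x using that unfolding Eh hline_def by blast
    have "hlin E R" unfolding hlin_def
    proof (intro conjI ballI allI)
      fix x y assume "x \<in> E" "y \<in> E"
      then obtain p r where "x = p \<star> e" "y = r \<star> e" using Ex by blast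
      then show "R (x + y) = R x + R y"
        using R R[of "p + r"] by (simp add: hsm_simps distrib_right)
    next
      fix p x assume "x \<in> E"
      then obtain r where "x = r \<star> e" using Ex by blast
      then show "R (p \<star> x) = p \<star> R x" using R by (simp add: hsm_simps mult.assoc)
    qed
    moreover have "R ` E \<subseteq> E" using Ex R unfolding Eh hline_def by auto
    moreover have "R ` V \<subseteq> V" using V0 R[of 0] by (simp add: hsm_simps)
    moreover have "R (R x) = - x" if "x \<in> E" for x
    proof -
      obtain p where p: "x = p \<star> e" using Ex \<open>x \<in> E\<close> by blast
      have "qi * qi = - 1" by (simp add: quat_eq_iff quat_mult_sel)
      then show ?thesis using p R by (simp add: mult.assoc hsm_simps)
    qed
    ultimately have "TU' 0 V E"
      unfolding TU'_def using g V0 dim_hline[OF e(2)] Eh by auto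
    then show ?thesis by (intro exI[of _ "Lab_U' 0"]) simp
  next
    case True
    define A where "A = rho ?d b ` SZ ?d b"
    have A: "subspace A" "A \<subseteq> V"
      unfolding A_def using rho_in[OF b]
        linear_on_image_subspace[OF hsubD(1)[OF hsub_SZ] linear_imp_linear_on[OF linear_rho]] by auto
    show ?thesis
    proof (cases "A = V")
      case False
      obtain m where m: "E \<subseteq> quat_space m" using E(1) by (auto simp: hsub_def)
      have Vm: "V \<subseteq> quat_space m" and Am: "A \<subseteq> quat_space m" using E(2) A(2) m by blast+
      obtain v where v: "v \<in> V" "v \<notin> A" using False A(2) by blast
      \<comment> \<open>A nonzero vector of \<open>V\<close> orthogonal to all real parts of
        syzygies: no relation involves it, so its quaternionic line meets the space generated by the
        complement \<open>?W\<close> of \<open>v0\<close> in \<open>V\<close> only in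
        \<open>0\<close>.\<close>
      then obtain a v0 where av: "v = a + v0" "a \<in> A" "v0 \<in> orth_compl m A"
        using orth_compl_decomp[OF A(1) Am] Vm by blast
      have "v0 = v - a" using av(1) by simp
      then have "v0 \<in> V" using av(2) v subspace_diff[OF V v(1)] A(2) by blast
      moreover have "v0 \<noteq> 0" using av(1,2) v(2) by auto
      ultimately have v0: "v0 \<in> V" "v0 \<noteq> 0" by auto
      let ?W = "{v \<in> V. ip m v0 v = 0}"
      have W: "subspace ?W" "?W \<subseteq> V" using V by (auto simp: subspace_def ip_simps)
      have AW: "A \<subseteq> ?W" using av(3) A(2) by (auto simp: orth_compl_iff)
      have n0: "ip m v0 v0 \<noteq> 0" using ip_self_eq_0[of v0 m] v0 Vm by blast
      let ?L = "span {v0}"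
      have L: "?L = range (\<lambda>c. c *\<^sub>R v0)" by (rule span_singleton)
      have LV: "?L \<subseteq> V" using v0 V by (intro span_minimal) auto
      have dec: "V = {x + y | x y. x \<in> ?L \<and> y \<in> ?W}"
      proof
        show "{x + y | x y. x \<in> ?L \<and> y \<in> ?W} \<subseteq> V" using LV by (auto intro!: subspace_add[OF V])
        show "V \<subseteq> {x + y | x y. x \<in> ?L \<and> y \<in> ?W}"
        proof
          fix x assume x: "x \<in> V"
          let ?c = "ip m v0 x / ip m v0 v0"
          have "x = ?c *\<^sub>R v0 + (x - ?c *\<^sub>R v0)" by simp
          moreover have "?c *\<^sub>R v0 \<in> ?L" unfolding L by blast
          moreover have "x - ?c *\<^sub>R v0 \<in> ?W"
            using x v0 n0 by (auto simp: ip_simps intro!: subspace_diff[OF V] subspace_scale[OF V])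
          ultimately show "x \<in> {x + y | x y. x \<in> ?L \<and> y \<in> ?W}" by blast
        qed
      qed
      have v0E: "v0 \<in> E" using v0 E(2) by blast
      note E1 = hsub_hline[OF E(1) v0E] hline_subset[OF E(1) v0E]
      note E2 = hsub_HS[OF E b W(1)] HS_subset[OF E b W(1)]
      let ?E1 = "hline v0" let ?E2 = "HS ?d b ?W"
      have int: "?E1 \<inter> ?E2 = {0}"
      proof
        show "{0} \<subseteq> ?E1 \<inter> ?E2" using subspace_0 hsubD(1) E1(1) E2(1) by blast
        show "?E1 \<inter> ?E2 \<subseteq> {0}"
        proof
          fix e assume "e \<in> ?E1 \<inter> ?E2"
          then obtain p x where p: "e = p \<star> v0" and x: "e = kap ?d b x" "x \<in> quat_space ?d"
            "\<forall>r. rho ?d b (r \<star> x) \<in> ?W"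
            unfolding hline_def HS_def by blast
          obtain g where g: "g \<in> quat_space ?d" "kap ?d b g = v0" "\<forall>r. rho ?d b (r \<star> g) = qRe r *\<^sub>R v0"
            by (rule bas_coord[OF b v0(1)])
          have "kap ?d b (p \<star> g - x) = 0" using p x g by (simp add: kap_simps)
          \<comment> \<open>The two lifts of \<open>e\<close> differ by a syzygy, so all real parts
            along its orbit lie in \<open>A\<close>, hence in \<open>?W\<close>. This puts every
            \<open>qRe (r * p) *\<^sub>R v0\<close> into \<open>?W\<close>, which is possible only
            for \<open>p = 0\<close>.\<close>
          then have sz: "p \<star> g - x \<in> SZ ?d b"
            using x g subspace_diff[OF quat_space_subspace] hsm_quat_space by (simp add: SZ_def)
          have "qRe (r * p) = 0" for r
          proof -
            have "rho ?d b (r \<star> (p \<star> g - x)) \<in> A" unfolding A_def using hsubD(3)[OF hsub_SZ sz] by blast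
            then have 1: "rho ?d b (r \<star> (p \<star> g - x)) \<in> ?W" using AW by blast
            have "rho ?d b (r \<star> (p \<star> g - x)) + rho ?d b (r \<star> x) \<in> ?W"
              using subspace_add[OF W(1) 1] x(3) by blast
            then have "qRe (r * p) *\<^sub>R v0 \<in> ?W"
              using spec[OF g(3), of "r * p"] by (simp add: hsm_simps rho_simps)
            then show ?thesis using n0 by (simp add: ip_simps)
          qed
          from this[of "qcnj p"] have "p \<bullet> p = 0" by (simp add: mult_qcnj)
          then show "e \<in> {0}" using p by (simp add: hsm_simps)
        qed
      qed
      have sum: "E = {x + y | x y. x \<in> ?E1 \<and> y \<in> ?E2}"
      proof
        show "{x + y | x y. x \<in> ?E1 \<and> y \<in> ?E2} \<subseteq> E" using E1(2) E2(2) by (auto intro!: subspace_add[OF subE])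
        have h: "hsub {x + y | x y. x \<in> ?E1 \<and> y \<in> ?E2}"
          by (rule hsub_sum[OF E(1) E1(1) E2(1) E1(2) E2(2)])
        have "?L \<subseteq> ?E1" using hline_self[of v0] by (intro span_minimal hsubD(1)[OF E1(1)]) auto
        moreover have "?W \<subseteq> ?E2" by (rule HS_superset[OF b W])
        ultimately have "V \<subseteq> {x + y | x y. x \<in> ?E1 \<and> y \<in> ?E2}"
          by (subst dec) blast
        then have "K \<subseteq> {x + y | x y. x \<in> ?E1 \<and> y \<in> ?E2}"
          unfolding K_def using kap_in[OF h _ b] by blast
        then show "E \<subseteq> {x + y | x y. x \<in> ?E1 \<and> y \<in> ?E2}" using True by simp
      qed
      have g1: "gpair ?L ?E1"
        using hline_self[of v0] by (intro gpair_mono[OF g E1(1) _ LV] span_minimal hsubD(1)[OF E1(1)]) auto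
      have g2: "gpair ?W ?E2" by (rule gpair_mono[OF g E2(1) W HS_superset[OF b W]])
      have "?E1 \<noteq> {0}" using hline_self[of v0] v0(2) by blast
      then have E20: "?E2 = {0}"
        using less.prems(3) g1 g2 int sum dec unfolding splits_def by blast
      then have "?W = {0}" using HS_superset[OF b W] subspace_0[OF W(1)] by blast
      then have "V = ?L" using dec by simp
      moreover have "dim ?L = 1"
        using dim_span_eq_card_independent[of "{v0}"] v0(2) by (simp add: independent_insert)
      moreover have "E = ?E1" using sum E20 by simp
      ultimately have "TU 0 V E" using g dim_hline[OF v0(2)] by (simp add: TU_def)
      then show ?thesis by (intro exI[of _ "Lab_U 0"]) simp
    next
      case regular: True
      have r: "reg ?d b V E" using True regular by (simp add: reg_def K_def A_def)
      let ?G = "SZ ?d b" let ?GZ = "SZ0 ?d b"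
      have gG: "gpair ?GZ ?G" by (rule gpair_SZ[OF g b])
      have sG: "subspace ?G" by (rule hsubD(1)[OF hsub_SZ])
      have G0: "?G \<noteq> {0}"
      proof
        assume "?G = {0}"
        then have V0: "V = {0}" using r by (simp add: reg_def rho_simps)
        then have "E \<subseteq> {0}"
          using kap_in[OF hsub_0 _ b] r unfolding reg_def by blast
        then show False using less.prems(2) subspace_0[OF subE] by blast
      qed
      \<comment> \<open>Regularity gives \<open>dim E + dim ?G = 4 * dim V\<close>, and the
        right-hand side is less than \<open>2 * dim E\<close>.\<close>
      have dG: "dim ?G < dim E"
        using gpair_dim_less[OF g less.prems(2)] dim_SZ[of ?d b] r by (simp add: reg_def)
      have "\<not> splits ?GZ ?G"
      proof
        assume "splits ?GZ ?G"
        then obtain A1 G1 A2 G2 where s: "gpair A1 G1" "gpair A2 G2" "G1 \<noteq> {0}" "G2 \<noteq> {0}"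
          "G1 \<inter> G2 = {0}" "?G = {x + y | x y. x \<in> G1 \<and> y \<in> G2}" "?GZ = {x + y | x y. x \<in> A1 \<and> y \<in> A2}"
          unfolding splits_def by blast
        note h1 = gpairD(1)[OF s(1)] and h2 = gpairD(1)[OF s(2)]
        have 01: "0 \<in> G1" "0 \<in> A1" "0 \<in> G2" "0 \<in> A2"
          using s(1,2) subspace_0 gpairD(2) hsubD(1) h1 h2 by blast+
        have G12: "G1 \<subseteq> ?G" "G2 \<subseteq> ?G" using 01 unfolding s(6) by force+
        have A12: "A1 \<subseteq> ?GZ" "A2 \<subseteq> ?GZ" using 01 unfolding s(7) by force+
        let ?V1 = "rho ?d b ` G1" let ?V2 = "rho ?d b ` G2"
        let ?E1 = "HS ?d b ?V1" let ?E2 = "HS ?d b ?V2"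
        have sV: "subspace ?V1" "subspace ?V2"
          using linear_on_image_subspace[OF hsubD(1) linear_imp_linear_on[OF linear_rho]] h1 h2 by blast+
        have V12: "?V1 \<subseteq> V" "?V2 \<subseteq> V" using rho_in[OF b] by blast+
        \<comment> \<open>Equal real parts make \<open>g1 - g2 = a1 + a2\<close> an element of
          \<open>?GZ\<close>. Then \<open>g1 - a1 = g2 + a2\<close> lies in both summands, so
          \<open>g1 = a1\<close> has no real part.\<close>
        have VV: "rho ?d b g1 = 0" if gg: "g1 \<in> G1" "g2 \<in> G2" "rho ?d b g1 = rho ?d b g2" for g1 g2
        proof -
          have "g1 - g2 \<in> ?GZ"
            using gg G12 subspace_diff[OF sG] by (auto simp: SZ0_def rho_simps)
          then obtain a1 a2 where a: "g1 - g2 = a1 + a2" "a1 \<in> A1" "a2 \<in> A2" unfolding s(7) by blast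
          then have "g1 - a1 = g2 + a2" by (simp add: algebra_simps)
          moreover have "g1 - a1 \<in> G1" using subspace_diff[OF hsubD(1)[OF h1]] gg(1) a(2) gpairD(3)[OF s(1)] by blast
          moreover have "g2 + a2 \<in> G2" using subspace_add[OF hsubD(1)[OF h2]] gg(2) a(3) gpairD(3)[OF s(2)] by blast
          ultimately have "g1 - a1 \<in> G1 \<inter> G2" by simp
          then have "g1 = a1" using s(5) by simp
          then show ?thesis using a(2) A12(1) by (auto simp: SZ0_def)
        qed
        have V12int: "x = 0" if "x \<in> ?V1" "x \<in> ?V2" for x using that VV by blast
        note H1 = hsub_HS[OF E b sV(1)] HS_subset[OF E b sV(1)] HS_superset[OF b sV(1) V12(1)]
        note H2 = hsub_HS[OF E b sV(2)] HS_subset[OF E b sV(2)] HS_superset[OF b sV(2) V12(2)]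
        have int: "?E1 \<inter> ?E2 = {0}"
        proof
          show "{0} \<subseteq> ?E1 \<inter> ?E2" using subspace_0[OF hsubD(1)[OF H1(1)]] subspace_0[OF hsubD(1)[OF H2(1)]] by blast
          show "?E1 \<inter> ?E2 \<subseteq> {0}"
          proof
            fix e assume "e \<in> ?E1 \<inter> ?E2"
            then obtain x1 x2 where x1: "e = kap ?d b x1" "x1 \<in> quat_space ?d" "\<forall>p. rho ?d b (p \<star> x1) \<in> ?V1"
              and x2: "e = kap ?d b x2" "x2 \<in> quat_space ?d" "\<forall>p. rho ?d b (p \<star> x2) \<in> ?V2"
              unfolding HS_def by blast
            have "x1 - x2 \<in> ?G"
              using x1 x2 subspace_diff[OF quat_space_subspace] by (simp add: SZ_def kap_simps)
            then obtain g1 g2 where gg: "x1 - x2 = g1 + g2" "g1 \<in> G1" "g2 \<in> G2" unfolding s(6) by blast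
            \<comment> \<open>Two lifts of \<open>e\<close> differ by a syzygy
              \<open>g1 + g2\<close>. The vector \<open>x1 - g1 = x2 + g2\<close> therefore has real
              parts in both \<open>?V1\<close> and \<open>?V2\<close> along its whole orbit, so it
              vanishes and \<open>x1\<close> is itself a syzygy.\<close>
            have "rho ?d b (p \<star> (x1 - g1)) = 0" for p
            proof (rule V12int)
              have 1: "rho ?d b (p \<star> x1) \<in> ?V1" "rho ?d b (p \<star> g1) \<in> ?V1"
                using x1(3) hsubD(3)[OF h1 gg(2)] by blast+
              then show "rho ?d b (p \<star> (x1 - g1)) \<in> ?V1"
                using subspace_diff[OF sV(1)] by (simp add: hsm_simps rho_simps)
              have 2: "rho ?d b (p \<star> x2) \<in> ?V2" "rho ?d b (p \<star> g2) \<in> ?V2"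
                using x2(3) hsubD(3)[OF h2 gg(3)] by blast+
              have "x1 - g1 = x2 + g2" using gg(1) by (simp add: algebra_simps)
              then show "rho ?d b (p \<star> (x1 - g1)) \<in> ?V2"
                using subspace_add[OF sV(2) 2] by (simp add: hsm_simps rho_simps)
            qed
            moreover have "x1 - g1 \<in> quat_space ?d"
              using x1(2) gg(2) G12(1) subspace_diff[OF quat_space_subspace] by (auto simp: SZ_def)
            ultimately have "x1 - g1 = 0" using rho_separates[OF b] by blast
            then have "x1 \<in> ?G" using gg(2) G12(1) by auto
            then show "e \<in> {0}" using x1(1) by (simp add: SZ_def)
          qed
        qed
        have Vs: "V = {x + y | x y. x \<in> ?V1 \<and> y \<in> ?V2}"
        proof
          show "{x + y | x y. x \<in> ?V1 \<and> y \<in> ?V2} \<subseteq> V" using V12 by (auto intro!: subspace_add[OF V])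
          show "V \<subseteq> {x + y | x y. x \<in> ?V1 \<and> y \<in> ?V2}"
          proof
            fix v assume "v \<in> V"
            then obtain g where g: "g \<in> ?G" "v = rho ?d b g" using r unfolding reg_def by blast
            then obtain g1 g2 where "g = g1 + g2" "g1 \<in> G1" "g2 \<in> G2" unfolding s(6) by blast
            then show "v \<in> {x + y | x y. x \<in> ?V1 \<and> y \<in> ?V2}" using g(2) by (auto simp: rho_simps)
          qed
        qed
        have Es: "E = {x + y | x y. x \<in> ?E1 \<and> y \<in> ?E2}"
        proof
          show "{x + y | x y. x \<in> ?E1 \<and> y \<in> ?E2} \<subseteq> E" using H1(2) H2(2) by (auto intro!: subspace_add[OF subE])
          have h: "hsub {x + y | x y. x \<in> ?E1 \<and> y \<in> ?E2}"
            by (rule hsub_sum[OF E(1) H1(1) H2(1) H1(2) H2(2)])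
          have "V \<subseteq> {x + y | x y. x \<in> ?E1 \<and> y \<in> ?E2}" using H1(3) H2(3) by (subst Vs) blast
          then show "E \<subseteq> {x + y | x y. x \<in> ?E1 \<and> y \<in> ?E2}"
            using kap_in[OF h _ b] r unfolding reg_def by blast
        qed
        \<comment> \<open>A summand with zero quaternionic span would consist of syzygies without
          real parts along their orbits, against \<open>rho_separates\<close>; this keeps the lifted
          splitting nontrivial.\<close>
        have nz: "HS ?d b (rho ?d b ` H) \<noteq> {0}"
          if H: "H \<noteq> {0}" "0 \<in> H" "H \<subseteq> ?G" "hsub H" "rho ?d b ` H \<subseteq> HS ?d b (rho ?d b ` H)" for H
        proof
          assume z: "HS ?d b (rho ?d b ` H) = {0}"
          obtain h where h: "h \<in> H" "h \<noteq> 0" using H(1,2) by blast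
          have "rho ?d b (p \<star> h) = 0" for p
            using z H(5) hsubD(3)[OF H(4) h(1)] by blast
          moreover have "h \<in> quat_space ?d" using h(1) H(3) by (auto simp: SZ_def)
          ultimately show False using rho_separates[OF b] h(2) by blast
        qed
        have "splits V E" unfolding splits_def
          using gpair_mono[OF g H1(1) sV(1) V12(1) H1(3)] gpair_mono[OF g H2(1) sV(2) V12(2) H2(3)]
            nz[OF s(3) 01(1) G12(1) h1 H1(3)] nz[OF s(4) 01(3) G12(2) h2 H2(3)] int Vs Es by blast
        then show False using less.prems(3) by simp
      qed
      from less.hyps[OF dG gG G0 this] obtain l where l: "lab_pair l ?GZ ?G" by blast
      show ?thesis
      proof (cases l)
        case (Lab_U k)
        then have "TU k ?GZ ?G" using l by simp
        then have "TU (Suc k) V E"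
          using g dim_SZ0[of ?d b] dim_SZ[of ?d b] r by (auto simp: reg_def TU_def)
        then show ?thesis by (intro exI[of _ "Lab_U (Suc k)"]) simp
      next
        case (Lab_U' k)
        then have "TU' (Suc k) V E" using TU'_of_SZ[OF g b r] l by simp
        then show ?thesis by (intro exI[of _ "Lab_U' (Suc k)"]) simp
      qed
    qed
  qed
qed

text \<open>Applying \<open>2 dim V < dim E\<close> to the syzygy pair and rewriting by
  \<open>dim_SZ\<close> and \<open>dim_SZ0\<close> bounds the dimension of the image of
  \<open>kap\<close> from below. A proper image would leave a complement of dimension at least
  \<open>4\<close>, too much for \<open>dim E \<le> 2 * dim V + 4\<close>.\<close>

lemma reg_dim_bounds:
  assumes g: "gpair V E" and b: "bas (dim V) b V" and d: "dim E \<le> 2 * dim V + 4" "3 \<le> dim V"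
  shows "kap (dim V) b ` quat_space (dim V) = E"
    and "2 * dim V + 2 * (dim V - dim (rho (dim V) b ` SZ (dim V) b)) < dim E"
    and "dim (rho (dim V) b ` SZ (dim V) b) \<le> dim V"
proof -
  let ?d = "dim V"
  let ?K = "kap ?d b ` quat_space ?d" and ?A = "rho ?d b ` SZ ?d b"
  note E = gpairD(1,3)[OF g]
  have K: "hsub ?K" "?K \<subseteq> E" using hsub_kap_image[OF E b] kap_in[OF E b] by auto
  have "subspace ?A" "?A \<subseteq> V"
    using rho_in[OF b] linear_on_image_subspace[OF hsubD(1)[OF hsub_SZ] linear_imp_linear_on[OF linear_rho]] by auto
  then show Ad: "dim ?A \<le> ?d" using fin_dim_subset(2)[OF gpairD(4)[OF g]] by blast
  have KE: "dim ?K \<le> dim E" using fin_dim_subset(2)[OF hsubD(2)[OF E(1)] hsubD(1)[OF K(1)] K(2)] .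
  \<comment> \<open>Nonzero syzygies are required to apply the inequality;
    \<open>3 \<le> dim V\<close> is there for this, since without syzygies the image would have
    dimension \<open>4 * dim V\<close>, more than \<open>2 * dim V + 4\<close>.\<close>
  have "SZ ?d b \<noteq> {0}"
  proof
    assume "SZ ?d b = {0}"
    then have "dim ?K = 4 * ?d" using dim_SZ[of ?d b] by simp
    then show False using KE d by simp
  qed
  then have "2 * dim (SZ0 ?d b) < dim (SZ ?d b)" using gpair_dim_less[OF gpair_SZ[OF g b]] by blast
  then have Kb: "2 * ?d + 2 * (?d - dim ?A) < dim ?K"
    using dim_SZ[of ?d b] dim_SZ0[of ?d b] Ad by linarith
  then show "2 * ?d + 2 * (?d - dim ?A) < dim E" using KE by simp
  show "?K = E"
  proof (rule ccontr)
    assume n: "?K \<noteq> E"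
    obtain C where C: "hsub C" "C \<subseteq> E" "?K \<inter> C = {0}" "E = {x + y | x y. x \<in> ?K \<and> y \<in> C}"
      by (rule hsub_complement[OF K(1) E(1) K(2)])
    have "C \<noteq> {0}"
    proof
      assume "C = {0}"
      then have "E = ?K" using C(4) by simp
      then show False using n by simp
    qed
    then have "4 \<le> dim C" by (rule hsub_dim_ge[OF C(1)])
    moreover have "dim E = dim ?K + dim C"
      using fin_dim_sum(2)[OF hsubD(2)[OF K(1)] hsubD(2)[OF C(1)] C(3)] C(4) by simp
    ultimately show False using Kb d by linarith
  qed
qed

lemma induced_SZ_map:
  assumes b: "bas d b V" and b': "bas d' b' V'" and E: "hsub E" "V \<subseteq> E"
    and f: "hlin E f" "f ` V \<subseteq> V'"
  obtains h where "\<And>S. hlin S h" "\<And>x. h x \<in> quat_space d'"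
    "\<And>x. rho d' b' (h x) = f (rho d b x)" "h ` SZ d b \<subseteq> SZ d' b'" "h ` SZ0 d b \<subseteq> SZ0 d' b'"
proof (rule induced_syzygy_map[OF b b' E f])
  fix h assume h: "\<And>S. hlin S h" "\<And>x. h x \<in> quat_space d'"
    "\<And>x. rho d' b' (h x) = f (rho d b x)" "\<And>x. kap d' b' (h x) = f (kap d b x)"
  have f0: "f 0 = 0" using linear_on_zero[OF hlin_linear_on[OF f(1)] hsubD(1)[OF E(1)]] .
  have 1: "h ` SZ d b \<subseteq> SZ d' b'" using h(2,4) f0 by (auto simp: SZ_def)
  then have "h ` SZ0 d b \<subseteq> SZ0 d' b'" using h(3) f0 by (auto simp: SZ0_def)
  then show thesis using that[OF h(1-3) 1] by blast
qed

text \<open>Here \<open>dim E = 2 * dim V + 2\<close>, so the bound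
  \<open>2 * dim V + 2 * defect < dim E\<close> leaves defect \<open>0\<close>, where the defect is
  the codimension in \<open>V\<close> of the real parts of syzygies.\<close>

lemma TU_reg:
  assumes T: "TU (Suc k) V E" and b: "bas (dim V) b V"
  shows "reg (dim V) b V E" and "TU k (SZ0 (dim V) b) (SZ (dim V) b)"
proof -
  have g: "gpair V E" and d: "dim V = 2 * k + 3" "dim E = 4 * k + 8" using T by (auto simp: TU_def)
  have le: "dim E \<le> 2 * dim V + 4" "3 \<le> dim V" using d by auto
  let ?A = "rho (dim V) b ` SZ (dim V) b"
  note bd = reg_dim_bounds[OF g b le]
  have "dim V \<le> dim ?A" using bd(2) d by linarith
  moreover have "subspace ?A" "?A \<subseteq> V"
    using rho_in[OF b] linear_on_image_subspace[OF hsubD(1)[OF hsub_SZ] linear_imp_linear_on[OF linear_rho]] by auto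
  ultimately have "?A = V" using fin_dim_subset_eq[OF gpairD(4)[OF g]] by blast
  then show r: "reg (dim V) b V E" using bd(1) by (simp add: reg_def)
  show "TU k (SZ0 (dim V) b) (SZ (dim V) b)"
    using gpair_SZ[OF g b] dim_SZ[of "dim V" b] dim_SZ0[of "dim V" b] r d by (auto simp: TU_def reg_def)
qed

text \<open>Now \<open>dim E = 2 * dim V + 4\<close>, so the bound only gives defect at most
  \<open>1\<close>. The real parts of syzygies form an \<open>R\<close>-stable space, hence of even
  dimension like \<open>V\<close>, which excludes defect \<open>1\<close>.\<close>

lemma TU'_reg:
  assumes T: "TU' (Suc k) V E" and b: "bas (dim V) b V"
  shows "reg (dim V) b V E" and "TU' k (SZ0 (dim V) b) (SZ (dim V) b)"
proof -
  let ?d = "dim V"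
  have g: "gpair V E" and d: "dim V = 4 * k + 4" "dim E = 8 * k + 12" using T by (auto simp: TU'_def)
  obtain R where R: "hlin E R" "R ` E \<subseteq> E" "R ` V \<subseteq> V" "\<forall>x\<in>E. R (R x) = - x"
    using T unfolding TU'_def by blast
  note E = gpairD(1,3)[OF g]
  have le: "dim E \<le> 2 * dim V + 4" "3 \<le> dim V" using d by auto
  let ?A = "rho ?d b ` SZ ?d b"
  note bd = reg_dim_bounds[OF g b le]
  obtain h where h: "\<And>S. hlin S h" "\<And>x. h x \<in> quat_space ?d" "\<And>x. rho ?d b (h x) = R (rho ?d b x)"
    "h ` SZ ?d b \<subseteq> SZ ?d b" "h ` SZ0 ?d b \<subseteq> SZ0 ?d b"
    using induced_SZ_map[OF b b E R(1,3)] by metis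
  have A: "subspace ?A" "?A \<subseteq> V"
    using rho_in[OF b] linear_on_image_subspace[OF hsubD(1)[OF hsub_SZ] linear_imp_linear_on[OF linear_rho]] by auto
  have fA: "fin_dim ?A" using fin_dim_subset(1)[OF gpairD(4)[OF g] A] .
  have AE: "?A \<subseteq> E" using A(2) E(2) by blast
  have RA: "R ` ?A \<subseteq> ?A"
  proof
    fix y assume "y \<in> R ` ?A"
    then obtain x where x: "x \<in> SZ ?d b" "y = R (rho ?d b x)" by blast
    have "y = rho ?d b (h x)" using x(2) h(3) by simp
    moreover have "h x \<in> SZ ?d b" using x(1) h(4) by blast
    ultimately show "y \<in> ?A" by blast
  qed
  have "R (R x) = - x" if "x \<in> ?A" for x using that AE R(4) by blast
  then have "even (dim ?A)"
    using even_dim_complex_structure[OF fA linear_on_subset[OF hlin_linear_on[OF R(1)] AE] RA] by blast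
  then obtain c where c: "dim ?A = 2 * c" by (elim evenE)
  have "2 * dim V + 2 * (dim V - 2 * c) < dim E" using bd(2) c by simp
  then have "dim V \<le> 2 * c" using d by presburger
  then have "dim V \<le> dim ?A" using c by simp
  then have "?A = V" using A fin_dim_subset_eq[OF gpairD(4)[OF g]] by blast
  then show r: "reg ?d b V E" using bd(1) by (simp add: reg_def)
  \<comment> \<open>\<open>rho\<close> intertwines \<open>h\<close> with \<open>R\<close>, so all
    real parts along the orbit of \<open>h (h x) + x\<close> vanish and \<open>rho_separates\<close>
    applies.\<close>
  have hh: "h (h x) = - x" if x: "x \<in> SZ ?d b" for x
  proof -
    have "rho ?d b (p \<star> (h (h x) + x)) = 0" for p
    proof -
      have "p \<star> h (h x) = h (h (p \<star> x))" using hlinD(2)[OF h(1)[of UNIV]] by simp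
      moreover have "R (R (rho ?d b (p \<star> x))) = - rho ?d b (p \<star> x)"
        using rho_in[OF b, of "p \<star> x"] E(2) R(4) by blast
      ultimately show ?thesis by (simp add: hsm_simps rho_simps h(3))
    qed
    moreover have "h (h x) + x \<in> quat_space ?d"
      using h(2) x by (intro subspace_add[OF quat_space_subspace]) (auto simp: SZ_def)
    ultimately have "h (h x) + x = 0" using rho_separates[OF b] by blast
    then show ?thesis by (simp add: eq_neg_iff_add_eq_0)
  qed
  have "dim (SZ ?d b) = 8 * k + 4" "dim (SZ0 ?d b) = 4 * k"
    using dim_SZ[of ?d b] dim_SZ0[of ?d b] r d by (auto simp: reg_def)
  then show "TU' k (SZ0 ?d b) (SZ ?d b)"
    using gpair_SZ[OF g b] h(1,4,5) hh unfolding TU'_def by blast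
qed

subsection \<open>Uniqueness of each type\<close>

definition pair_iso :: "qvec set \<Rightarrow> qvec set \<Rightarrow> qvec set \<Rightarrow> qvec set \<Rightarrow> bool" where
  "pair_iso V E V' E' \<longleftrightarrow> (\<exists>f g. hlin E f \<and> hlin E' g \<and> f ` E \<subseteq> E' \<and> g ` E' \<subseteq> E \<and> f ` V \<subseteq> V' \<and> g ` V' \<subseteq> V \<and>
     (\<forall>x\<in>E. g (f x) = x) \<and> (\<forall>y\<in>E'. f (g y) = y))"

text \<open>Both directions of the syzygy isomorphism descend by \<open>hom_of_SZ_map\<close>. The
  composites are the identity on \<open>V\<close> and on \<open>V'\<close>, whose vectors are real
  parts of syzygies, hence on the spaces that they generate.\<close>

lemma pair_iso_of_SZ:
  assumes g: "gpair V E" "gpair V' E'" and b: "bas d b V" "bas d' b' V'"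
    and r: "reg d b V E" "reg d' b' V' E'" and i: "pair_iso (SZ0 d b) (SZ d b) (SZ0 d' b') (SZ d' b')"
  shows "pair_iso V E V' E'"
proof -
  obtain h h' where h: "hlin (SZ d b) h" "hlin (SZ d' b') h'" "h ` SZ d b \<subseteq> SZ d' b'" "h' ` SZ d' b' \<subseteq> SZ d b"
    "h ` SZ0 d b \<subseteq> SZ0 d' b'" "h' ` SZ0 d' b' \<subseteq> SZ0 d b" "\<forall>x\<in>SZ d b. h' (h x) = x" "\<forall>y\<in>SZ d' b'. h (h' y) = y"
    using i unfolding pair_iso_def by (elim exE conjE) (rule that; assumption)
  note E = gpairD(1,3)[OF g(1)] and E' = gpairD(1,3)[OF g(2)]
  obtain f where f: "hlin E f" "f ` E \<subseteq> E'" "f ` V \<subseteq> V'" "\<forall>g\<in>SZ d b. f (rho d b g) = rho d' b' (h g)"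
    by (rule hom_of_SZ_map[OF b E E' r(1) h(1,3,5)])
  obtain f' where f': "hlin E' f'" "f' ` E' \<subseteq> E" "f' ` V' \<subseteq> V" "\<forall>g\<in>SZ d' b'. f' (rho d' b' g) = rho d b (h' g)"
    by (rule hom_of_SZ_map[OF b(2,1) E' E r(2) h(2,4,6)])
  have K: "kap d b ` quat_space d = E" "kap d' b' ` quat_space d' = E'" using r by (auto simp: reg_def)
  have hid: "hlin S (\<lambda>x. x)" for S by (simp add: hlin_def)
  have "f' (f v) = v" if v: "v \<in> V" for v
  proof -
    obtain x where x: "x \<in> SZ d b" "v = rho d b x" using v r(1) unfolding reg_def by blast
    have "h x \<in> SZ d' b'" using x(1) h(3) by blast
    then show ?thesis using x f(4) f'(4) h(7) by simp
  qed
  then have 1: "f' (f e) = e" if "e \<in> E" for e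
    using hlin_eq_on[OF b(1) E K(1) hlin_compose[OF f(1,2) f'(1)] hid _ that] by blast
  have "f (f' v) = v" if v: "v \<in> V'" for v
  proof -
    obtain x where x: "x \<in> SZ d' b'" "v = rho d' b' x" using v r(2) unfolding reg_def by blast
    have "h' x \<in> SZ d b" using x(1) h(4) by blast
    then show ?thesis using x f(4) f'(4) h(8) by simp
  qed
  then have "f (f' e) = e" if "e \<in> E'" for e
    using hlin_eq_on[OF b(2) E' K(2) hlin_compose[OF f'(1,2) f(1)] hid _ that] by blast
  then show ?thesis unfolding pair_iso_def using f(1-3) f'(1-3) 1 by blast
qed

lemma hline_map:
  assumes "e \<noteq> 0"
  obtains f where "hlin (hline e) f" "\<forall>p. f (p \<star> e) = p \<star> e'"
proof -
  define f where "f x = (SOME p. x = p \<star> e) \<star> e'" for x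
  have f: "f (p \<star> e) = p \<star> e'" for p
  proof -
    have "p \<star> e = (SOME q. p \<star> e = q \<star> e) \<star> e" by (rule someI_ex) blast
    then have "(p - (SOME q. p \<star> e = q \<star> e)) \<star> e = 0" by (simp add: hsm_simps)
    then have "(SOME q. p \<star> e = q \<star> e) = p" using assms by (simp add: hsm_eq_0)
    then show ?thesis by (simp add: f_def)
  qed
  have "f (p \<star> e + q \<star> e) = f (p \<star> e) + f (q \<star> e)" for p q
    using f[of "p + q"] f by (simp add: hsm_simps)
  moreover have "f (p \<star> (q \<star> e)) = p \<star> f (q \<star> e)" for p q
    using f[of "p * q"] f by (simp add: hsm_simps)
  ultimately have "hlin (hline e) f" by (auto simp: hlin_def hline_def)
  then show ?thesis using f that by blast
qed

lemma hline_pair_iso: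
  assumes "e \<noteq> 0" "e' \<noteq> 0" "V = (\<lambda>c. (c *\<^sub>R 1) \<star> e) ` C" "V' = (\<lambda>c. (c *\<^sub>R 1) \<star> e') ` C"
  shows "pair_iso V (hline e) V' (hline e')"
proof -
  obtain f where f: "hlin (hline e) f" "\<forall>p. f (p \<star> e) = p \<star> e'" by (rule hline_map[OF assms(1)])
  obtain g where g: "hlin (hline e') g" "\<forall>p. g (p \<star> e') = p \<star> e" by (rule hline_map[OF assms(2)])
  show ?thesis unfolding pair_iso_def
    by (intro exI[of _ f] exI[of _ g]) (use f g assms in \<open>auto simp: hline_def\<close>)
qed

lemma dim_four_hline:
  assumes "hsub E" "dim E = 4" "e \<in> E" "e \<noteq> 0" shows "E = hline e"
  using fin_dim_subset_eq[OF hsubD(2)[OF assms(1)] hsubD(1)[OF hsub_hline[OF assms(1,3)]] hline_subset[OF assms(1,3)]]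
    dim_hline[OF assms(4)] assms(2) by simp

lemma TU_0_cases:
  assumes "TU 0 V E"
  obtains e where "e \<noteq> 0" "E = hline e" "V = (\<lambda>c. (c *\<^sub>R 1) \<star> e) ` UNIV"
proof -
  have g: "gpair V E" and d: "dim V = 1" "dim E = 4" using assms by (auto simp: TU_def)
  have "V \<noteq> {0}" using d by auto
  then obtain e where e: "e \<in> V" "e \<noteq> 0" using subspace_0[OF gpairD(2)[OF g]] by blast
  then have "E = hline e" using gpairD(1,3)[OF g] d by (intro dim_four_hline) auto
  moreover have "span {e} = V"
  proof (rule fin_dim_subset_eq[OF gpairD(4)[OF g]])
    show "span {e} \<subseteq> V" using e gpairD(2)[OF g] by (intro span_minimal) auto
    show "dim V \<le> dim (span {e})"
      using dim_span_eq_card_independent[of "{e}"] e(2) d by (simp add: independent_insert)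
  qed simp
  ultimately show ?thesis using that[OF e(2)] by (simp add: span_singleton hsm_simps)
qed

lemma TU'_0_cases:
  assumes "TU' 0 V E"
  obtains e where "e \<noteq> 0" "E = hline e" "V = (\<lambda>c. (c *\<^sub>R 1) \<star> e) ` {0}"
proof -
  have g: "gpair V E" and d: "dim V = 0" "dim E = 4" using assms by (auto simp: TU'_def)
  have V: "V = {0}" using d fin_dim_eq_0[OF gpairD(4)[OF g]] by simp
  have "E \<noteq> {0}" using d by auto
  then obtain e where e: "e \<in> E" "e \<noteq> 0" using subspace_0[OF hsubD(1)[OF gpairD(1)[OF g]]] by blast
  then have "E = hline e" using gpairD(1)[OF g] d by (intro dim_four_hline) auto
  then show ?thesis using that[OF e(2)] V by (simp add: hsm_simps)
qed

lemma TU_unique: "TU k V E \<Longrightarrow> TU k V' E' \<Longrightarrow> pair_iso V E V' E'"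
proof (induction k arbitrary: V E V' E')
  case 0
  obtain e where e: "e \<noteq> 0" "E = hline e" "V = (\<lambda>c. (c *\<^sub>R 1) \<star> e) ` UNIV" by (rule TU_0_cases[OF 0(1)])
  obtain e' where e': "e' \<noteq> 0" "E' = hline e'" "V' = (\<lambda>c. (c *\<^sub>R 1) \<star> e') ` UNIV" by (rule TU_0_cases[OF 0(2)])
  show ?case using hline_pair_iso[OF e(1) e'(1) e(3) e'(3)] e(2) e'(2) by simp
next
  case (Suc k)
  have g: "gpair V E" "gpair V' E'" using Suc.prems by (auto simp: TU_def)
  obtain b where b: "bas (dim V) b V" using bas_exists[OF gpairD(4)[OF g(1)]] by metis
  obtain b' where b': "bas (dim V') b' V'" using bas_exists[OF gpairD(4)[OF g(2)]] by metis
  show ?case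
    by (rule pair_iso_of_SZ[OF g b b' TU_reg(1)[OF Suc.prems(1) b] TU_reg(1)[OF Suc.prems(2) b']])
      (rule Suc.IH[OF TU_reg(2)[OF Suc.prems(1) b] TU_reg(2)[OF Suc.prems(2) b']])
qed

lemma TU'_unique: "TU' k V E \<Longrightarrow> TU' k V' E' \<Longrightarrow> pair_iso V E V' E'"
proof (induction k arbitrary: V E V' E')
  case 0
  obtain e where e: "e \<noteq> 0" "E = hline e" "V = (\<lambda>c. (c *\<^sub>R 1) \<star> e) ` {0}" by (rule TU'_0_cases[OF 0(1)])
  obtain e' where e': "e' \<noteq> 0" "E' = hline e'" "V' = (\<lambda>c. (c *\<^sub>R 1) \<star> e') ` {0}" by (rule TU'_0_cases[OF 0(2)])
  show ?case using hline_pair_iso[OF e(1) e'(1) e(3) e'(3)] e(2) e'(2) by simp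
next
  case (Suc k)
  have g: "gpair V E" "gpair V' E'" using Suc.prems by (auto simp: TU'_def)
  obtain b where b: "bas (dim V) b V" using bas_exists[OF gpairD(4)[OF g(1)]] by metis
  obtain b' where b': "bas (dim V') b' V'" using bas_exists[OF gpairD(4)[OF g(2)]] by metis
  show ?case
    by (rule pair_iso_of_SZ[OF g b b' TU'_reg(1)[OF Suc.prems(1) b] TU'_reg(1)[OF Suc.prems(2) b']])
      (rule Suc.IH[OF TU'_reg(2)[OF Suc.prems(1) b] TU'_reg(2)[OF Suc.prems(2) b']])
qed

lemma lab_pair_unique: "lab_pair l V E \<Longrightarrow> lab_pair l V' E' \<Longrightarrow> pair_iso V E V' E'"
  by (cases l) (auto intro: TU_unique TU'_unique)

subsection \<open>Morphisms between different types\<close>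

text \<open>The effect of the syzygy functor on types. Truncated subtraction leaves the two labels
  with \<open>k = 0\<close> unchanged; the map is applied only at positions above \<open>2\<close>,
  where it lowers the position by \<open>2\<close>.\<close>

fun lab_pred :: "crq_label \<Rightarrow> crq_label" where
  "lab_pred (Lab_U k) = Lab_U (k - 1)"
| "lab_pred (Lab_U' k) = Lab_U' (k - 1)"

lemma label_pos_eq_2: "label_pos l = 2 \<Longrightarrow> l = Lab_U 0"
proof (cases l)
  case (Lab_U' k)
  moreover assume "label_pos l = 2"
  ultimately have "2 * k + 1 = 2" by simp
  then have False by presburger
  then show ?thesis ..
qed simp

lemma lab_pair_reg:
  assumes "lab_pair l V E" "bas (dim V) b V" "2 < label_pos l"
  shows "reg (dim V) b V E" "lab_pair (lab_pred l) (SZ0 (dim V) b) (SZ (dim V) b)"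
proof -
  obtain k where k: "l = Lab_U (Suc k) \<or> l = Lab_U' (Suc k)"
  proof (cases l)
    case (Lab_U k)
    then show ?thesis using assms(3) that[of "k - 1"] by simp
  next
    case (Lab_U' k)
    then show ?thesis using assms(3) that[of "k - 1"] by simp
  qed
  then show "reg (dim V) b V E" "lab_pair (lab_pred l) (SZ0 (dim V) b) (SZ (dim V) b)"
    using TU_reg[OF _ assms(2)] TU'_reg[OF _ assms(2)] assms(1) by auto
qed

text \<open>Type \<open>U\<^sub>0\<close> has no nonzero syzygies and so is not regular, but there
  the image of \<open>kap\<close> is a nonzero quaternionic subspace of a four-dimensional
  space.\<close>

lemma lab_pair_kap:
  assumes "lab_pair l V E" "bas (dim V) b V" "1 < label_pos l"
  shows "kap (dim V) b ` quat_space (dim V) = E"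
proof (cases "2 < label_pos l")
  case True
  then show ?thesis using lab_pair_reg(1)[OF assms(1,2)] by (simp add: reg_def)
next
  case False
  then have "label_pos l = 2" using assms(3) by simp
  then have "l = Lab_U 0" by (rule label_pos_eq_2)
  then have T: "TU 0 V E" using assms(1) by simp
  then have g: "gpair V E" and d: "dim V = 1" "dim E = 4" by (auto simp: TU_def)
  note E = gpairD(1,3)[OF g]
  let ?K = "kap (dim V) b ` quat_space (dim V)"
  have K: "hsub ?K" "?K \<subseteq> E" using hsub_kap_image[OF E assms(2)] kap_in[OF E assms(2)] by auto
  have "?K \<noteq> {0}"
  proof
    assume "?K = {0}"
    then have "V \<subseteq> {0}" using bas_subset_kap_image[OF assms(2)] by simp
    then have "V = {0}" using subspace_0[OF gpairD(2)[OF g]] by blast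
    then show False using d by simp
  qed
  then show ?thesis
    using hsub_dim_ge[OF K(1)] d fin_dim_subset_eq[OF hsubD(2)[OF E(1)] hsubD(1)[OF K(1)] K(2)] by simp
qed

text \<open>Passing to syzygies lowers both positions by \<open>2\<close>. The descent ends at a
  target of type \<open>U'\<^sub>0\<close>, where \<open>V' = 0\<close> while the source is
  generated by \<open>V\<close>, or of type \<open>U\<^sub>0\<close>, whose syzygies vanish while
  every vector of the source \<open>V\<close> is a real part of a syzygy.\<close>

lemma lab_pair_hom_zero:
  "lab_pair l V E \<Longrightarrow> lab_pair l' V' E' \<Longrightarrow> label_pos l' < label_pos l \<Longrightarrow> hlin E f \<Longrightarrow> f ` E \<subseteq> E' \<Longrightarrow>
    f ` V \<subseteq> V' \<Longrightarrow> e \<in> E \<Longrightarrow> f e = 0"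
proof (induction "label_pos l'" arbitrary: l l' V E V' E' f e rule: less_induct)
  case less
  note g = lab_pair_gpair[OF less.prems(1)] lab_pair_gpair[OF less.prems(2)]
  note E = gpairD(1,3)[OF g(1)] and E' = gpairD(1,3)[OF g(2)]
  note f = less.prems(4,5,6)
  obtain b where b: "bas (dim V) b V" using bas_exists[OF gpairD(4)[OF g(1)]] by metis
  obtain b' where b': "bas (dim V') b' V'" using bas_exists[OF gpairD(4)[OF g(2)]] by metis
  have pos: "1 \<le> label_pos l'" by (cases l') auto
  have K: "kap (dim V) b ` quat_space (dim V) = E"
    using lab_pair_kap[OF less.prems(1) b] pos less.prems(3) by simp
  have "hlin E (\<lambda>_. 0)" by (simp add: hlin_def hsm_simps)
  then have zero: "f e = 0" if "\<And>v. v \<in> V \<Longrightarrow> f v = 0"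
    using hlin_eq_on[OF b E K f(1) _ _ less.prems(7)] that by blast
  show ?case
  proof (cases "label_pos l' = 1")
    case True
    then have "l' = Lab_U' 0" by (cases l') auto
    then have "dim V' = 0" using less.prems(2) by (simp add: TU'_def)
    then have "V' = {0}" using fin_dim_eq_0[OF gpairD(4)[OF g(2)]] by simp
    then show ?thesis using f(3) by (intro zero) auto
  next
    case False
    then have "2 < label_pos l" using pos less.prems(3) by simp
    note r = lab_pair_reg[OF less.prems(1) b this]
    obtain h where h: "\<And>S. hlin S h" "\<And>x. h x \<in> quat_space (dim V')" "\<And>x. rho (dim V') b' (h x) = f (rho (dim V) b x)"
      "h ` SZ (dim V) b \<subseteq> SZ (dim V') b'" "h ` SZ0 (dim V) b \<subseteq> SZ0 (dim V') b'"
      using induced_SZ_map[OF b b' E f(1,3)] by metis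
    have h0: "h x = 0" if x: "x \<in> SZ (dim V) b" for x
    proof (cases "label_pos l' = 2")
      case True
      then have "l' = Lab_U 0" by (rule label_pos_eq_2)
      then have d: "dim V' = 1" "dim E' = 4" using less.prems(2) by (auto simp: TU_def)
      \<comment> \<open>The count is \<open>4 * 1 - 4 = 0\<close>.\<close>
      then have "dim (SZ (dim V') b') = 0"
        using dim_SZ[of "dim V'" b'] lab_pair_kap[OF less.prems(2) b'] True by simp
      then have "SZ (dim V') b' = {0}" using fin_dim_eq_0[OF hsubD(2)[OF hsub_SZ]] by simp
      then show ?thesis using h(4) x by blast
    next
      case n2: False
      then have l2: "2 < label_pos l'" using pos False by simp
      note r' = lab_pair_reg[OF less.prems(2) b' l2]
      have p: "label_pos (lab_pred l') + 2 = label_pos l'" using l2 by (cases l') auto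
      have "label_pos (lab_pred l) + 2 = label_pos l" using \<open>2 < label_pos l\<close> by (cases l) auto
      then have "label_pos (lab_pred l') < label_pos (lab_pred l)" "label_pos (lab_pred l') < label_pos l'"
        using p less.prems(3) by auto
      then show ?thesis using less.hyps[OF _ r(2) r'(2) _ h(1) h(4,5) x] by blast
    qed
    show ?thesis
    proof (rule zero)
      fix v assume "v \<in> V"
      then obtain x where "x \<in> SZ (dim V) b" "v = rho (dim V) b x" using r(1) unfolding reg_def by blast
      then show "f v = 0" using h(3)[of x] h0 by (simp add: rho_simps)
    qed
  qed
qed

subsection \<open>Decomposition of pairs\<close>

text \<open>Directness is recorded indirectly: the blocks span, and their dimensions add up to
  \<open>dim E\<close>. This is the form in which bijectivity is later obtained.\<close>

lemma gpair_decomposes: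
  "gpair V E \<Longrightarrow> \<exists>bs. (\<forall>(l, W, F)\<in>set bs. lab_pair l W F \<and> W \<subseteq> V \<and> F \<subseteq> E) \<and>
     sum_list (map (\<lambda>(l, W, F). dim F) bs) = dim E \<and>
     E \<subseteq> span (\<Union>(l, W, F)\<in>set bs. F) \<and> V \<subseteq> span (\<Union>(l, W, F)\<in>set bs. W)"
  (is "_ \<Longrightarrow> \<exists>bs. ?P bs V E")
proof (induction "dim E" arbitrary: V E rule: less_induct)
  case less
  show ?case
  proof (cases "E = {0}")
    case True
    moreover have "V \<subseteq> E" using gpairD(3)[OF less.prems] .
    ultimately show ?thesis by (intro exI[of _ "[]"]) auto
  next
    case E0: False
    show ?thesis
    proof (cases "splits V E")
      case False
      then obtain l where "lab_pair l V E" using indecomposable[OF less.prems E0] by blast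
      then show ?thesis using span_superset by (intro exI[of _ "[(l, V, E)]"]) auto
    next
      case True
      then obtain V1 E1 V2 E2 where s: "gpair V1 E1" "gpair V2 E2" "E1 \<noteq> {0}" "E2 \<noteq> {0}"
        "E1 \<inter> E2 = {0}" "E = {x + y | x y. x \<in> E1 \<and> y \<in> E2}" "V = {x + y | x y. x \<in> V1 \<and> y \<in> V2}"
        unfolding splits_def by blast
      have d: "dim E = dim E1 + dim E2"
        unfolding s(6) by (rule fin_dim_sum(2)[OF gpairD(5)[OF s(1)] gpairD(5)[OF s(2)] s(5)])
      have "4 \<le> dim E1" "4 \<le> dim E2" using hsub_dim_ge gpairD(1) s(1-4) by blast+
      then have dl: "dim E1 < dim E" "dim E2 < dim E" using d by auto
      obtain bs1 where b1: "?P bs1 V1 E1" using less.hyps[OF dl(1) s(1)] by (elim exE)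
      obtain bs2 where b2: "?P bs2 V2 E2" using less.hyps[OF dl(2) s(2)] by (elim exE)
      note b = b1 b2
      have 0: "0 \<in> V1" "0 \<in> V2" "0 \<in> E1" "0 \<in> E2"
        using subspace_0 gpairD(2) hsubD(1)[OF gpairD(1)] s(1,2) by blast+
      have sub: "V1 \<subseteq> V" "V2 \<subseteq> V" "E1 \<subseteq> E" "E2 \<subseteq> E" using 0 unfolding s(6,7) by force+
      have sp: "x + y \<in> span (A \<union> B)" if "x \<in> span A" "y \<in> span B" for x y :: qvec and A B
        using that span_mono[of A "A \<union> B"] span_mono[of B "A \<union> B"] by (auto intro: span_add)
      have "?P (bs1 @ bs2) V E"
      proof (intro conjI)
        show "\<forall>(l, W, F)\<in>set (bs1 @ bs2). lab_pair l W F \<and> W \<subseteq> V \<and> F \<subseteq> E"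
          using b sub by (auto 0 4)
        show "sum_list (map (\<lambda>(l, W, F). dim F) (bs1 @ bs2)) = dim E" using b d by simp
        have U: "(\<Union>(l, W, F)\<in>set (bs1 @ bs2). F) = (\<Union>(l, W, F)\<in>set bs1. F) \<union> (\<Union>(l, W, F)\<in>set bs2. F)"
          "(\<Union>(l, W, F)\<in>set (bs1 @ bs2). W) = (\<Union>(l, W, F)\<in>set bs1. W) \<union> (\<Union>(l, W, F)\<in>set bs2. W)"
          by auto
        show "E \<subseteq> span (\<Union>(l, W, F)\<in>set (bs1 @ bs2). F)"
          unfolding U s(6) using conjunct1[OF conjunct2[OF conjunct2[OF b1]]]
            conjunct1[OF conjunct2[OF conjunct2[OF b2]]] by (auto intro!: sp)
        show "V \<subseteq> span (\<Union>(l, W, F)\<in>set (bs1 @ bs2). W)"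
          unfolding U s(7) using conjunct2[OF conjunct2[OF conjunct2[OF b1]]]
            conjunct2[OF conjunct2[OF conjunct2[OF b2]]] by (auto intro!: sp)
      qed
      then show ?thesis by blast
    qed
  qed
qed

section \<open>Verification that the explicit models have the two types\<close>

section \<open>The model spaces\<close>

lemma family_sum_real:
  "dim (family_sum {..<n} (\<lambda>_. UNIV :: real set)) = n" "fin_dim (family_sum {..<n} (\<lambda>_. UNIV :: real set))"
  using dim_family_sum[of "{..<n}" "\<lambda>_. UNIV :: real set"] fin_dim_real by auto

text \<open>The span of \<open>1\<close> and \<open>q\<close> is a copy of the complex field. If
  \<open>J\<close> sends one of its nonzero elements back into it, division by that element, via the
  conjugate \<open>r - s q\<close>, shows that \<open>J\<close> lies in it, and \<open>q\<close> and
  \<open>- q\<close> are its only imaginary units.\<close>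

lemma sphere_plane:
  assumes J: "J \<in> Im_quat_sphere" and q: "q \<in> Im_quat_sphere"
    and z: "r *\<^sub>R 1 + s *\<^sub>R q \<noteq> 0" and eq: "J * (r *\<^sub>R 1 + s *\<^sub>R q) = r' *\<^sub>R 1 + s' *\<^sub>R q"
  shows "J = q \<or> J = - q"
proof -
  define n where "n = r * r + s * s"
  have "n \<noteq> 0" using z by (auto simp: n_def sum_squares_eq_zero_iff)
  have qq: "q * q = - 1" using q by (simp add: sphere_iff_square)
  have sq: "(r *\<^sub>R 1 + s *\<^sub>R q) * (r *\<^sub>R 1 - s *\<^sub>R q) = n *\<^sub>R 1"
    by (simp add: n_def algebra_simps qq)
  have "n *\<^sub>R J = J * ((r *\<^sub>R 1 + s *\<^sub>R q) * (r *\<^sub>R 1 - s *\<^sub>R q))" by (simp add: sq)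
  also have "\<dots> = (r' *\<^sub>R 1 + s' *\<^sub>R q) * (r *\<^sub>R 1 - s *\<^sub>R q)" by (simp only: mult.assoc[symmetric] eq)
  also have "\<dots> = (r * r' + s * s') *\<^sub>R 1 + (r * s' - s * r') *\<^sub>R q"
    by (simp add: algebra_simps qq)
  finally have nJ: "n *\<^sub>R J = (r * r' + s * s') *\<^sub>R 1 + (r * s' - s * r') *\<^sub>R q" .
  then have "qRe (n *\<^sub>R J) = qRe ((r * r' + s * s') *\<^sub>R 1 + (r * s' - s * r') *\<^sub>R q)" by simp
  then have "r * r' + s * s' = 0" using J q by (simp add: sphere_iff)
  then have "n *\<^sub>R J = (r * s' - s * r') *\<^sub>R q" using nJ by simp
  then have "inverse n *\<^sub>R (n *\<^sub>R J) = inverse n *\<^sub>R ((r * s' - s * r') *\<^sub>R q)" by simp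
  then obtain t where t: "J = t *\<^sub>R q" using \<open>n \<noteq> 0\<close> by auto
  then have "t * t = 1" using J q by (simp add: sphere_iff)
  then have "t = 1 \<or> t = - 1" by (simp add: square_eq_1_iff)
  then show ?thesis using t by auto
qed

text \<open>Coordinates \<open>0, ..., k\<close> of \<open>a\<close> are the real parts; coordinates
  \<open>k + 1, ..., 2 k\<close> are the coefficients of the vectors
  \<open>V_vec q k j\<close>.\<close>

definition V_param :: "(nat \<Rightarrow> nat \<Rightarrow> quat) \<Rightarrow> nat \<Rightarrow> (nat \<Rightarrow>\<^sub>0 real) \<Rightarrow> qvec" where
  "V_param q k a = (\<Sum>i<Suc k. sg i (lk a i *\<^sub>R 1)) + (\<Sum>j<k. lk a (Suc k + j) *\<^sub>R V_vec q k j)"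

text \<open>The coefficient of \<open>q k i\<close> in entry \<open>i\<close>. This entry is touched
  by the generators \<open>i\<close> and \<open>i - 1\<close>, the coefficient of the latter being
  stored at index \<open>k + 1 + (i - 1)\<close>; at either end one of the two is absent.\<close>

definition V_coeff :: "nat \<Rightarrow> (nat \<Rightarrow>\<^sub>0 real) \<Rightarrow> nat \<Rightarrow> real" where
  "V_coeff k a i = (if i < k then lk a (Suc k + i) else 0) + (if 0 < i then lk a (k + i) else 0)"

lemma lk_sum_V_vec:
  "i \<le> k \<Longrightarrow> lk (\<Sum>j<k. c j *\<^sub>R V_vec q k j) i = ((if i < k then c i else 0) + (if 0 < i then c (i - 1) else 0)) *\<^sub>R q k i"
  "k < i \<Longrightarrow> lk (\<Sum>j<k. c j *\<^sub>R V_vec q k j) i = 0"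
proof -
  have *: "lk (\<Sum>j<k. c j *\<^sub>R V_vec q k j) i =
    (\<Sum>j<k. if j = i then c j *\<^sub>R q k j else 0) + (\<Sum>j<k. if Suc j = i then c j *\<^sub>R q k (Suc j) else 0)"
    unfolding lookup_sum sum.distrib[symmetric]
    by (rule sum.cong) (auto simp: V_vec_def lk_sg scaleR_add_right)
  have 2: "(\<Sum>j<k. if Suc j = i then c j *\<^sub>R q k (Suc j) else 0) =
      (if 0 < i \<and> i \<le> k then c (i - 1) *\<^sub>R q k i else 0)"
  proof (cases i)
    case (Suc i')
    then show ?thesis using sum.delta[of "{..<k}" i' "\<lambda>j. c j *\<^sub>R q k (Suc j)"] by auto
  qed simp
  have 1: "(\<Sum>j<k. if j = i then c j *\<^sub>R q k j else 0) = (if i < k then c i *\<^sub>R q k i else 0)"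
    using sum.delta[of "{..<k}" i "\<lambda>j. c j *\<^sub>R q k j"] by simp
  show "i \<le> k \<Longrightarrow> lk (\<Sum>j<k. c j *\<^sub>R V_vec q k j) i = ((if i < k then c i else 0) + (if 0 < i then c (i - 1) else 0)) *\<^sub>R q k i"
    "k < i \<Longrightarrow> lk (\<Sum>j<k. c j *\<^sub>R V_vec q k j) i = 0"
    unfolding * 1 2 by (auto simp: scaleR_add_left)
qed

lemma lk_V_param:
  "lk (V_param q k a) i = (if i \<le> k then lk a i *\<^sub>R 1 + V_coeff k a i *\<^sub>R q k i else 0)"
proof -
  have "lk (\<Sum>i<Suc k. sg i (lk a i *\<^sub>R (1::quat))) i = (if i \<le> k then lk a i *\<^sub>R 1 else 0)"
    by (simp add: lookup_sum lk_sg less_Suc_eq_le del: sum.lessThan_Suc)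
  moreover have "lk (\<Sum>j<k. lk a (Suc k + j) *\<^sub>R V_vec q k j) i = (if i \<le> k then V_coeff k a i *\<^sub>R q k i else 0)"
  proof (cases "i \<le> k")
    case True
    have "V_coeff k a i = (if i < k then lk a (Suc k + i) else 0) + (if 0 < i then lk a (Suc k + (i - 1)) else 0)"
      by (cases i) (auto simp: V_coeff_def)
    then show ?thesis using lk_sum_V_vec(1)[OF True, of "\<lambda>j. lk a (Suc k + j)" q] True by simp
  next
    case False
    then show ?thesis using lk_sum_V_vec(2)[of k i "\<lambda>j. lk a (Suc k + j)" q] by simp
  qed
  ultimately show ?thesis by (simp add: V_param_def)
qed

lemma linear_V_param: "linear (V_param q k)"
  by (rule linearI; rule poly_mapping_eqI) (auto simp: lk_V_param V_coeff_def algebra_simps)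

lemma V_space_param: "V_space q k = V_param q k ` family_sum {..<2 * k + 1} (\<lambda>_. UNIV)"
proof (intro set_eqI iffI)
  fix v assume "v \<in> V_space q k"
  then obtain x c where v: "v = x + (\<Sum>j<k. c j *\<^sub>R V_vec q k j)" "x \<in> quat_space (k + 1)"
    "\<forall>i. lk x i \<in> \<real>" unfolding V_space_def by blast
  define a where "a = (\<Sum>i<Suc k. sg i (qRe (lk x i))) + (\<Sum>j<k. sg (Suc k + j) (c j))"
  have a1: "lk a i = qRe (lk x i)" if "i \<le> k" for i
    using that by (simp add: a_def lookup_sum lk_sg less_Suc_eq_le del: sum.lessThan_Suc)
  have a2: "lk a (Suc k + j) = c j" if "j < k" for j
    using that by (simp add: a_def lookup_sum lk_sg del: sum.lessThan_Suc)
  have "a \<in> family_sum {..<2 * k + 1} (\<lambda>_. UNIV)"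
    by (subst family_sum_alt) (auto simp: a_def lookup_sum lk_sg intro!: sum.neutral)
  moreover have "v = V_param q k a"
  proof -
    have "x = (\<Sum>i<Suc k. sg i (lk a i *\<^sub>R 1))"
    proof (rule poly_mapping_eqI)
      fix i
      obtain r where "lk x i = of_real r" using v(3) by (metis Reals_cases)
      then have "lk x i = qRe (lk x i) *\<^sub>R 1" by (simp add: of_real_def)
      then show "lk x i = lk (\<Sum>i<Suc k. sg i (lk a i *\<^sub>R 1)) i"
        using v(2) a1[of i]
        by (cases "i \<le> k") (simp_all add: lookup_sum lk_sg less_Suc_eq_le quat_space_iff del: sum.lessThan_Suc)
    qed
    moreover have "(\<Sum>j<k. c j *\<^sub>R V_vec q k j) = (\<Sum>j<k. lk a (Suc k + j) *\<^sub>R V_vec q k j)"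
      using a2 by (intro sum.cong) auto
    ultimately show ?thesis using v(1) by (simp add: V_param_def)
  qed
  ultimately show "v \<in> V_param q k ` family_sum {..<2 * k + 1} (\<lambda>_. UNIV)" by blast
next
  fix v assume "v \<in> V_param q k ` family_sum {..<2 * k + 1} (\<lambda>_. UNIV)"
  then obtain a where v: "v = V_param q k a" by blast
  let ?x = "\<Sum>i<Suc k. sg i (lk a i *\<^sub>R (1::quat))"
  have x: "lk ?x i = (if i \<le> k then lk a i *\<^sub>R 1 else 0)" for i
    by (simp add: lookup_sum lk_sg less_Suc_eq_le del: sum.lessThan_Suc)
  have "?x \<in> quat_space (k + 1)" by (simp add: quat_space_iff x del: sum.lessThan_Suc)
  moreover have "\<forall>i. lk ?x i \<in> \<real>" unfolding x by (auto simp: Reals_def of_real_def)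
  ultimately show "v \<in> V_space q k"
    unfolding V_space_def v V_param_def by (intro CollectI exI conjI) (rule refl)
qed

text \<open>Each generator contributes the same coefficient to two neighbouring entries, which carry
  opposite signs.\<close>

lemma V_coeff_alternating: "(\<Sum>i\<le>k. (- 1) ^ i * V_coeff k a i) = 0"
proof -
  have "(\<Sum>i\<le>k. (- 1) ^ i * V_coeff k a i) =
    (\<Sum>i\<le>k. (- 1) ^ i * (if i < k then lk a (Suc k + i) else 0)) +
    (\<Sum>i\<le>k. (- 1) ^ i * (if 0 < i then lk a (k + i) else 0))"
    unfolding V_coeff_def by (simp add: distrib_left sum.distrib)
  also have "(\<Sum>i\<le>k. (- 1) ^ i * (if i < k then lk a (Suc k + i) else 0)) = (\<Sum>i<k. (- 1) ^ i * lk a (Suc k + i))"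
    by (simp add: lessThan_Suc_atMost[symmetric])
  also have "(\<Sum>i\<le>k. (- 1) ^ i * (if 0 < i then lk a (k + i) else 0)) = (\<Sum>i<k. (- 1) ^ Suc i * lk a (k + Suc i))"
    by (simp add: lessThan_Suc_atMost[symmetric] sum.lessThan_Suc_shift del: sum.lessThan_Suc)
  finally show ?thesis by (simp add: sum_negf[symmetric] sum.distrib[symmetric])
qed

lemma V_coeff_single:
  assumes "l \<le> k" "\<And>i. i \<le> k \<Longrightarrow> i \<noteq> l \<Longrightarrow> V_coeff k a i = 0"
  shows "V_coeff k a l = 0"
proof -
  have "(\<Sum>i\<le>k. (- 1) ^ i * V_coeff k a i) = (\<Sum>i\<le>k. if i = l then (- 1) ^ l * V_coeff k a l else 0)"
    using assms(2) by (intro sum.cong) auto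
  also have "\<dots> = (- 1) ^ l * V_coeff k a l" using assms(1) by simp
  finally show ?thesis using V_coeff_alternating[of k a] by simp
qed

text \<open>If \<open>x\<close> and \<open>J x\<close> lie in the space, \<open>J\<close> is plus or
  minus \<open>q k i\<close> at every nonzero entry. As the \<open>q k i\<close> differ up to sign,
  only one entry can be nonzero; the alternating sum then removes its imaginary part, and
  \<open>J\<close> cannot send a nonzero real number to a real one.\<close>

lemma TU_V_space:
  assumes q: "admissible_choice q" shows "TU k (V_space q k) (quat_space (k + 1))"
proof -
  let ?F = "family_sum {..<2 * k + 1} (\<lambda>_. UNIV) :: (nat \<Rightarrow>\<^sub>0 real) set"
  note lin = linear_imp_linear_on[OF linear_V_param[of q k], of ?F]
  have qs: "q k i \<in> Im_quat_sphere" if "i \<le> k" for i using q that by (simp add: admissible_choice_def)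
  have qd: "q k i \<noteq> q k j \<and> q k i \<noteq> - q k j" if "i \<le> k" "j \<le> k" "i \<noteq> j" for i j
    using q that by (simp add: admissible_choice_def)
  have coef: "lk a i = 0 \<and> V_coeff k a i = 0" if "i \<le> k" "lk (V_param q k a) i = 0" for a i
  proof -
    have eq: "lk a i *\<^sub>R 1 + V_coeff k a i *\<^sub>R q k i = 0" using that by (simp add: lk_V_param)
    then have "qRe (lk a i *\<^sub>R 1 + V_coeff k a i *\<^sub>R q k i) = 0" by simp
    then have "lk a i = 0" using qs[OF that(1)] by (simp add: sphere_iff)
    then show ?thesis using eq sphere_nz[OF qs[OF that(1)]] by simp
  qed
  have inj: "a = 0" if a: "a \<in> ?F" "V_param q k a = 0" for a
  proof (rule poly_mapping_eqI)
    have c: "lk a i = 0 \<and> V_coeff k a i = 0" if "i \<le> k" for i using coef[OF that, of a] a(2) by simp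
    \<comment> \<open>The coefficients of the generators are recovered from the entries one after
      the other, starting at entry \<open>0\<close>, which involves only the first
      generator.\<close>
    have c2: "j < k \<Longrightarrow> lk a (Suc k + j) = 0" for j
    proof (induction j)
      case 0
      then show ?case using c[of 0] by (simp add: V_coeff_def)
    next
      case (Suc j)
      then show ?case using c[of "Suc j"] by (simp add: V_coeff_def)
    qed
    fix n
    consider "n \<le> k" | "k < n" "n < 2 * k + 1" | "\<not> n < 2 * k + 1" by linarith
    then show "lk a n = lk 0 n"
    proof cases
      case 2
      then show ?thesis using c2[of "n - Suc k"] by simp
    next
      case 3
      then show ?thesis using a(1) by (auto simp: family_sum_def in_keys_iff)
    qed (use c in auto)
  qed
  have d: "dim (V_space q k) = 2 * k + 1"
    using fin_dim_image_inj(1)[OF family_sum_real(2) lin] inj family_sum_real(1)[of "2 * k + 1"]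
    unfolding V_space_param by metis
  have sub: "subspace (V_space q k)"
    unfolding V_space_param by (rule linear_on_image_subspace[OF fin_dim_subspace[OF family_sum_real(2)] lin])
  have Vq: "V_space q k \<subseteq> quat_space (k + 1)" unfolding V_space_param by (auto simp: quat_space_iff lk_V_param)
  have "x = 0" if J: "J \<in> Im_quat_sphere" and x: "x \<in> V_space q k" "J \<star> x \<in> V_space q k" for J x
  proof (rule ccontr)
    assume "x \<noteq> 0"
    obtain a where a: "x = V_param q k a" using x(1) unfolding V_space_param by blast
    obtain a' where a': "J \<star> x = V_param q k a'" using x(2) unfolding V_space_param by blast
    have lkJ: "J * lk x i = lk (V_param q k a') i" for i by (metis a' lk_hsm)
    obtain l where l: "lk x l \<noteq> 0" using \<open>x \<noteq> 0\<close> by (metis lookup_zero poly_mapping_eqI)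
    then have lk: "l \<le> k" using a by (auto simp: lk_V_param split: if_splits)
    have Jq: "J = q k i \<or> J = - q k i" if "i \<le> k" "lk x i \<noteq> 0" for i
      using sphere_plane[OF J qs[OF that(1)]] lkJ[of i] that unfolding a by (auto simp: lk_V_param)
    have x0: "lk x i = 0" if "i \<le> k" "i \<noteq> l" for i
      using Jq[OF lk l] Jq[OF that(1)] qd[OF that(1) lk that(2)] by (metis minus_minus)
    have "V_coeff k a l = 0" using coef x0 a by (intro V_coeff_single[OF lk]) auto
    moreover have "V_coeff k a' l = 0" using coef x0 lkJ by (intro V_coeff_single[OF lk]) (metis mult_zero_right)
    ultimately have "J * (lk a l *\<^sub>R 1) = lk a' l *\<^sub>R 1"
      using lkJ[of l] lk unfolding a by (simp add: lk_V_param)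
    then have *: "lk a l *\<^sub>R J = lk a' l *\<^sub>R 1" by simp
    then have "qRe (lk a l *\<^sub>R J) = qRe (lk a' l *\<^sub>R 1)" by simp
    then have "lk a' l = 0" using J by (simp add: sphere_iff)
    then have "lk a l = 0" using * sphere_nz[OF J] by simp
    then show False using l \<open>V_coeff k a l = 0\<close> lk a by (simp add: lk_V_param)
  qed
  then show ?thesis
    unfolding TU_def gpair_def using hsub_quat_space sub Vq d dim_quat_space(2) by auto
qed

lemma qc_sel: "quat_of_complex z + quat_of_complex w * quat_j = Quat (Re z) (Im z) (Re w) (Im w)"
  "quat_of_complex z - quat_of_complex w * quat_j = Quat (Re z) (Im z) (- Re w) (- Im w)"
  by (simp_all add: quat_eq_iff quat_mult_sel quat_of_complex_def)

text \<open>The two patterns of the defining formula written out: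
  \<open>z (n + 1) - cnj (z n) j\<close> at even \<open>n\<close>, and
  \<open>cnj (z n) + z (n + 1) j\<close> at odd \<open>n\<close>.\<close>

definition V'_coord :: "(nat \<Rightarrow>\<^sub>0 complex) \<Rightarrow> nat \<Rightarrow> quat" where
  "V'_coord z n = (if even n then Quat (Re (lk z (Suc n))) (Im (lk z (Suc n))) (- Re (lk z n)) (Im (lk z n))
     else Quat (Re (lk z n)) (- Im (lk z n)) (Re (lk z (Suc n))) (Im (lk z (Suc n))))"

definition V'_param :: "nat \<Rightarrow> (nat \<Rightarrow>\<^sub>0 complex) \<Rightarrow> qvec" where
  "V'_param k z = (\<Sum>n<2 * k + 1. sg n (V'_coord z n))"

lemma lk_V'_param: "lk (V'_param k z) n = (if n < 2 * k + 1 then V'_coord z n else 0)"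
  by (simp add: V'_param_def lookup_sum lk_sg del: sum.lessThan_Suc)

lemma linear_V'_param: "linear (V'_param k)"
  by (rule linearI; rule poly_mapping_eqI) (auto simp: lk_V'_param V'_coord_def quat_eq_iff)

text \<open>The parameters \<open>z\<^sub>1, ..., z\<^sub>2\<^sub>k\<close>; the vanishing at index
  \<open>0\<close> and beyond \<open>2 * k\<close> encodes the boundary conventions of
  \<open>V'_space\<close>.\<close>

definition V'_family :: "nat \<Rightarrow> (nat \<Rightarrow>\<^sub>0 complex) set" where
  "V'_family k = family_sum {1..<2 * k + 1} (\<lambda>_. UNIV)"

lemma V'_family_iff: "z \<in> V'_family k \<longleftrightarrow> lk z 0 = 0 \<and> (\<forall>n>2 * k. lk z n = 0)"
  unfolding V'_family_def by (subst family_sum_alt) (auto, metis Suc_leI not_less_eq gr0I)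

lemma V'_space_param: "V'_space k = V'_param k ` V'_family k"
proof (intro set_eqI iffI)
  fix v assume "v \<in> V'_space k"
  then obtain z where v: "v \<in> quat_space (2 * k + 1)" and z: "z 0 = 0" "z (2 * k + 1) = 0"
     "\<forall>n\<le>2 * k. lk v n =
        (if even n then quat_of_complex (z (n + 1)) - quat_of_complex (cnj (z n)) * quat_j
         else quat_of_complex (cnj (z n)) + quat_of_complex (z (n + 1)) * quat_j)"
    unfolding V'_space_def by blast
  define a where "a = (\<Sum>n<2 * k + 1. sg n (z n))"
  have la: "lk a n = (if n < 2 * k + 1 then z n else 0)" for n
    by (simp add: a_def lookup_sum lk_sg del: sum.lessThan_Suc)
  then have la': "lk a n = z n" if "n \<le> Suc (2 * k)" for n using z(2) that by (cases "n = 2 * k + 1") auto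
  have "v = V'_param k a"
  proof (rule poly_mapping_eqI)
    fix n show "lk v n = lk (V'_param k a) n"
    proof (cases "n < 2 * k + 1")
      case True
      then have "lk a n = z n" "lk a (Suc n) = z (Suc n)" using la' by auto
      then show ?thesis using True z(3) by (simp add: lk_V'_param V'_coord_def qc_sel)
    next
      case False
      then show ?thesis using v by (simp add: lk_V'_param quat_space_iff)
    qed
  qed
  moreover have "a \<in> V'_family k" using la z(1) by (simp add: V'_family_iff)
  ultimately show "v \<in> V'_param k ` V'_family k" by blast
next
  fix v assume "v \<in> V'_param k ` V'_family k"
  then obtain a where a: "a \<in> V'_family k" "v = V'_param k a" by blast
  then have "lk a 0 = 0 \<and> lk a (2 * k + 1) = 0 \<and>
     (\<forall>n\<le>2 * k. lk v n =
        (if even n then quat_of_complex (lk a (n + 1)) - quat_of_complex (cnj (lk a n)) * quat_j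
         else quat_of_complex (cnj (lk a n)) + quat_of_complex (lk a (n + 1)) * quat_j))"
    by (auto simp: V'_family_iff lk_V'_param V'_coord_def qc_sel)
  moreover have "v \<in> quat_space (2 * k + 1)" using a by (simp add: quat_space_iff lk_V'_param)
  ultimately show "v \<in> V'_space k" unfolding V'_space_def by blast
qed

lemma fin_dim_complex: "fin_dim (UNIV :: complex set)" "dim (UNIV :: complex set) = 2"
proof -
  show "fin_dim (UNIV :: complex set)" unfolding fin_dim_def
    by (rule exI[of _ Basis]) (use span_Basis in auto)
  show "dim (UNIV :: complex set) = 2" by simp
qed

lemma V'_family_dim: "fin_dim (V'_family k)" "dim (V'_family k) = 4 * k"
  using dim_family_sum[of "{1..<2 * k + 1}" "\<lambda>_. UNIV :: complex set"] fin_dim_complex unfolding V'_family_def by auto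

lemma TU'_V'_space: "TU' k (V'_space k) (quat_space (2 * k + 1))"
proof -
  note lin = linear_imp_linear_on[OF linear_V'_param[of k], of "V'_family k"]
  have inj: "z = 0" if z: "z \<in> V'_family k" "V'_param k z = 0" for z
  proof (rule poly_mapping_eqI)
    fix n
    have "lk z n = 0" if "n < 2 * k + 1"
    proof -
      have "V'_coord z n = 0" using z(2) that lk_V'_param[of k z n] by simp
      then show ?thesis by (auto simp: V'_coord_def quat_eq_iff complex_eq_iff split: if_splits)
    qed
    then show "lk z n = lk 0 n" using z(1) by (cases "n < 2 * k + 1") (auto simp: V'_family_iff)
  qed
  have d: "dim (V'_space k) = 4 * k"
    using fin_dim_image_inj(1)[OF V'_family_dim(1) lin] inj V'_family_dim(2)[of k]
    unfolding V'_space_param by metis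
  have sub: "subspace (V'_space k)"
    unfolding V'_space_param by (rule linear_on_image_subspace[OF fin_dim_subspace[OF V'_family_dim(1)] lin])
  have Vq: "V'_space k \<subseteq> quat_space (2 * k + 1)" unfolding V'_space_param by (auto simp: quat_space_iff lk_V'_param)
  have J0: "x = 0" if J: "J \<in> Im_quat_sphere" and x: "x \<in> V'_space k" "J \<star> x \<in> V'_space k" for J x
  proof -
    obtain z where z: "z \<in> V'_family k" "x = V'_param k z" using x(1) unfolding V'_space_param by blast
    obtain y where y: "y \<in> V'_family k" "J \<star> x = V'_param k y" using x(2) unfolding V'_space_param by blast
    have eq: "J * V'_coord z n = V'_coord y n" if "n < 2 * k + 1" for n
    proof -
      have "J * lk x n = lk (V'_param k y) n" by (metis y(2) lk_hsm)
      then show ?thesis using that z(2) by (simp add: lk_V'_param)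
    qed
    have Jr: "qRe J = 0" "qI J * qI J + qJ J * qJ J + qK J * qK J = 1"
      using J by (auto simp: sphere_iff inner_quat_def)
    have z0: "lk z 0 = 0" "lk y 0 = 0" "\<And>n. 2 * k < n \<Longrightarrow> lk z n = 0" using z(1) y(1) by (auto simp: V'_family_iff)
    have "lk z n = 0" for n
    proof (cases "qJ J = 0 \<and> qK J = 0")
      case True
      then have JI: "qI J * qI J = 1" using Jr by simp
      \<comment> \<open>Each parameter occurs in two consecutive entries, once conjugated and once
        not. For \<open>J\<close> equal to \<open>i\<close> or \<open>- i\<close>, entry
        \<open>n\<close> gives \<open>y n = - J z n\<close> and entry \<open>n - 1\<close> gives
        \<open>y n = J z n\<close>, so \<open>z n = 0\<close>.\<close>
      have e1: "Re (lk y n) = qI J * Im (lk z n) \<and> Im (lk y n) = - qI J * Re (lk z n)" if "n < 2 * k + 1" for n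
        using eq[OF that] True Jr(1)
        by (cases "even n") (auto simp: V'_coord_def quat_eq_iff quat_mult_sel)
      have e2: "Re (lk y (Suc n)) = - qI J * Im (lk z (Suc n)) \<and> Im (lk y (Suc n)) = qI J * Re (lk z (Suc n))"
        if "n < 2 * k + 1" for n
        using eq[OF that] True Jr(1)
        by (cases "even n") (auto simp: V'_coord_def quat_eq_iff quat_mult_sel)
      show ?thesis
      proof (cases "n = 0 \<or> 2 * k < n")
        case False
        then have "n < 2 * k + 1" "n - 1 < 2 * k + 1" "Suc (n - 1) = n" by auto
        then have "qI J * Im (lk z n) = 0" "qI J * Re (lk z n) = 0" using e1[of n] e2[of "n - 1"] by auto
        moreover have "qI J \<noteq> 0" using JI by auto
        ultimately show ?thesis by (simp add: complex_eq_iff)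
      qed (use z0 in auto)
    next
      case False
      then have nz: "qJ J * qJ J + qK J * qK J \<noteq> 0" by (simp add: sum_squares_eq_zero_iff)
      have cross: "u = 0 \<and> w = 0" if "qJ J * u + qK J * w = 0" "qK J * u - qJ J * w = 0" for u w
      proof -
        have "(qJ J * qJ J + qK J * qK J) * u = qJ J * (qJ J * u + qK J * w) + qK J * (qK J * u - qJ J * w)"
          "(qJ J * qJ J + qK J * qK J) * w = qK J * (qJ J * u + qK J * w) - qJ J * (qK J * u - qJ J * w)"
          by (simp_all add: algebra_simps)
        then show ?thesis using that False by auto
      qed
      \<comment> \<open>Once \<open>z n\<close> and \<open>y n\<close> vanish, entry
        \<open>n\<close> lies in the complex plane or in that plane times \<open>j\<close>, and its
        product with \<open>J\<close> must lie there too. The component of \<open>J\<close> outside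
        the complex plane has squared length \<open>qJ J * qJ J + qK J * qK J\<close>, the
        determinant of the two equations that kill \<open>z (n + 1)\<close>.\<close>
      have "n < Suc (2 * k + 1) \<Longrightarrow> lk z n = 0 \<and> lk y n = 0"
      proof (induction n)
        case 0
        then show ?case using z0 by simp
      next
        case (Suc n)
        then have n: "n < 2 * k + 1" and zn: "lk z n = 0" "lk y n = 0" by auto
        have "Re (lk z (Suc n)) = 0 \<and> Im (lk z (Suc n)) = 0"
        proof (cases "even n")
          case True
          then show ?thesis using eq[OF n] zn Jr(1)
            by (intro cross) (auto simp: V'_coord_def quat_eq_iff quat_mult_sel)
        next
          case False
          then show ?thesis using eq[OF n] zn Jr(1)
            by (intro cross) (auto simp: V'_coord_def quat_eq_iff quat_mult_sel algebra_simps)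
        qed
        then have z': "lk z (Suc n) = 0" by (simp add: complex_eq_iff)
        have "V'_coord z n = 0" using zn z' by (simp add: V'_coord_def quat_eq_iff)
        then have "V'_coord y n = 0" using eq[OF n] by simp
        then have "lk y (Suc n) = 0" by (auto simp: V'_coord_def quat_eq_iff complex_eq_iff split: if_splits)
        then show ?case using z' by simp
      qed
      then show ?thesis using z0(3)[of n] by (cases "n < Suc (2 * k + 1)") auto
    qed
    then have "z = 0" by (intro poly_mapping_eqI) simp
    then show ?thesis using z(2) linear_0[OF linear_V'_param] by simp
  qed
  \<comment> \<open>Right multiplication by \<open>diag(i, -i, i, \<dots>)\<close> acts on the parameters as \<open>z \<mapsto> i z\<close>.\<close>
  define R :: "qvec \<Rightarrow> qvec" where
    "R v = (\<Sum>n<2 * k + 1. sg n (lk v n * (if even n then qi else - qi)))" for v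
  have lkR: "lk (R v) n = (if n < 2 * k + 1 then lk v n * (if even n then qi else - qi) else 0)" for v n
    by (simp add: R_def lookup_sum lk_sg del: sum.lessThan_Suc)
  have R1: "hlin (quat_space (2 * k + 1)) R" unfolding hlin_def
    by (auto intro!: poly_mapping_eqI simp: lkR algebra_simps)
  have R2: "R ` quat_space (2 * k + 1) \<subseteq> quat_space (2 * k + 1)" by (auto simp: quat_space_iff lkR)
  have R3: "R ` V'_space k \<subseteq> V'_space k"
  proof -
    have "R (V'_param k z) \<in> V'_param k ` V'_family k" if z: "z \<in> V'_family k" for z
    proof -
      define z' where "z' = (\<Sum>n<2 * k + 1. sg n (\<i> * lk z n))"
      have lz: "lk z' n = \<i> * lk z n" for n
        using z by (auto simp: z'_def lookup_sum lk_sg V'_family_iff simp del: sum.lessThan_Suc)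
      have "z' \<in> V'_family k" using z by (auto simp: V'_family_iff lz)
      moreover have "R (V'_param k z) = V'_param k z'"
        by (rule poly_mapping_eqI) (auto simp: lkR lk_V'_param V'_coord_def lz quat_eq_iff quat_mult_sel)
      ultimately show ?thesis by blast
    qed
    then show ?thesis unfolding V'_space_param by blast
  qed
  have "qi * qi = - 1" by (simp add: quat_eq_iff quat_mult_sel)
  then have R4: "R (R v) = - v" if "v \<in> quat_space (2 * k + 1)" for v
    using that by (intro poly_mapping_eqI) (auto simp: lkR quat_space_iff mult.assoc)
  show ?thesis
    unfolding TU'_def gpair_def
    using hsub_quat_space sub Vq d dim_quat_space(2) J0 R1 R2 R3 R4 by auto
qed

fun label_V :: "(nat \<Rightarrow> nat \<Rightarrow> quat) \<Rightarrow> crq_label \<Rightarrow> qvec set" where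
  "label_V q (Lab_U k) = V_space q k"
| "label_V q (Lab_U' k) = V'_space k"

lemma label_U_orth_compl: "label_U q l = orth_compl (label_dim l) (label_V q l)"
  by (cases l) auto

lemma lab_pair_label_V: "admissible_choice q \<Longrightarrow> lab_pair l (label_V q l) (quat_space (label_dim l))"
  using TU_V_space TU'_V'_space by (cases l) auto

section \<open>Automorphisms of the quaternions and rotation of coordinates\<close>

section \<open>Automorphisms of the quaternions\<close>

lemma AutD:
  assumes "a \<in> Aut_quat"
  shows "a (x + y) = a x + a y" "a (c *\<^sub>R x) = c *\<^sub>R a x" "a (x * y) = a x * a y" "a 1 = 1" "a 0 = 0"
    "a (- x) = - a x" "a (x - y) = a x - a y" "a x = a y \<longleftrightarrow> x = y" "a (inv a x) = x" "inv a (a x) = x"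
proof -
  have l: "linear a" and b: "bij a" using assms by (auto simp: Aut_quat_def)
  show "a (x + y) = a x + a y" "a (c *\<^sub>R x) = c *\<^sub>R a x" "a 0 = 0" "a (- x) = - a x" "a (x - y) = a x - a y"
    using l by (simp_all add: linear_add linear_scale linear_0 linear_neg linear_diff)
  show "a (x * y) = a x * a y" "a 1 = 1" using assms by (auto simp: Aut_quat_def)
  show "a x = a y \<longleftrightarrow> x = y" using bij_is_inj[OF b] by (auto dest: injD)
  show "a (inv a x) = x" using bij_is_surj[OF b] by (rule surj_f_inv_f)
  show "inv a (a x) = x" using bij_is_inj[OF b] by (rule inv_f_f)
qed

lemma Aut_id: "id \<in> Aut_quat"
  by (auto simp: Aut_quat_def linear_id)

lemma Aut_comp: "a \<in> Aut_quat \<Longrightarrow> b \<in> Aut_quat \<Longrightarrow> a \<circ> b \<in> Aut_quat"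
  by (auto simp: Aut_quat_def linear_compose bij_comp)

lemma Aut_inv: "a \<in> Aut_quat \<Longrightarrow> inv a \<in> Aut_quat"
proof -
  assume a: "a \<in> Aut_quat"
  have b: "bij a" using a by (auto simp: Aut_quat_def)
  have e: "inv a x = y \<longleftrightarrow> x = a y" for x y using AutD(9,10)[OF a] by metis
  have "linear (inv a)" by (rule linearI) (simp_all add: e AutD[OF a])
  then show ?thesis using bij_imp_bij_inv[OF b] by (simp add: Aut_quat_def e AutD[OF a])
qed

lemma Aut_sphere: "a \<in> Aut_quat \<Longrightarrow> a p \<in> Im_quat_sphere \<longleftrightarrow> p \<in> Im_quat_sphere"
  using AutD(3,4,6,8)[of a] unfolding sphere_iff_square by metis

text \<open>An imaginary quaternion, scaled to length one, is a square root of \<open>-1\<close>,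
  and automorphisms preserve such roots; the real part is fixed because \<open>1\<close> is.\<close>

lemma Aut_inner_self:
  assumes a: "a \<in> Aut_quat" shows "a p \<bullet> a p = p \<bullet> p"
proof -
  define v where "v = p - qRe p *\<^sub>R 1"
  have v0: "qRe v = 0" by (simp add: v_def)
  have "qRe (a v) = 0 \<and> a v \<bullet> a v = v \<bullet> v"
  proof (cases "v = 0")
    case False
    define n where "n = norm v"
    have n: "n \<noteq> 0" "n * n = v \<bullet> v" using False by (simp_all add: n_def dot_square_norm power2_eq_square)
    have "inverse n *\<^sub>R v \<in> Im_quat_sphere" using v0 n by (simp add: sphere_iff n(2)[symmetric] field_simps)
    then have "inverse n *\<^sub>R a v \<in> Im_quat_sphere" using Aut_sphere[OF a] AutD(2)[OF a] by metis
    then have "qRe (a v) = 0" "inverse n * (inverse n * (a v \<bullet> a v)) = 1" using n by (auto simp: sphere_iff)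
    then have "qRe (a v) = 0" "a v \<bullet> a v = n * n" using n(1) by (auto simp: field_simps)
    then show ?thesis using n(2) by simp
  qed (simp add: AutD[OF a])
  moreover have "p = qRe p *\<^sub>R 1 + v" by (simp add: v_def)
  then have "a p = qRe p *\<^sub>R 1 + a v" using AutD(1,2,4)[OF a] by metis
  ultimately have "a p \<bullet> a p = qRe p * qRe p + v \<bullet> v" by (auto simp: inner_quat_def)
  also have "\<dots> = p \<bullet> p" by (simp add: v_def inner_quat_def)
  finally show ?thesis .
qed

lemma Aut_inner:
  assumes a: "a \<in> Aut_quat" shows "a p \<bullet> a r = p \<bullet> r"
proof -
  have "a (p + r) \<bullet> a (p + r) = (p + r) \<bullet> (p + r)" by (rule Aut_inner_self[OF a])
  then show ?thesis
    using Aut_inner_self[OF a, of p] Aut_inner_self[OF a, of r]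
    by (simp add: AutD[OF a] inner_add_left inner_add_right inner_commute)
qed

text \<open>Composing with such maps turns a map that is semilinear with respect to the
  identifications of the spheres into a quaternionic linear one.\<close>

definition twist :: "(quat \<Rightarrow> quat) \<Rightarrow> qvec \<Rightarrow> qvec" where "twist a v = Poly_Mapping.map a v"

lemma lk_twist: "a \<in> Aut_quat \<Longrightarrow> lk (twist a v) i = a (lk v i)"
  by (simp add: twist_def Poly_Mapping.map.rep_eq when_def AutD)

lemma twist_simps:
  assumes "a \<in> Aut_quat"
  shows "twist a (x + y) = twist a x + twist a y" "twist a (c *\<^sub>R x) = c *\<^sub>R twist a x"
    "twist a (p \<star> x) = a p \<star> twist a x" "twist a (- x) = - twist a x" "twist a 0 = 0"
    "twist a (twist (inv a) x) = x" "twist (inv a) (twist a x) = x"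
    "twist a x \<in> quat_space m \<longleftrightarrow> x \<in> quat_space m" "ip m (twist a x) (twist a y) = ip m x y"
proof -
  note l = lk_twist[OF assms] lk_twist[OF Aut_inv[OF assms]]
  show "twist a (x + y) = twist a x + twist a y" "twist a (c *\<^sub>R x) = c *\<^sub>R twist a x"
    "twist a (p \<star> x) = a p \<star> twist a x" "twist a (- x) = - twist a x" "twist a 0 = 0"
    by (rule poly_mapping_eqI; simp add: l AutD(1-6)[OF assms])+
  show "twist a (twist (inv a) x) = x" "twist (inv a) (twist a x) = x"
    by (rule poly_mapping_eqI; simp add: l AutD(9,10)[OF assms])+
  show "twist a x \<in> quat_space m \<longleftrightarrow> x \<in> quat_space m"
    using AutD(8)[OF assms, of _ 0] by (simp add: l quat_space_iff AutD(5)[OF assms])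
  show "ip m (twist a x) (twist a y) = ip m x y" by (simp add: ip_def l Aut_inner[OF assms])
qed

lemma gpair_twist:
  assumes a: "a \<in> Aut_quat" and g: "gpair V (quat_space m)"
  shows "gpair (twist a ` V) (quat_space m)" "dim (twist a ` V) = dim V"
proof -
  have l: "linear (twist a)" by (rule linearI) (simp_all add: twist_simps a)
  show "dim (twist a ` V) = dim V"
  proof (rule fin_dim_image_inj(1)[OF gpairD(4)[OF g] linear_imp_linear_on[OF l]])
    fix x assume "twist a x = 0"
    then have "twist (inv a) (twist a x) = 0" using twist_simps(5)[OF Aut_inv[OF a]] by simp
    then show "x = 0" using twist_simps(7)[OF a] by simp
  qed
  show "gpair (twist a ` V) (quat_space m)" unfolding gpair_def
  proof (intro conjI ballI impI)
    show "subspace (twist a ` V)" by (rule linear_subspace_image[OF l gpairD(2)[OF g]])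
    show "twist a ` V \<subseteq> quat_space m" using gpairD(3)[OF g] by (auto simp: twist_simps a)
    fix J x assume J: "J \<in> Im_quat_sphere" and x: "x \<in> twist a ` V" "J \<star> x \<in> twist a ` V"
    obtain v where v: "x = twist a v" "v \<in> V" using x(1) by blast
    have "J \<star> x = twist a (inv a J \<star> v)" using v by (simp add: twist_simps a AutD(9)[OF a])
    then have "inv a J \<star> v \<in> V" using x(2) twist_simps(7)[OF a] by (metis imageE)
    moreover have "inv a J \<in> Im_quat_sphere" using J Aut_sphere[OF Aut_inv[OF a]] by simp
    ultimately have "v = 0" using gpairD(6)[OF g] v(2) by blast
    then show "x = 0" using v by (simp add: twist_simps a)
  qed (rule hsub_quat_space)
qed

text \<open>The types are defined by dimensions and the existence of \<open>R\<close>, and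
  \<open>R\<close> can be conjugated by the twist. So a rotated model still has its old type,
  although its defining vectors have changed.\<close>

lemma lab_pair_twist:
  assumes a: "a \<in> Aut_quat" and l: "lab_pair l V (quat_space m)"
  shows "lab_pair l (twist a ` V) (quat_space m)"
proof (cases l)
  case (Lab_U k)
  then show ?thesis using l gpair_twist[OF a lab_pair_gpair[OF l]] by (simp add: TU_def)
next
  case (Lab_U' k)
  then obtain R where R: "hlin (quat_space m) R" "R ` quat_space m \<subseteq> quat_space m" "R ` V \<subseteq> V"
    "\<forall>x\<in>quat_space m. R (R x) = - x" using l by (auto simp: TU'_def)
  let ?R = "\<lambda>x. twist a (R (twist (inv a) x))"
  note ia = Aut_inv[OF a]
  have q: "twist (inv a) x \<in> quat_space m" if "x \<in> quat_space m" for x using that by (simp add: twist_simps ia)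
  have "hlin (quat_space m) ?R" unfolding hlin_def
    using hlinD[OF R(1)] q by (simp add: twist_simps a ia AutD(9)[OF a])
  moreover have Rq: "R (twist (inv a) x) \<in> quat_space m" if "x \<in> quat_space m" for x
    using R(2) q[OF that] by blast
  moreover have "?R ` quat_space m \<subseteq> quat_space m" using Rq by (auto simp: twist_simps a)
  moreover have "?R ` (twist a ` V) \<subseteq> twist a ` V" using R(3) by (auto simp: twist_simps a)
  moreover have "\<forall>x\<in>quat_space m. ?R (?R x) = - x" using R(4) q by (simp add: twist_simps a)
  ultimately show ?thesis
    using l gpair_twist[OF a lab_pair_gpair[OF l]] Lab_U' by (auto simp: TU'_def)
qed

section \<open>From the pairs back to the spaces \<open>U\<close>\<close>

section \<open>Duality\<close>

text \<open>\<open>f\<close> multiplies coordinate rows from the right by the matrix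
  \<open>A\<close>; its adjoint multiplies from the right by the conjugate transpose, hence is again
  linear for left multiplication.\<close>

lemma adjoint_exists:
  assumes f: "hlin (quat_space m) f" "f ` quat_space m \<subseteq> quat_space m'"
  obtains g where "\<forall>S. hlin S g" "\<forall>w. g w \<in> quat_space m" "\<forall>u\<in>quat_space m. \<forall>w. ip m' (f u) w = ip m u (g w)"
proof -
  define A where "A l j = lk (f (sg l 1)) j" for l j
  define g :: "qvec \<Rightarrow> qvec" where "g w = (\<Sum>l<m. sg l (\<Sum>j<m'. lk w j * qcnj (A l j)))" for w
  have lkg: "lk (g w) l = (if l < m then \<Sum>j<m'. lk w j * qcnj (A l j) else 0)" for w l
    by (simp add: g_def lookup_sum lk_sg)
  have "hlin S g" for S unfolding hlin_def
    by (auto intro!: poly_mapping_eqI simp: lkg distrib_right sum.distrib sum_distrib_left mult.assoc)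
  moreover have "g w \<in> quat_space m" for w by (simp add: quat_space_iff lkg)
  moreover have "ip m' (f u) w = ip m u (g w)" if u: "u \<in> quat_space m" for u w
  proof -
    have e: "sg l 1 \<in> quat_space m" if "l < m" for l using that by (simp add: quat_space_iff lk_sg)
    have "u = (\<Sum>l<m. lk u l \<star> sg l 1)"
    proof (rule poly_mapping_eqI)
      fix i
      have "lk (\<Sum>l<m. lk u l \<star> sg l 1) i = (\<Sum>l<m. if l = i then lk u l else 0)"
        unfolding lookup_sum by (rule sum.cong) (auto simp: lk_sg)
      then show "lk u i = lk (\<Sum>l<m. lk u l \<star> sg l 1) i" using u by (simp add: quat_space_iff)
    qed
    then have "f u = f (\<Sum>l<m. lk u l \<star> sg l 1)" by simp
    also have "\<dots> = (\<Sum>l<m. f (lk u l \<star> sg l 1))"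
      by (rule linear_on_sum[OF hlin_linear_on[OF f(1)] quat_space_subspace]) (use hsm_quat_space e in auto)
    also have "\<dots> = (\<Sum>l<m. lk u l \<star> f (sg l 1))" using hlinD(2)[OF f(1)] e by simp
    finally have fu: "lk (f u) j = (\<Sum>l<m. lk u l * A l j)" for j by (simp add: lookup_sum A_def)
    have "ip m' (f u) w = (\<Sum>j<m'. \<Sum>l<m. lk u l \<bullet> (lk w j * qcnj (A l j)))"
      unfolding ip_def fu by (simp add: inner_sum_left inner_mult_left(2))
    also have "\<dots> = (\<Sum>l<m. lk u l \<bullet> (\<Sum>j<m'. lk w j * qcnj (A l j)))"
      by (subst sum.swap) (simp add: inner_sum_right)
    finally show ?thesis by (simp add: ip_def lkg)
  qed
  ultimately show ?thesis using that by blast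
qed

text \<open>The adjoint \<open>g\<close> maps \<open>V'\<close> to \<open>V\<close>, that is, from
  the later type to the earlier one, so it vanishes by \<open>lab_pair_hom_zero\<close>; a map with
  zero adjoint is zero.\<close>

lemma hom_orth_compl_zero:
  assumes p: "lab_pair l V (quat_space m)" "lab_pair l' V' (quat_space m')" "label_pos l < label_pos l'"
    and f: "hlin (quat_space m) f" "f ` quat_space m \<subseteq> quat_space m'" "f ` orth_compl m V \<subseteq> orth_compl m' V'"
    and x: "x \<in> quat_space m"
  shows "f x = 0"
proof -
  obtain g where g: "\<forall>S. hlin S g" "\<forall>w. g w \<in> quat_space m" "\<forall>u\<in>quat_space m. \<forall>w. ip m' (f u) w = ip m u (g w)"
    by (rule adjoint_exists[OF f(1,2)])
  note gp = lab_pair_gpair[OF p(1)] lab_pair_gpair[OF p(2)]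
  have "g w \<in> V" if w: "w \<in> V'" for w
  proof -
    have "ip m (g w) u = 0" if u: "u \<in> orth_compl m V" for u
    proof -
      have "f u \<in> orth_compl m' V'" using f(3) u by blast
      then have "ip m' (f u) w = 0" using w by (simp add: orth_compl_iff)
      then show ?thesis using g(3) u by (simp add: orth_compl_iff ip_commute)
    qed
    then have "g w \<in> orth_compl m (orth_compl m V)" using g(2) by (simp add: orth_compl_iff)
    then show ?thesis using orth_compl_orth_compl[OF gpairD(2,3)[OF gp(1)]] by simp
  qed
  then have gV: "g ` V' \<subseteq> V" by blast
  have g0: "g w = 0" if "w \<in> quat_space m'" for w
    by (rule lab_pair_hom_zero[OF p(2,1,3) _ _ gV that]) (use g in auto)
  show ?thesis
  proof (rule ip_nondegenerate[of _ m'])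
    show "f x \<in> quat_space m'" using f(2) x by blast
    show "ip m' (f x) v = 0" if "v \<in> quat_space m'" for v using g(3) x g0[OF that] by (simp add: ip_simps)
  qed
qed

text \<open>Twisting by \<open>a\<close> before and by the inverse of \<open>a'\<close> after
  \<open>f\<close> makes it quaternionic linear. The models are rotated accordingly, which preserves
  both their types and orthogonality.\<close>

lemma twisted_hom_label_zero:
  assumes q: "admissible_choice q" and p: "label_pos l < label_pos l'"
    and a: "a \<in> Aut_quat" "a' \<in> Aut_quat"
    and f: "linear_on (quat_space (label_dim l)) f" "f ` quat_space (label_dim l) \<subseteq> quat_space (label_dim l')"
      "f ` label_U q l \<subseteq> label_U q l'" "\<And>p x. x \<in> quat_space (label_dim l) \<Longrightarrow> f (a p \<star> x) = a' p \<star> f x"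
    and x: "x \<in> quat_space (label_dim l)"
  shows "f x = 0"
proof -
  let ?m = "label_dim l" and ?m' = "label_dim l'"
  let ?V = "twist (inv a) ` label_V q l" and ?V' = "twist (inv a') ` label_V q l'"
  let ?f = "\<lambda>x. twist (inv a') (f (twist a x))"
  note ia = Aut_inv[OF a(1)] Aut_inv[OF a(2)]
  have L: "lab_pair l ?V (quat_space ?m)" "lab_pair l' ?V' (quat_space ?m')"
    using lab_pair_twist[OF ia(1) lab_pair_label_V[OF q]] lab_pair_twist[OF ia(2) lab_pair_label_V[OF q]] by auto
  have t: "twist a x \<in> quat_space ?m" if "x \<in> quat_space ?m" for x using that by (simp add: twist_simps a)
  have 1: "hlin (quat_space ?m) ?f" unfolding hlin_def
    using f(1,4) t by (simp add: twist_simps a ia linear_on_def AutD(10)[OF a(2)])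
  have ft: "f (twist a x) \<in> quat_space ?m'" if "x \<in> quat_space ?m" for x using f(2) t[OF that] by blast
  then have 2: "?f ` quat_space ?m \<subseteq> quat_space ?m'" by (auto simp: twist_simps ia)
  have 3: "?f ` orth_compl ?m ?V \<subseteq> orth_compl ?m' ?V'"
  proof
    fix y assume "y \<in> ?f ` orth_compl ?m ?V"
    then obtain u where u: "u \<in> orth_compl ?m ?V" "y = ?f u" by blast
    have "twist a u \<in> label_U q l"
      unfolding label_U_orth_compl orth_compl_iff
    proof (intro conjI ballI)
      show "twist a u \<in> quat_space ?m" using u(1) t by (simp add: orth_compl_iff)
      fix v assume "v \<in> label_V q l"
      then have "ip ?m u (twist (inv a) v) = 0" using u(1) by (simp add: orth_compl_iff)
      then have "ip ?m (twist a u) (twist a (twist (inv a) v)) = 0" by (simp add: twist_simps(9)[OF a(1)])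
      then show "ip ?m (twist a u) v = 0" by (simp add: twist_simps(6)[OF a(1)])
    qed
    then have fu: "f (twist a u) \<in> label_U q l'" using f(3) by blast
    show "y \<in> orth_compl ?m' ?V'" unfolding orth_compl_iff
    proof (intro conjI ballI)
      show "y \<in> quat_space ?m'" using 2 u by (auto simp: orth_compl_iff)
      fix v assume "v \<in> ?V'"
      then obtain w where "v = twist (inv a') w" "w \<in> label_V q l'" by blast
      then show "ip ?m' y v = 0"
        using fu u(2) by (simp add: twist_simps(9)[OF ia(2)] label_U_orth_compl orth_compl_iff)
    qed
  qed
  have x': "twist (inv a) x \<in> quat_space ?m" using x by (simp add: twist_simps ia)
  have "?f (twist (inv a) x) = 0" by (rule hom_orth_compl_zero[OF L p 1 2 3 x'])
  then have "twist (inv a') (f x) = 0" by (simp add: twist_simps(6)[OF a(1)])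
  then have "twist a' (twist (inv a') (f x)) = 0" by (simp add: twist_simps(5)[OF a(2)])
  then show ?thesis by (simp add: twist_simps(6)[OF a(2)])
qed

lemma label_U_subspace: "subspace (label_U q l)" "fin_dim (label_U q l)" "label_U q l \<subseteq> quat_space (label_dim l)"
  unfolding label_U_orth_compl by (auto simp: orth_compl_subspace orth_compl_fin_dim orth_compl_iff)

text \<open>Multiplicities will be obtained by dividing by this dimension. It is positive because
  \<open>V\<close> has less than half the dimension of the ambient space.\<close>

lemma dim_label_U_pos: "admissible_choice q \<Longrightarrow> 0 < dim (label_U q l)"
proof -
  assume q: "admissible_choice q"
  note g = lab_pair_gpair[OF lab_pair_label_V[OF q, of l]]
  have "0 < label_dim l" by (cases l) auto
  then have "quat_space (label_dim l) \<noteq> {0}" using dim_quat_space(2)[of "label_dim l"] by force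
  then have "2 * dim (label_V q l) < dim (quat_space (label_dim l))" by (rule gpair_dim_less[OF g])
  then show ?thesis
    using dim_orth_compl[OF gpairD(2,3)[OF g]] by (simp add: label_U_orth_compl dim_quat_space)
qed

text \<open>A vector \<open>s\<close> orthogonal to both \<open>U\<close> and \<open>J U\<close>
  satisfies \<open>s \<in> V\<close> and \<open>J s \<in> V\<close>, since the adjoint of
  \<open>J\<close> is \<open>- J\<close>; hence it is zero.\<close>

lemma label_U_generates:
  assumes q: "admissible_choice q" and J: "J \<in> Im_quat_sphere" and e: "e \<in> quat_space (label_dim l)"
  obtains x y where "x \<in> label_U q l" "y \<in> label_U q l" "e = x + J \<star> y"
proof -
  let ?m = "label_dim l" and ?U = "label_U q l"
  note g = lab_pair_gpair[OF lab_pair_label_V[OF q, of l]]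
  have UU: "orth_compl ?m ?U = label_V q l"
    unfolding label_U_orth_compl by (rule orth_compl_orth_compl[OF gpairD(2,3)[OF g]])
  let ?JU = "(\<lambda>y. J \<star> y) ` ?U"
  let ?S = "{x + y | x y. x \<in> ?U \<and> y \<in> ?JU}"
  have JU: "subspace ?JU" by (rule linear_subspace_image[OF linear_hsm label_U_subspace(1)])
  have S: "subspace ?S" by (rule subspace_sums[OF label_U_subspace(1) JU])
  have Sm: "?S \<subseteq> quat_space ?m"
    using label_U_subspace(3)[of q l] by (auto intro!: subspace_add[OF quat_space_subspace] hsm_quat_space)
  have "s = 0" if s: "s \<in> orth_compl ?m ?S" for s
  proof -
    have s1: "ip ?m s (x + J \<star> y) = 0" if "x \<in> ?U" "y \<in> ?U" for x y
      using s that by (auto simp: orth_compl_iff)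
    have 0: "0 \<in> ?U" by (rule subspace_0[OF label_U_subspace(1)])
    have sq: "s \<in> quat_space ?m" using s by (simp add: orth_compl_iff)
    have "s \<in> orth_compl ?m ?U" using s1[OF _ 0] sq by (simp add: orth_compl_iff hsm_simps)
    moreover have "J \<star> s \<in> orth_compl ?m ?U"
      unfolding orth_compl_iff
    proof (intro conjI ballI)
      show "J \<star> s \<in> quat_space ?m" by (rule hsm_quat_space[OF sq])
      fix u assume u: "u \<in> ?U"
      have "ip ?m (J \<star> s) u = ip ?m s ((- J) \<star> u)" by (simp add: ip_hsm sphere_qcnj[OF J])
      also have "\<dots> = ip ?m s (0 + J \<star> ((- 1) *\<^sub>R u))" by (simp add: hsm_simps)
      also have "\<dots> = 0" by (rule s1[OF 0 subspace_scale[OF label_U_subspace(1) u]])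
      finally show "ip ?m (J \<star> s) u = 0" .
    qed
    ultimately show ?thesis using gpairD(6)[OF g J] UU by blast
  qed
  then have "e \<in> ?S" using orth_compl_decomp[OF S Sm] e by force
  then show ?thesis using that by blast
qed

section \<open>Replacing maps of spheres by automorphisms of the quaternions\<close>

section \<open>Quaternionic structures and semilinear maps\<close>

lemma quat_morphismsD:
  assumes "\<sigma> \<in> quat_morphisms E" "x \<in> E"
  shows "\<sigma> p x \<in> E" "y \<in> E \<Longrightarrow> \<sigma> p (x + y) = \<sigma> p x + \<sigma> p y" "\<sigma> p (c *\<^sub>R x) = c *\<^sub>R \<sigma> p x"
    "\<sigma> (p + r) x = \<sigma> p x + \<sigma> r x" "\<sigma> (c *\<^sub>R p) x = c *\<^sub>R \<sigma> p x" "\<sigma> (p * r) x = \<sigma> p (\<sigma> r x)"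
    "\<sigma> 1 x = x"
proof -
  have e: "\<sigma> p \<in> End E" using assms(1) by (simp add: quat_morphisms_def)
  show "\<sigma> p x \<in> E" using e assms(2) by (auto simp: End_def)
  show "y \<in> E \<Longrightarrow> \<sigma> p (x + y) = \<sigma> p x + \<sigma> p y" "\<sigma> p (c *\<^sub>R x) = c *\<^sub>R \<sigma> p x"
    using e assms(2) by (auto simp: End_def linear_on_def)
  show "\<sigma> (p + r) x = \<sigma> p x + \<sigma> r x" "\<sigma> (c *\<^sub>R p) x = c *\<^sub>R \<sigma> p x" "\<sigma> (p * r) x = \<sigma> p (\<sigma> r x)"
    "\<sigma> 1 x = x"
    using assms by (simp_all add: quat_morphisms_def)
qed

lemma quat_morphisms_linear_on: "\<sigma> \<in> quat_morphisms E \<Longrightarrow> linear_on E (\<sigma> p)"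
  by (auto simp: linear_on_def quat_morphismsD)

lemma quat_morphisms_0:
  assumes "\<sigma> \<in> quat_morphisms E" "x \<in> E" shows "\<sigma> 0 x = 0"
  using quat_morphismsD(5)[OF assms, of 0 0] by simp

lemma quat_morphisms_zero:
  assumes "\<sigma> \<in> quat_morphisms E" "subspace E" shows "\<sigma> p 0 = 0"
  using linear_on_zero[OF quat_morphisms_linear_on[OF assms(1)] assms(2)] .

lemma quat_morphisms_eq_0:
  assumes "\<sigma> \<in> quat_morphisms E" "subspace E" "x \<in> E" "\<sigma> p x = 0" "p \<noteq> 0" shows "x = 0"
proof -
  obtain y where "y * p = 1" using quat_inverse[OF assms(5)] by blast
  then have "x = \<sigma> y (\<sigma> p x)" using quat_morphismsD(6,7)[OF assms(1,3)] by metis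
  then show ?thesis using assms(4) quat_morphisms_zero[OF assms(1,2)] by simp
qed

abbreviation quat_class :: "'e::real_vector set \<Rightarrow> (quat \<Rightarrow> 'e \<Rightarrow> 'e) \<Rightarrow> (quat \<Rightarrow> 'e \<Rightarrow> 'e) set" where
  "quat_class E \<sigma> \<equiv> quat_equiv E `` {\<sigma>}"

lemma admissible_quat_class:
  assumes \<sigma>: "\<sigma> \<in> quat_morphisms E" shows "admissible (quat_class E \<sigma>) = \<sigma> ` Im_quat_sphere"
proof
  show "admissible (quat_class E \<sigma>) \<subseteq> \<sigma> ` Im_quat_sphere"
  proof
    fix J assume "J \<in> admissible (quat_class E \<sigma>)"
    then obtain a p where "a \<in> Aut_quat" "p \<in> Im_quat_sphere" "J = \<sigma> (a p)"
      by (auto simp: admissible_def quat_equiv_def)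
    then show "J \<in> \<sigma> ` Im_quat_sphere" using Aut_sphere by blast
  qed
  have "(\<sigma>, \<sigma>) \<in> quat_equiv E" using \<sigma> Aut_id by (auto simp: quat_equiv_def intro!: bexI[of _ id])
  then show "\<sigma> ` Im_quat_sphere \<subseteq> admissible (quat_class E \<sigma>)" by (auto simp: admissible_def)
qed

lemma quat_class_structure: "\<sigma> \<in> quat_morphisms E \<Longrightarrow> quat_class E \<sigma> \<in> quat_structures E"
  unfolding quat_structures_def by (rule quotientI)

lemma quat_structure_class:
  assumes "Q \<in> quat_structures E" obtains \<sigma> where "\<sigma> \<in> quat_morphisms E" "Q = quat_class E \<sigma>"
  using assms unfolding quat_structures_def by (rule quotientE) (rule that)

definition semilinear :: "'e::real_vector set \<Rightarrow> (quat \<Rightarrow> 'e \<Rightarrow> 'e) \<Rightarrow> 'f::real_vector set \<Rightarrow> (quat \<Rightarrow> 'f \<Rightarrow> 'f) \<Rightarrow>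
    (quat \<Rightarrow> quat) \<Rightarrow> ('e \<Rightarrow> 'f) \<Rightarrow> bool" where
  "semilinear E \<sigma> E' \<sigma>' \<alpha> f \<longleftrightarrow> f \<in> E \<rightarrow> E' \<and> linear_on E f \<and> (\<forall>p. \<forall>x\<in>E. f (\<sigma> p x) = \<sigma>' (\<alpha> p) (f x))"

lemma semilinear_quaternionic:
  assumes "\<sigma> \<in> quat_morphisms E" "\<sigma>' \<in> quat_morphisms E'" "\<alpha> \<in> Aut_quat" "semilinear E \<sigma> E' \<sigma>' \<alpha> f"
  shows "\<exists>T. quaternionic_wrt E (quat_class E \<sigma>) E' (quat_class E' \<sigma>') T f"
proof -
  \<comment> \<open>A preimage is chosen because \<open>\<sigma>\<close> need not be injective: on
    the zero space all its values coincide.\<close>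
  define T where "T J = \<sigma>' (\<alpha> (SOME p. p \<in> Im_quat_sphere \<and> J = \<sigma> p))" for J
  have *: "\<exists>p\<in>Im_quat_sphere. J = \<sigma> p \<and> T J = \<sigma>' (\<alpha> p)" if J: "J \<in> \<sigma> ` Im_quat_sphere" for J
  proof -
    have "\<exists>p. p \<in> Im_quat_sphere \<and> J = \<sigma> p" using J by blast
    from someI_ex[OF this] show ?thesis unfolding T_def by blast
  qed
  have "quaternionic_wrt E (quat_class E \<sigma>) E' (quat_class E' \<sigma>') T f"
    unfolding quaternionic_wrt_def admissible_quat_class[OF assms(1)] admissible_quat_class[OF assms(2)]
  proof (intro conjI ballI)
    show "f \<in> E \<rightarrow> E'" "linear_on E f" using assms(4) by (auto simp: semilinear_def)
    show "T \<in> \<sigma> ` Im_quat_sphere \<rightarrow> \<sigma>' ` Im_quat_sphere"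
    proof
      fix J assume "J \<in> \<sigma> ` Im_quat_sphere"
      then obtain p where "p \<in> Im_quat_sphere" "T J = \<sigma>' (\<alpha> p)" using * by blast
      then show "T J \<in> \<sigma>' ` Im_quat_sphere" using Aut_sphere[OF assms(3)] by blast
    qed
    fix J x assume "J \<in> \<sigma> ` Im_quat_sphere" "x \<in> E"
    then obtain p where "J = \<sigma> p" "T J = \<sigma>' (\<alpha> p)" using * by blast
    then show "f (J x) = T J (f x)" using assms(4) \<open>x \<in> E\<close> by (simp add: semilinear_def)
  qed
  then show ?thesis by blast
qed

text \<open>\<open>T\<close> is merely a function between spheres, so \<open>\<alpha>\<close> is
  built from its values at the three units and extended linearly. Since \<open>f\<close> is onto,
  the semilinear rule determines the action of \<open>\<alpha> p\<close> on all of
  \<open>E'\<close>, which makes \<open>\<alpha>\<close> multiplicative.\<close>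

lemma quaternionic_semilinear:
  assumes \<sigma>: "\<sigma> \<in> quat_morphisms E" and \<sigma>': "\<sigma>' \<in> quat_morphisms E'" and E: "subspace E" "subspace E'"
    and f: "quaternionic_wrt E (quat_class E \<sigma>) E' (quat_class E' \<sigma>') T f" "f ` E = E'"
  obtains \<alpha> where "\<alpha> \<in> Aut_quat" "semilinear E \<sigma> E' \<sigma>' \<alpha> f"
proof -
  have fE: "f \<in> E \<rightarrow> E'" and lf: "linear_on E f" and T: "T \<in> \<sigma> ` Im_quat_sphere \<rightarrow> \<sigma>' ` Im_quat_sphere"
    and fT: "\<And>J x. J \<in> \<sigma> ` Im_quat_sphere \<Longrightarrow> x \<in> E \<Longrightarrow> f (J x) = T J (f x)"
    using f(1) unfolding quaternionic_wrt_def admissible_quat_class[OF \<sigma>] admissible_quat_class[OF \<sigma>'] by auto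
  show ?thesis
  \<comment> \<open>On the zero space the action carries no information about
    \<open>\<alpha>\<close>, so the identity is taken.\<close>
  proof (cases "E' = {0}")
    case True
    have "f (\<sigma> p x) = \<sigma>' (id p) (f x)" if "x \<in> E" for p x
    proof -
      have "f x = 0" "f (\<sigma> p x) = 0" using fE True that quat_morphismsD(1)[OF \<sigma> that] by auto
      then show ?thesis using quat_morphisms_zero[OF \<sigma>' E(2)] by simp
    qed
    then have "semilinear E \<sigma> E' \<sigma>' id f" using fE lf by (simp add: semilinear_def)
    then show ?thesis using that Aut_id by blast
  next
    case False
    then obtain y0 where y0: "y0 \<in> E'" "y0 \<noteq> 0" using subspace_0[OF E(2)] by blast
    have "\<exists>r. r \<in> Im_quat_sphere \<and> T (\<sigma> p) = \<sigma>' r" if "p \<in> Im_quat_sphere" for p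
    proof -
      have "T (\<sigma> p) \<in> \<sigma>' ` Im_quat_sphere" using T that by blast
      then show ?thesis by blast
    qed
    then obtain t where t: "\<And>p. p \<in> Im_quat_sphere \<Longrightarrow> T (\<sigma> p) = \<sigma>' (t p)" by metis
    define \<alpha> where "\<alpha> p = qRe p *\<^sub>R 1 + qI p *\<^sub>R t qi + qJ p *\<^sub>R t qj + qK p *\<^sub>R t qk" for p
    have lin: "\<alpha> (p + r) = \<alpha> p + \<alpha> r" "\<alpha> (c *\<^sub>R p) = c *\<^sub>R \<alpha> p" for p r c
      by (simp_all add: \<alpha>_def algebra_simps)
    have sl: "f (\<sigma> p x) = \<sigma>' (\<alpha> p) (f x)" if x: "x \<in> E" for p x
    proof -
      have fx: "f x \<in> E'" using fE x by blast
      note s = quat_morphismsD[OF \<sigma> x] and s' = quat_morphismsD[OF \<sigma>' fx]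
      have p: "p = qRe p *\<^sub>R 1 + qI p *\<^sub>R qi + qJ p *\<^sub>R qj + qK p *\<^sub>R qk" by (simp add: quat_eq_iff)
      have "\<sigma> p x = qRe p *\<^sub>R x + qI p *\<^sub>R \<sigma> qi x + qJ p *\<^sub>R \<sigma> qj x + qK p *\<^sub>R \<sigma> qk x"
        by (subst p) (simp only: s(4,5,7))
      moreover have "f (a *\<^sub>R x + b *\<^sub>R u + c *\<^sub>R v + d *\<^sub>R w) = a *\<^sub>R f x + b *\<^sub>R f u + c *\<^sub>R f v + d *\<^sub>R f w"
        if "u \<in> E" "v \<in> E" "w \<in> E" for a b c d u v w
        using lf x that E(1) unfolding linear_on_def by (simp add: subspace_add subspace_scale)
      moreover have "f (\<sigma> r x) = \<sigma>' (t r) (f x)" if "r \<in> Im_quat_sphere" for r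
        using fT[of "\<sigma> r" x] t[OF that] that x by simp
      ultimately have "f (\<sigma> p x) = qRe p *\<^sub>R f x + qI p *\<^sub>R \<sigma>' (t qi) (f x) + qJ p *\<^sub>R \<sigma>' (t qj) (f x) + qK p *\<^sub>R \<sigma>' (t qk) (f x)"
        using s(1) by simp
      also have "\<dots> = \<sigma>' (\<alpha> p) (f x)" unfolding \<alpha>_def by (simp only: s'(4,5,7))
      finally show ?thesis .
    qed
    have inj': "p = r" if "\<And>y. y \<in> E' \<Longrightarrow> \<sigma>' p y = \<sigma>' r y" for p r
    proof (rule ccontr)
      assume n: "p \<noteq> r"
      have "\<sigma>' p y0 = \<sigma>' (r + (p - r)) y0" by simp
      also have "\<dots> = \<sigma>' r y0 + \<sigma>' (p - r) y0" by (rule quat_morphismsD(4)[OF \<sigma>' y0(1)])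
      finally have "\<sigma>' (p - r) y0 = 0" using that[OF y0(1)] by simp
      then show False using quat_morphisms_eq_0[OF \<sigma>' E(2) y0(1), of "p - r"] n y0(2) by simp
    qed
    have mult: "\<alpha> (p * r) = \<alpha> p * \<alpha> r" for p r
    proof (rule inj')
      fix y assume "y \<in> E'"
      then obtain x where x: "x \<in> E" "y = f x" using f(2) by blast
      have "\<sigma>' (\<alpha> (p * r)) y = f (\<sigma> p (\<sigma> r x))" using sl[OF x(1)] quat_morphismsD(6)[OF \<sigma> x(1)] x(2) by metis
      also have "\<dots> = \<sigma>' (\<alpha> p) (\<sigma>' (\<alpha> r) y)" using sl quat_morphismsD(1)[OF \<sigma> x(1)] x by metis
      also have "\<dots> = \<sigma>' (\<alpha> p * \<alpha> r) y" using quat_morphismsD(6)[OF \<sigma>' \<open>y \<in> E'\<close>] by metis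
      finally show "\<sigma>' (\<alpha> (p * r)) y = \<sigma>' (\<alpha> p * \<alpha> r) y" .
    qed
    have one: "\<alpha> 1 = 1" by (simp add: \<alpha>_def)
    have linear: "linear \<alpha>" by (rule linearI) (simp_all add: lin)
    \<comment> \<open>A unital multiplicative map on a division algebra has trivial kernel;
      bijectivity follows by comparing dimensions.\<close>
    have nz: "p = 0" if "\<alpha> p = 0" for p
    proof (rule ccontr)
      assume "p \<noteq> 0"
      then obtain y where "y * p = 1" using quat_inverse by blast
      then show False using mult[of y p] one that by simp
    qed
    have "\<alpha> ` UNIV = UNIV"
      using fin_dim_subset_eq[OF dim_quat(1) linear_on_image_subspace[OF subspace_UNIV linear_imp_linear_on[OF linear]]]
        fin_dim_image_inj(1)[OF dim_quat(1) linear_imp_linear_on[OF linear] nz] by simp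
    moreover have "inj \<alpha>"
      using fin_dim_image_inj(2)[OF dim_quat(1) linear_imp_linear_on[OF linear] nz] .
    ultimately have "bij \<alpha>" by (simp add: bij_def)
    then have "\<alpha> \<in> Aut_quat" using linear one mult by (simp add: Aut_quat_def)
    moreover have "semilinear E \<sigma> E' \<sigma>' \<alpha> f" using fE lf sl by (simp add: semilinear_def)
    ultimately show ?thesis by (rule that)
  qed
qed

lemma semilinear_inverse:
  assumes \<sigma>: "\<sigma> \<in> quat_morphisms E" and E: "subspace E" "subspace E'" and \<alpha>: "\<alpha> \<in> Aut_quat"
    and f: "semilinear E \<sigma> E' \<sigma>' \<alpha> f" "bij_betw f E E'"
  shows "semilinear E' \<sigma>' E \<sigma> (inv \<alpha>) (inv_into E f)"
proof -
  let ?g = "inv_into E f"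
  have lf: "linear_on E f" and sl: "\<And>p x. x \<in> E \<Longrightarrow> f (\<sigma> p x) = \<sigma>' (\<alpha> p) (f x)"
    using f(1) by (auto simp: semilinear_def)
  have g: "?g y \<in> E" "f (?g y) = y" if "y \<in> E'" for y
    using f(2) that by (auto simp: bij_betw_def inv_into_into f_inv_into_f)
  have gf: "?g (f x) = x" if "x \<in> E" for x using f(2) that by (simp add: bij_betw_def)
  have "?g (x + y) = ?g x + ?g y" if "x \<in> E'" "y \<in> E'" for x y
  proof -
    have "f (?g x + ?g y) = x + y" using lf g that unfolding linear_on_def by simp
    then show ?thesis using gf[of "?g x + ?g y"] subspace_add[OF E(1)] g that by metis
  qed
  moreover have "?g (c *\<^sub>R x) = c *\<^sub>R ?g x" if "x \<in> E'" for c x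
  proof -
    have "f (c *\<^sub>R ?g x) = c *\<^sub>R x" using lf g that unfolding linear_on_def by simp
    then show ?thesis using gf[of "c *\<^sub>R ?g x"] subspace_scale[OF E(1)] g that by metis
  qed
  moreover have "?g (\<sigma>' p y) = \<sigma> (inv \<alpha> p) (?g y)" if "y \<in> E'" for p y
  proof -
    have "f (\<sigma> (inv \<alpha> p) (?g y)) = \<sigma>' p y" using sl g that by (simp add: AutD(9)[OF \<alpha>])
    then show ?thesis using gf[of "\<sigma> (inv \<alpha> p) (?g y)"] quat_morphismsD(1)[OF \<sigma>] g that by metis
  qed
  ultimately show ?thesis using g(1) by (auto simp: semilinear_def linear_on_def)
qed

lemma semilinear_compose:
  "semilinear E \<sigma> E' \<sigma>' \<alpha> f \<Longrightarrow> semilinear E' \<sigma>' E'' \<sigma>'' \<beta> g \<Longrightarrow> semilinear E \<sigma> E'' \<sigma>'' (\<beta> \<circ> \<alpha>) (\<lambda>x. g (f x))"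
  unfolding semilinear_def linear_on_def by (simp add: Pi_iff)

text \<open>A quaternionic basis is a longest family independent over the quaternions. Its length is
  bounded by \<open>dim E\<close>, and a vector outside the span would extend it, since a nonzero
  last coefficient can be divided out.\<close>

lemma quat_space_coordinates:
  assumes E: "fin_dim E" and \<sigma>: "\<sigma> \<in> quat_morphisms E"
  obtains m \<theta> where "linear_on (quat_space m) \<theta>" "bij_betw \<theta> (quat_space m) E"
    "\<And>p v. v \<in> quat_space m \<Longrightarrow> \<theta> (p \<star> v) = \<sigma> p (\<theta> v)"
proof -
  have sE: "subspace E" using E by (rule fin_dim_subspace)
  define th where "th e m v = (\<Sum>l<m. \<sigma> (lk v l) (e l))" for e :: "nat \<Rightarrow> 'a" and m and v :: qvec
  have lin: "linear_on (quat_space m) (th e m)" and hom: "th e m (p \<star> v) = \<sigma> p (th e m v)"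
    and inE: "th e m v \<in> E" if e: "\<forall>l<m. e l \<in> E" for e m p v
  proof -
    show "th e m v \<in> E" unfolding th_def using e quat_morphismsD(1)[OF \<sigma>] by (intro subspace_sum[OF sE]) auto
    show "linear_on (quat_space m) (th e m)"
      using e quat_morphismsD(4,5)[OF \<sigma>]
      by (auto simp: linear_on_def th_def sum.distrib[symmetric] scaleR_sum_right intro!: sum.cong)
    have "th e m (p \<star> v) = (\<Sum>l<m. \<sigma> p (\<sigma> (lk v l) (e l)))"
      unfolding th_def using e quat_morphismsD(6)[OF \<sigma>] by (intro sum.cong) auto
    also have "\<dots> = \<sigma> p (th e m v)" unfolding th_def
      using e quat_morphismsD(1)[OF \<sigma>]
      by (intro linear_on_sum[OF quat_morphisms_linear_on[OF \<sigma>] sE, symmetric]) auto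
    finally show "th e m (p \<star> v) = \<sigma> p (th e m v)" .
  qed
  define P where "P m \<longleftrightarrow> (\<exists>e. (\<forall>l<m. e l \<in> E) \<and> (\<forall>v\<in>quat_space m. th e m v = 0 \<longrightarrow> v = 0))" for m
  have P0: "P 0" by (auto simp: P_def quat_space_iff intro!: poly_mapping_eqI)
  have "m < Suc (dim E)" if "P m" for m
  proof -
    obtain e where e: "\<forall>l<m. e l \<in> E" "\<forall>v\<in>quat_space m. th e m v = 0 \<longrightarrow> v = 0"
      using \<open>P m\<close> unfolding P_def by (elim exE conjE)
    have "dim (th e m ` quat_space m) = 4 * m"
      using fin_dim_image_inj(1)[OF dim_quat_space(1) lin[OF e(1)]] e(2) dim_quat_space(2) by simp
    moreover have "dim (th e m ` quat_space m) \<le> dim E"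
      using inE[OF e(1)] by (intro fin_dim_subset(2)[OF E linear_on_image_subspace[OF quat_space_subspace lin[OF e(1)]]]) auto
    ultimately show ?thesis by simp
  qed
  then obtain m where m: "P m" "\<And>n. P n \<Longrightarrow> n \<le> m"
    using ex_has_greatest_nat[of P 0 id "Suc (dim E)"] P0 by auto
  obtain e where e: "\<forall>l<m. e l \<in> E" "\<forall>v\<in>quat_space m. th e m v = 0 \<longrightarrow> v = 0"
    using m(1) by (auto simp: P_def)
  have "x \<in> th e m ` quat_space m" if x: "x \<in> E" for x
  proof (rule ccontr)
    assume nx: "x \<notin> th e m ` quat_space m"
    let ?e = "e(m := x)"
    have "v = 0" if v: "v \<in> quat_space (Suc m)" "th ?e (Suc m) v = 0" for v
    proof -
      define w where "w = v - sg m (lk v m)"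
      have w: "w \<in> quat_space m"
        unfolding quat_space_iff
      proof (intro allI impI)
        fix i assume "m \<le> i"
        then show "lk w i = 0" using v(1) by (cases "i = m") (auto simp: w_def lk_sg quat_space_iff)
      qed
      have "th e m w = (\<Sum>l<m. \<sigma> (lk v l) (?e l))"
        unfolding th_def w_def by (intro sum.cong) (auto simp: lk_sg)
      then have eq: "th e m w + \<sigma> (lk v m) x = 0" using v(2) by (simp add: th_def)
      show ?thesis
      proof (cases "lk v m = 0")
        case True
        then have "th e m w = 0" using eq quat_morphisms_0[OF \<sigma> x] by simp
        then have "w = 0" using e(2) w by blast
        then show ?thesis using True by (simp add: w_def)
      next
        case False
        then obtain y where y: "y * lk v m = 1" using quat_inverse by blast
        have "\<sigma> (lk v m) x = - th e m w" using eq by (simp add: eq_neg_iff_add_eq_0 add.commute)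
        then have "\<sigma> y (\<sigma> (lk v m) x) = \<sigma> y ((-1) *\<^sub>R th e m w)" by simp
        then have "x = (-1) *\<^sub>R \<sigma> y (th e m w)"
          using quat_morphismsD(6,7)[OF \<sigma> x] y quat_morphismsD(3)[OF \<sigma> inE[OF e(1)]] by metis
        also have "\<dots> = (-1) *\<^sub>R th e m (y \<star> w)" using hom[OF e(1)] by simp
        also have "\<dots> = th e m ((-1) *\<^sub>R (y \<star> w))"
          using lin[OF e(1)] hsm_quat_space[OF w] unfolding linear_on_def by metis
        finally have "x = th e m ((-1) *\<^sub>R (y \<star> w))" .
        moreover have "(-1) *\<^sub>R (y \<star> w) \<in> quat_space m"
          by (intro subspace_scale[OF quat_space_subspace] hsm_quat_space w)
        ultimately show ?thesis using nx by blast
      qed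
    qed
    moreover have "\<forall>l<Suc m. ?e l \<in> E" using e(1) x by (simp add: less_Suc_eq)
    ultimately have "P (Suc m)" unfolding P_def by blast
    then show False using m(2) by fastforce
  qed
  then have "th e m ` quat_space m = E" using inE[OF e(1)] by blast
  then have "bij_betw (th e m) (quat_space m) E"
    using fin_dim_image_inj(2)[OF dim_quat_space(1) lin[OF e(1)]] e(2) by (simp add: bij_betw_def)
  then show ?thesis using that lin[OF e(1)] hom[OF e(1)] by blast
qed

section \<open>Ambient maps of CR quaternionic isomorphisms\<close>

section \<open>CR quaternionic isomorphisms\<close>

text \<open>The image contains the embedded space \<open>crq_U Y\<close> and its translate under
  \<open>T J\<close>, and these two generate \<open>crq_E Y\<close>.\<close>

lemma crq_linear_surj:
  assumes X: "crq_vector_space X" and Y: "crq_vector_space Y"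
    and t: "t ` crq_U X = crq_U Y" and q: "quaternionic_wrt (crq_E X) (crq_Q X) (crq_E Y) (crq_Q Y) T f"
    and eq: "\<And>u. u \<in> crq_U X \<Longrightarrow> crq_\<iota> Y (t u) = f (crq_\<iota> X u)"
  shows "f ` crq_E X = crq_E Y"
proof
  show "f ` crq_E X \<subseteq> crq_E Y" using q by (auto simp: quaternionic_wrt_def)
  obtain \<sigma> where \<sigma>: "\<sigma> \<in> quat_morphisms (crq_E X)" "crq_Q X = quat_class (crq_E X) \<sigma>"
    using quat_structure_class X unfolding crq_vector_space_def by metis
  have J: "\<sigma> qi \<in> admissible (crq_Q X)" using admissible_quat_class[OF \<sigma>(1)] \<sigma>(2) by simp
  then have TJ: "T (\<sigma> qi) \<in> admissible (crq_Q Y)" using q by (auto simp: quaternionic_wrt_def)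
  have \<iota>: "crq_\<iota> X u \<in> crq_E X" if "u \<in> crq_U X" for u using X that by (auto simp: crq_vector_space_def)
  show "crq_E Y \<subseteq> f ` crq_E X"
  proof
    fix e assume "e \<in> crq_E Y"
    moreover have "\<forall>J\<in>admissible (crq_Q Y).
        {x + J y | x y. x \<in> crq_\<iota> Y ` crq_U Y \<and> y \<in> crq_\<iota> Y ` crq_U Y} = crq_E Y"
      using Y unfolding crq_vector_space_def by (elim conjE)
    note bspec[OF this TJ]
    ultimately have "e \<in> {x + T (\<sigma> qi) y | x y. x \<in> crq_\<iota> Y ` crq_U Y \<and> y \<in> crq_\<iota> Y ` crq_U Y}" by simp
    then have "\<exists>x y. e = x + T (\<sigma> qi) y \<and> x \<in> crq_\<iota> Y ` t ` crq_U X \<and> y \<in> crq_\<iota> Y ` t ` crq_U X"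
      unfolding t mem_Collect_eq .
    then obtain u v where uv: "u \<in> crq_U X" "v \<in> crq_U X" "e = crq_\<iota> Y (t u) + T (\<sigma> qi) (crq_\<iota> Y (t v))"
      by (elim exE conjE imageE) simp
    then have "e = f (crq_\<iota> X u) + f (\<sigma> qi (crq_\<iota> X v))"
      using eq q J \<iota> by (simp add: quaternionic_wrt_def)
    also have "\<dots> = f (crq_\<iota> X u + \<sigma> qi (crq_\<iota> X v))"
      using q \<iota> uv quat_morphismsD(1)[OF \<sigma>(1)] by (simp add: quaternionic_wrt_def linear_on_def)
    finally have e: "e = f (crq_\<iota> X u + \<sigma> qi (crq_\<iota> X v))" .
    have "subspace (crq_E X)" using X by (simp add: crq_vector_space_def)
    then have "crq_\<iota> X u + \<sigma> qi (crq_\<iota> X v) \<in> crq_E X"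
      using \<iota> uv quat_morphismsD(1)[OF \<sigma>(1)] by (simp add: subspace_add)
    then show "e \<in> f ` crq_E X" using e by blast
  qed
qed

text \<open>The ambient maps \<open>f\<close> and \<open>g\<close> of \<open>\<phi>\<close> and of
  its inverse are not known to be mutually inverse, but both are onto. So the two ambient spaces
  have equal dimension and \<open>f\<close> is bijective.\<close>

lemma crq_iso_semilinear:
  assumes X: "crq_vector_space X" and Y: "crq_vector_space Y" and i: "crq_iso X Y \<phi>"
    and \<sigma>: "\<sigma> \<in> quat_morphisms (crq_E X)" "crq_Q X = quat_class (crq_E X) \<sigma>"
    and \<sigma>': "\<sigma>' \<in> quat_morphisms (crq_E Y)" "crq_Q Y = quat_class (crq_E Y) \<sigma>'"
  obtains f \<alpha> where "\<alpha> \<in> Aut_quat" "semilinear (crq_E X) \<sigma> (crq_E Y) \<sigma>' \<alpha> f" "bij_betw f (crq_E X) (crq_E Y)"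
    "\<And>u. u \<in> crq_U X \<Longrightarrow> f (crq_\<iota> X u) = crq_\<iota> Y (\<phi> u)"
proof -
  obtain T f where f: "quaternionic_wrt (crq_E X) (crq_Q X) (crq_E Y) (crq_Q Y) T f"
    "\<And>u. u \<in> crq_U X \<Longrightarrow> crq_\<iota> Y (\<phi> u) = f (crq_\<iota> X u)"
    using i unfolding crq_iso_def crq_linear_def by auto
  let ?\<psi> = "inv_into (crq_U X) \<phi>"
  obtain S g where g: "quaternionic_wrt (crq_E Y) (crq_Q Y) (crq_E X) (crq_Q X) S g"
    "\<And>u. u \<in> crq_U Y \<Longrightarrow> crq_\<iota> X (?\<psi> u) = g (crq_\<iota> Y u)"
    using i unfolding crq_iso_def crq_linear_def by auto
  have bij: "bij_betw \<phi> (crq_U X) (crq_U Y)" using i by (simp add: crq_iso_def)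
  have im: "\<phi> ` crq_U X = crq_U Y" "?\<psi> ` crq_U Y = crq_U X"
    using bij bij_betw_inv_into[OF bij] by (auto simp: bij_betw_def)
  have E: "fin_dim (crq_E X)" "fin_dim (crq_E Y)" using X Y by (auto simp: crq_vector_space_def)
  have sf: "f ` crq_E X = crq_E Y" by (rule crq_linear_surj[OF X Y im(1) f])
  have sg: "g ` crq_E Y = crq_E X" by (rule crq_linear_surj[OF Y X im(2) g])
  have l: "linear_on (crq_E X) f" "linear_on (crq_E Y) g" using f(1) g(1) by (auto simp: quaternionic_wrt_def)
  have "dim {x \<in> crq_E X. f x = 0} = 0"
    using fin_dim_rank_nullity(2)[OF E(1) l(1)] fin_dim_rank_nullity(2)[OF E(2) l(2)] sf sg by simp
  moreover have "fin_dim {x \<in> crq_E X. f x = 0}"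
    by (rule fin_dim_subset(1)[OF E(1) linear_on_kernel_subspace[OF fin_dim_subspace[OF E(1)] l(1)]]) auto
  ultimately have "{x \<in> crq_E X. f x = 0} = {0}" using fin_dim_eq_0 by blast
  then have "inj_on f (crq_E X)" by (intro fin_dim_image_inj(2)[OF E(1) l(1)]) auto
  then have b: "bij_betw f (crq_E X) (crq_E Y)" using sf by (simp add: bij_betw_def)
  obtain \<alpha> where "\<alpha> \<in> Aut_quat" "semilinear (crq_E X) \<sigma> (crq_E Y) \<sigma>' \<alpha> f"
    by (rule quaternionic_semilinear[OF \<sigma>(1) \<sigma>'(1) fin_dim_subspace[OF E(1)] fin_dim_subspace[OF E(2)] f(1)[unfolded \<sigma>(2) \<sigma>'(2)] sf])
  then show ?thesis using that b f(2) by metis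
qed

lemma semilinear_crq_linear:
  assumes \<sigma>: "\<sigma> \<in> quat_morphisms (crq_E X)" "crq_Q X = quat_class (crq_E X) \<sigma>"
    and \<sigma>': "\<sigma>' \<in> quat_morphisms (crq_E Y)" "crq_Q Y = quat_class (crq_E Y) \<sigma>'"
    and f: "\<alpha> \<in> Aut_quat" "semilinear (crq_E X) \<sigma> (crq_E Y) \<sigma>' \<alpha> f"
    and t: "t \<in> crq_U X \<rightarrow> crq_U Y" "linear_on (crq_U X) t"
    and eq: "\<And>u. u \<in> crq_U X \<Longrightarrow> crq_\<iota> Y (t u) = f (crq_\<iota> X u)"
  shows "crq_linear X Y t"
  unfolding crq_linear_def
  using semilinear_quaternionic[OF \<sigma>(1) \<sigma>'(1) f] t eq unfolding \<sigma>(2) \<sigma>'(2) by blast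

lemma semilinear_crq_iso:
  assumes \<sigma>: "\<sigma> \<in> quat_morphisms (crq_E X)" "crq_Q X = quat_class (crq_E X) \<sigma>"
    and \<sigma>': "\<sigma>' \<in> quat_morphisms (crq_E Y)" "crq_Q Y = quat_class (crq_E Y) \<sigma>'"
    and E: "subspace (crq_E X)" "subspace (crq_E Y)" and U: "subspace (crq_U X)"
    and f: "\<alpha> \<in> Aut_quat" "semilinear (crq_E X) \<sigma> (crq_E Y) \<sigma>' \<alpha> f" "bij_betw f (crq_E X) (crq_E Y)"
    and t: "bij_betw t (crq_U X) (crq_U Y)" "linear_on (crq_U X) t"
    and eq: "\<And>u. u \<in> crq_U X \<Longrightarrow> crq_\<iota> Y (t u) = f (crq_\<iota> X u)"
    and \<iota>: "crq_\<iota> X \<in> crq_U X \<rightarrow> crq_E X"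
  shows "crq_iso X Y t"
proof -
  let ?s = "inv_into (crq_U X) t"
  have s: "?s v \<in> crq_U X" "t (?s v) = v" if "v \<in> crq_U Y" for v
    using t(1) that by (auto simp: bij_betw_def inv_into_into f_inv_into_f)
  have st: "?s (t u) = u" if "u \<in> crq_U X" for u using t(1) that by (simp add: bij_betw_def)
  have ls: "linear_on (crq_U Y) ?s" unfolding linear_on_def
  proof (intro conjI ballI allI)
    fix x y assume "x \<in> crq_U Y" "y \<in> crq_U Y"
    moreover from this have "t (?s x + ?s y) = x + y" using t(2) s unfolding linear_on_def by simp
    ultimately show "?s (x + y) = ?s x + ?s y" using st[of "?s x + ?s y"] s subspace_add[OF U] by metis
  next
    fix c x assume "x \<in> crq_U Y"
    moreover from this have "t (c *\<^sub>R ?s x) = c *\<^sub>R x" using t(2) s unfolding linear_on_def by simp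
    ultimately show "?s (c *\<^sub>R x) = c *\<^sub>R ?s x" using st[of "c *\<^sub>R ?s x"] s subspace_scale[OF U] by metis
  qed
  have "crq_linear X Y t"
    by (rule semilinear_crq_linear[OF \<sigma> \<sigma>' f(1,2) _ t(2) eq]) (use t(1) in \<open>auto simp: bij_betw_def\<close>)
  moreover have "crq_linear Y X ?s"
  proof (rule semilinear_crq_linear[OF \<sigma>' \<sigma> Aut_inv[OF f(1)] semilinear_inverse[OF \<sigma>(1) E f(1-3)] _ ls])
    show "?s \<in> crq_U Y \<rightarrow> crq_U X" using s by auto
    fix v assume v: "v \<in> crq_U Y"
    have "crq_\<iota> Y v = f (crq_\<iota> X (?s v))" using eq[OF s(1)[OF v]] s(2)[OF v] by simp
    moreover have "crq_\<iota> X (?s v) \<in> crq_E X" using \<iota> s(1)[OF v] by blast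
    ultimately show "crq_\<iota> X (?s v) = inv_into (crq_E X) f (crq_\<iota> Y v)"
      using f(3) by (simp add: bij_betw_def)
  qed
  ultimately show ?thesis using t(1) by (simp add: crq_iso_def)
qed

section \<open>Direct sums of models and the components of maps between them\<close>

section \<open>Sums of model spaces\<close>

definition Esum :: "crq_label list \<Rightarrow> nat set \<Rightarrow> (nat \<Rightarrow>\<^sub>0 qvec) set" where
  "Esum ls I = family_sum I (\<lambda>i. quat_space (label_dim (ls ! i)))"

definition Usum :: "(nat \<Rightarrow> nat \<Rightarrow> quat) \<Rightarrow> crq_label list \<Rightarrow> nat set \<Rightarrow> (nat \<Rightarrow>\<^sub>0 qvec) set" where
  "Usum q ls I = family_sum I (\<lambda>i. label_U q (ls ! i))"

text \<open>The form into which \<open>crq_direct_sum\<close> unfolds for the models;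
  \<open>lk_ssum\<close> reduces it to multiplication of component \<open>i\<close> by
  \<open>a i p\<close>.\<close>

definition ssum :: "(nat \<Rightarrow> quat \<Rightarrow> quat) \<Rightarrow> crq_label list \<Rightarrow> nat set \<Rightarrow> quat \<Rightarrow> (nat \<Rightarrow>\<^sub>0 qvec) \<Rightarrow> (nat \<Rightarrow>\<^sub>0 qvec)" where
  "ssum a ls I p = restrict (Poly_Mapping.mapp (\<lambda>i. (left_mult (label_dim (ls ! i)) \<circ> a i) p)) (Esum ls I)"

lemma term_sum_sel:
  "crq_U (term_sum q a ls I) = Usum q ls I" "crq_E (term_sum q a ls I) = Esum ls I"
  "crq_Q (term_sum q a ls I) = quat_class (Esum ls I) (ssum a ls I)"
  "crq_\<iota> (term_sum q a ls I) = (\<lambda>v. v)"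
proof -
  show "crq_U (term_sum q a ls I) = Usum q ls I" "crq_E (term_sum q a ls I) = Esum ls I"
    by (simp_all add: term_sum_def crq_direct_sum_def Let_def crq_term_def Usum_def Esum_def)
  have "ssum a ls I = (\<lambda>p. restrict (Poly_Mapping.mapp (\<lambda>i. (left_mult (label_dim (ls ! i)) \<circ> a i) p)) (Esum ls I))"
    by (rule ext) (rule ssum_def)
  then show "crq_Q (term_sum q a ls I) = quat_class (Esum ls I) (ssum a ls I)"
    by (simp add: term_sum_def crq_direct_sum_def Let_def crq_term_def Esum_def)
  have "Poly_Mapping.mapp (\<lambda>i u. u) v = v" for v :: "nat \<Rightarrow>\<^sub>0 qvec"
    by (rule poly_mapping_eqI) (simp add: lookup_mapp when_def in_keys_iff)
  then show "crq_\<iota> (term_sum q a ls I) = (\<lambda>v. v)"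
    by (simp add: term_sum_def crq_direct_sum_def Let_def crq_term_def fun_eq_iff)
qed

lemma Esum_iff:
  "v \<in> Esum ls I \<longleftrightarrow> (\<forall>i. i \<notin> I \<longrightarrow> lk v i = 0) \<and> (\<forall>i\<in>I. lk v i \<in> quat_space (label_dim (ls ! i)))"
  unfolding Esum_def by (rule family_sum_alt) (rule subspace_0[OF quat_space_subspace])

lemma Usum_iff:
  "v \<in> Usum q ls I \<longleftrightarrow> (\<forall>i. i \<notin> I \<longrightarrow> lk v i = 0) \<and> (\<forall>i\<in>I. lk v i \<in> label_U q (ls ! i))"
  unfolding Usum_def by (rule family_sum_alt) (rule subspace_0[OF label_U_subspace(1)])

lemma Esum_subspace: "subspace (Esum ls I)"
  unfolding Esum_def by (rule subspace_family_sum) (rule quat_space_subspace)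

lemma Usum_subspace: "subspace (Usum q ls I)"
  unfolding Usum_def by (rule subspace_family_sum) (rule label_U_subspace)

lemma Usum_subset: "Usum q ls I \<subseteq> Esum ls I"
  using label_U_subspace(3) unfolding Usum_iff Esum_iff subset_iff by blast

lemma Esum_dim:
  "finite I \<Longrightarrow> fin_dim (Esum ls I)"
  "finite I \<Longrightarrow> dim (Esum ls I) = (\<Sum>i\<in>I. 4 * label_dim (ls ! i))"
  using dim_family_sum[of I "\<lambda>i. quat_space (label_dim (ls ! i))"] dim_quat_space by (simp_all add: Esum_def)

lemma Usum_dim:
  "finite I \<Longrightarrow> fin_dim (Usum q ls I)"
  "finite I \<Longrightarrow> dim (Usum q ls I) = (\<Sum>i\<in>I. dim (label_U q (ls ! i)))"
  using dim_family_sum[of I "\<lambda>i. label_U q (ls ! i)"] label_U_subspace(2) by (simp_all add: Usum_def)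

lemma lk_ssum:
  assumes "v \<in> Esum ls I" shows "lk (ssum a ls I p v) i = a i p \<star> lk v i"
proof (cases "lk v i = 0")
  case True
  then show ?thesis using assms by (simp add: ssum_def lookup_mapp in_keys_iff hsm_simps)
next
  case False
  then have "lk v i \<in> quat_space (label_dim (ls ! i))" using assms unfolding Esum_iff by metis
  then show ?thesis using False assms by (simp add: ssum_def lookup_mapp left_mult_def hsm_def in_keys_iff)
qed

lemma ssum_in: "v \<in> Esum ls I \<Longrightarrow> ssum a ls I p v \<in> Esum ls I"
  using hsm_quat_space by (subst Esum_iff) (auto simp: lk_ssum Esum_iff hsm_simps)

lemma ssum_morphism:
  assumes "\<And>i. i \<in> I \<Longrightarrow> a i \<in> Aut_quat"
  shows "ssum a ls I \<in> quat_morphisms (Esum ls I)"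
proof -
  note sub = subspace_add[OF Esum_subspace] subspace_scale[OF Esum_subspace]
  have z: "lk v i = 0" if "v \<in> Esum ls I" "i \<notin> I" for v i using that by (simp add: Esum_iff)
  have "ssum a ls I p \<in> End (Esum ls I)" for p
    unfolding End_def
  proof (intro CollectI conjI)
    show "ssum a ls I p \<in> Esum ls I \<rightarrow>\<^sub>E Esum ls I"
      using ssum_in by (auto simp: PiE_iff) (auto simp: ssum_def extensional_def)
    show "linear_on (Esum ls I) (ssum a ls I p)"
      by (auto simp: linear_on_def intro!: poly_mapping_eqI[where ?'a = nat and ?'b = qvec])
        (simp_all add: lk_ssum sub hsm_simps)
  qed
  moreover have "ssum a ls I (p + r) x = ssum a ls I p x + ssum a ls I r x"
    "ssum a ls I (c *\<^sub>R p) x = c *\<^sub>R ssum a ls I p x"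
    "ssum a ls I (p * r) x = ssum a ls I p (ssum a ls I r x)"
    "ssum a ls I 1 x = x" if x: "x \<in> Esum ls I" for p r c x
  proof -
    have e: "u = w" if "\<And>i. i \<in> I \<Longrightarrow> lk u i = lk w i" "\<And>i. i \<notin> I \<Longrightarrow> lk u i = lk w i" for u w :: "nat \<Rightarrow>\<^sub>0 qvec"
      by (rule poly_mapping_eqI) (use that in blast)
    show "ssum a ls I (p + r) x = ssum a ls I p x + ssum a ls I r x"
      by (rule e) (simp_all add: lk_ssum x z[OF x] AutD(1)[OF assms] hsm_simps)
    show "ssum a ls I (c *\<^sub>R p) x = c *\<^sub>R ssum a ls I p x"
      by (rule e) (simp_all add: lk_ssum x z[OF x] AutD(2)[OF assms] hsm_simps)
    show "ssum a ls I (p * r) x = ssum a ls I p (ssum a ls I r x)"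
      by (rule e) (simp_all add: lk_ssum x ssum_in z[OF x] AutD(3)[OF assms] hsm_simps)
    show "ssum a ls I 1 x = x"
      by (rule e) (simp_all add: lk_ssum x z[OF x] AutD(4)[OF assms] hsm_simps)
  qed
  ultimately show ?thesis by (simp add: quat_morphisms_def)
qed

text \<open>Generation is checked componentwise: on component \<open>i\<close> the structure given
  by \<open>p\<close> acts as \<open>a i p\<close>, again an imaginary unit, so
  \<open>label_U_generates\<close> applies.\<close>

lemma term_sum_crq_vector_space:
  assumes q: "admissible_choice q" and I: "finite I" and a: "\<And>i. i \<in> I \<Longrightarrow> a i \<in> Aut_quat"
  shows "crq_vector_space (term_sum q a ls I)"
  unfolding crq_vector_space_def term_sum_sel
proof (intro conjI ballI)
  have m: "ssum a ls I \<in> quat_morphisms (Esum ls I)" by (rule ssum_morphism) (rule a)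
  show "subspace (Usum q ls I)" "fin_dim (Usum q ls I)" "subspace (Esum ls I)" "fin_dim (Esum ls I)"
    using Usum_subspace Esum_subspace Usum_dim(1)[OF I] Esum_dim(1)[OF I] by blast+
  show "quat_class (Esum ls I) (ssum a ls I) \<in> quat_structures (Esum ls I)" by (rule quat_class_structure[OF m])
  show "(\<lambda>v. v) \<in> Usum q ls I \<rightarrow> Esum ls I" using Usum_subset by blast
  show "linear_on (Usum q ls I) (\<lambda>v. v)" by (simp add: linear_on_def)
  show "inj_on (\<lambda>v. v) (Usum q ls I)" by simp
  fix J assume "J \<in> admissible (quat_class (Esum ls I) (ssum a ls I))"
  then obtain p where p: "p \<in> Im_quat_sphere" "J = ssum a ls I p" unfolding admissible_quat_class[OF m] by blast
  have "e \<in> {x + J y | x y. x \<in> Usum q ls I \<and> y \<in> Usum q ls I}" if e: "e \<in> Esum ls I" for e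
  proof -
    have "\<exists>x y. x \<in> label_U q (ls ! i) \<and> y \<in> label_U q (ls ! i) \<and> lk e i = x + a i p \<star> y" if i: "i \<in> I" for i
    proof -
      have "a i p \<in> Im_quat_sphere" using Aut_sphere[OF a[OF i]] p(1) by simp
      moreover have "lk e i \<in> quat_space (label_dim (ls ! i))" using e i by (simp add: Esum_iff)
      ultimately show ?thesis using label_U_generates[OF q] by metis
    qed
    then obtain x y where xy: "\<And>i. i \<in> I \<Longrightarrow> x i \<in> label_U q (ls ! i) \<and> y i \<in> label_U q (ls ! i) \<and> lk e i = x i + a i p \<star> y i"
      by metis
    let ?x = "\<Sum>i\<in>I. sg i (x i)" and ?y = "\<Sum>i\<in>I. sg i (y i)"
    have l: "lk ?x i = (if i \<in> I then x i else 0)" "lk ?y i = (if i \<in> I then y i else 0)" for i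
      using I by (simp_all add: lookup_sum lk_sg)
    have U: "?x \<in> Usum q ls I" "?y \<in> Usum q ls I" using xy by (auto simp: Usum_iff l)
    then have yE: "?y \<in> Esum ls I" using Usum_subset by blast
    have "e = ?x + J ?y"
    proof (rule poly_mapping_eqI)
      fix i show "lk e i = lk (?x + J ?y) i"
        using xy[of i] e by (simp add: p(2) lk_ssum[OF yE] l Esum_iff hsm_simps)
    qed
    then show ?thesis using U by blast
  qed
  moreover have "x + J y \<in> Esum ls I" if "x \<in> Usum q ls I" "y \<in> Usum q ls I" for x y
    unfolding p(2) using that Usum_subset ssum_in by (intro subspace_add[OF Esum_subspace]) blast+
  ultimately show "{x + J y | x y. x \<in> (\<lambda>v. v) ` Usum q ls I \<and> y \<in> (\<lambda>v. v) ` Usum q ls I} = Esum ls I"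
    by auto
qed

lemma semilinear_inclusion:
  assumes "I \<subseteq> K" shows "semilinear (Esum ls I) (ssum a ls I) (Esum ls K) (ssum a ls K) id (\<lambda>x. x)"
proof -
  have sub: "Esum ls I \<subseteq> Esum ls K"
  proof
    fix v assume v: "v \<in> Esum ls I"
    have "lk v i \<in> quat_space (label_dim (ls ! i))" for i
      using v subspace_0[OF quat_space_subspace] by (cases "i \<in> I") (auto simp: Esum_iff)
    then show "v \<in> Esum ls K" using v assms by (auto simp: Esum_iff)
  qed
  have "ssum a ls I p x = ssum a ls K p x" if x: "x \<in> Esum ls I" for p x
  proof (rule poly_mapping_eqI)
    have "x \<in> Esum ls K" using x sub by blast
    then show "lk (ssum a ls I p x) i = lk (ssum a ls K p x) i" for i using x by (simp add: lk_ssum)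
  qed
  then show ?thesis using sub by (auto simp: semilinear_def linear_on_def)
qed

text \<open>The component of \<open>F\<close> from term \<open>i\<close> to term \<open>j\<close> is
  semilinear with respect to \<open>a i\<close> on the source and
  \<open>a' j \<circ> \<beta>\<close> on the target.\<close>

lemma semilinear_component_zero:
  assumes q: "admissible_choice q" and i: "i \<in> I" "finite I" and j: "j \<in> K" and p: "label_pos (ls ! i) < label_pos (ls' ! j)"
    and a: "a i \<in> Aut_quat" "a' j \<in> Aut_quat" "\<beta> \<in> Aut_quat"
    and F: "semilinear (Esum ls I) (ssum a ls I) (Esum ls' K) (ssum a' ls' K) \<beta> F" "F ` Usum q ls I \<subseteq> Usum q ls' K"
    and x: "x \<in> quat_space (label_dim (ls ! i))"
  shows "lk (F (sg i x)) j = 0"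
proof -
  let ?f = "\<lambda>x. lk (F (sg i x)) j"
  let ?Q = "quat_space (label_dim (ls ! i))"
  have sE: "sg i x \<in> Esum ls I" if "x \<in> ?Q" for x using that i by (auto simp: Esum_iff lk_sg subspace_0[OF quat_space_subspace])
  have sU: "sg i x \<in> Usum q ls I" if "x \<in> label_U q (ls ! i)" for x
    using that i by (auto simp: Usum_iff lk_sg subspace_0[OF label_U_subspace(1)])
  have FE: "F v \<in> Esum ls' K" and Fs: "F (ssum a ls I p v) = ssum a' ls' K (\<beta> p) (F v)" if "v \<in> Esum ls I" for v p
    using F(1) that by (auto simp: semilinear_def)
  have lF: "linear_on (Esum ls I) F" using F(1) by (simp add: semilinear_def)
  have hom: "?f (a i p \<star> x) = (a' j \<circ> \<beta>) p \<star> ?f x" if x: "x \<in> ?Q" for p x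
  proof -
    have "sg i (a i p \<star> x) = ssum a ls I p (sg i x)"
      by (rule poly_mapping_eqI) (auto simp: lk_ssum[OF sE[OF x]] lk_sg hsm_simps)
    then have "F (sg i (a i p \<star> x)) = ssum a' ls' K (\<beta> p) (F (sg i x))" using Fs[OF sE[OF x]] by simp
    then show ?thesis using lk_ssum[OF FE[OF sE[OF x]]] by simp
  qed
  have lin: "linear_on ?Q ?f"
    using lF sE unfolding linear_on_def by (simp add: linear_add[OF linear_sg] linear_scale[OF linear_sg])
  have im: "?f ` ?Q \<subseteq> quat_space (label_dim (ls' ! j))" using FE[OF sE] j by (auto simp: Esum_iff)
  have imU: "?f ` label_U q (ls ! i) \<subseteq> label_U q (ls' ! j)"
  proof
    fix y assume "y \<in> ?f ` label_U q (ls ! i)"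
    then obtain u where u: "u \<in> label_U q (ls ! i)" "y = ?f u" by blast
    then have "F (sg i u) \<in> Usum q ls' K" using F(2) sU by blast
    then show "y \<in> label_U q (ls' ! j)" using u j by (simp add: Usum_iff)
  qed
  show ?thesis
    by (rule twisted_hom_label_zero[OF q p a(1) Aut_comp[OF a(2,3)] lin im imU _ x]) (rule hom)
qed

definition upto_pos :: "crq_label list \<Rightarrow> nat \<Rightarrow> nat set" where
  "upto_pos ls n = {i. i < length ls \<and> label_pos (ls ! i) \<le> n}"

lemma upto_pos: "finite (upto_pos ls n)" "upto_pos ls n \<subseteq> {..<length ls}"
  by (auto simp: upto_pos_def)

lemma Esum_mono: "I \<subseteq> K \<Longrightarrow> Esum ls I \<subseteq> Esum ls K"
  using semilinear_inclusion[of I K ls] unfolding semilinear_def by blast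

text \<open>All components from terms at positions at most \<open>n\<close> to terms at positions
  above \<open>n\<close> vanish.\<close>

lemma semilinear_filtered:
  assumes q: "admissible_choice q"
    and a: "\<And>i. i < length ls \<Longrightarrow> a i \<in> Aut_quat" "\<And>j. j < length ls' \<Longrightarrow> a' j \<in> Aut_quat" "\<beta> \<in> Aut_quat"
    and F: "semilinear (Esum ls {..<length ls}) (ssum a ls {..<length ls}) (Esum ls' {..<length ls'}) (ssum a' ls' {..<length ls'}) \<beta> F"
      "F ` Usum q ls {..<length ls} \<subseteq> Usum q ls' {..<length ls'}"
    and v: "v \<in> Esum ls (upto_pos ls n)"
  shows "F v \<in> Esum ls' (upto_pos ls' n)"
proof -
  let ?N = "{..<length ls}"
  have vN: "v \<in> Esum ls ?N" using Esum_mono[OF upto_pos(2)] v by blast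
  then have Fv: "F v \<in> Esum ls' {..<length ls'}" using F(1) by (auto simp: semilinear_def)
  have lF: "linear_on (Esum ls ?N) F" using F(1) by (simp add: semilinear_def)
  have "v = (\<Sum>i\<in>upto_pos ls n. sg i (lk v i))"
    using v upto_pos(1) unfolding Esum_def by (rule family_sum_eq_sum_single)
  then have "F v = F (\<Sum>i\<in>upto_pos ls n. sg i (lk v i))" by simp
  also have "\<dots> = (\<Sum>i\<in>upto_pos ls n. F (sg i (lk v i)))"
  proof (rule linear_on_sum[OF lF Esum_subspace])
    fix i assume "i \<in> upto_pos ls n"
    then show "sg i (lk v i) \<in> Esum ls ?N"
      using vN upto_pos(2) by (auto simp: Esum_iff lk_sg subspace_0[OF quat_space_subspace])
  qed
  finally have eq: "F v = (\<Sum>i\<in>upto_pos ls n. F (sg i (lk v i)))" .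
  have "lk (F v) j = 0" if j: "j < length ls'" "n < label_pos (ls' ! j)" for j
    unfolding eq lookup_sum
  proof (rule sum.neutral, intro ballI)
    fix i assume i: "i \<in> upto_pos ls n"
    then have "i < length ls" "label_pos (ls ! i) < label_pos (ls' ! j)" using j by (auto simp: upto_pos_def)
    moreover have "lk v i \<in> quat_space (label_dim (ls ! i))" using v i by (simp add: Esum_iff)
    ultimately show "lk (F (sg i (lk v i))) j = 0"
      using a j(1) by (intro semilinear_component_zero[OF q _ _ _ _ _ _ a(3) F]) auto
  qed
  moreover have "lk (F v) j = 0" if "\<not> j < length ls'" for j using Fv that by (simp add: Esum_iff)
  ultimately have "lk (F v) j = 0" if "j \<notin> upto_pos ls' n" for j
    using that unfolding upto_pos_def by (metis (mono_tags, lifting) mem_Collect_eq not_le)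
  then show ?thesis using Fv by (auto simp: Esum_iff upto_pos_def)
qed

section \<open>The filtration and its independence of the decomposition\<close>

section \<open>The filtration\<close>

lemma Usum_mono: "I \<subseteq> K \<Longrightarrow> Usum q ls I \<subseteq> Usum q ls K"
proof
  fix v assume IK: "I \<subseteq> K" and v: "v \<in> Usum q ls I"
  have "lk v i \<in> label_U q (ls ! i)" for i
    using v subspace_0[OF label_U_subspace(1)] by (cases "i \<in> I") (auto simp: Usum_iff)
  then show "v \<in> Usum q ls K" using v IK by (auto simp: Usum_iff)
qed

text \<open>Allows the filtration to be controlled on the ambient spaces, where semilinear maps
  live, and then restricted to \<open>U\<close>.\<close>

lemma Usum_inter_Esum: "I \<subseteq> K \<Longrightarrow> Usum q ls K \<inter> Esum ls I = Usum q ls I"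
proof
  assume IK: "I \<subseteq> K"
  show "Usum q ls K \<inter> Esum ls I \<subseteq> Usum q ls I"
  proof
    fix v assume "v \<in> Usum q ls K \<inter> Esum ls I"
    then show "v \<in> Usum q ls I" using IK unfolding Int_iff Usum_iff Esum_iff by blast
  qed
  show "Usum q ls I \<subseteq> Usum q ls K \<inter> Esum ls I"
    using Usum_mono[OF IK] Usum_subset by blast
qed

lemma crq_W_sel:
  "crq_U (crq_W q X a ls \<phi> n) = {u \<in> crq_U X. \<phi> u \<in> Usum q ls (upto_pos ls n)}"
  "crq_E (crq_W q X a ls \<phi> n) = Esum ls (upto_pos ls n)"
  "crq_Q (crq_W q X a ls \<phi> n) = quat_class (Esum ls (upto_pos ls n)) (ssum a ls (upto_pos ls n))"
  "crq_\<iota> (crq_W q X a ls \<phi> n) u = \<phi> u"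
  by (simp_all add: crq_W_def Let_def term_sum_sel upto_pos_def)

lemma crq_decomposition_semilinear:
  assumes X: "crq_vector_space X" and q: "admissible_choice q" and d: "crq_decomposition q X a ls \<phi>"
    and \<sigma>: "\<sigma> \<in> quat_morphisms (crq_E X)" "crq_Q X = quat_class (crq_E X) \<sigma>"
  obtains f \<alpha> where "\<alpha> \<in> Aut_quat"
    "semilinear (crq_E X) \<sigma> (Esum ls {..<length ls}) (ssum a ls {..<length ls}) \<alpha> f"
    "bij_betw f (crq_E X) (Esum ls {..<length ls})"
    "\<forall>u\<in>crq_U X. f (crq_\<iota> X u) = \<phi> u"
    "bij_betw \<phi> (crq_U X) (Usum q ls {..<length ls})" "linear_on (crq_U X) \<phi>"
    "\<forall>i<length ls. a i \<in> Aut_quat"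
proof -
  let ?N = "{..<length ls}" and ?S = "term_sum q a ls {..<length ls}"
  have a: "\<forall>i<length ls. a i \<in> Aut_quat" and i: "crq_iso X ?S \<phi>" using d by (auto simp: crq_decomposition_def)
  have m: "ssum a ls ?N \<in> quat_morphisms (crq_E ?S)" "crq_Q ?S = quat_class (crq_E ?S) (ssum a ls ?N)"
    using ssum_morphism[of ?N a ls] a by (auto simp: term_sum_sel)
  have S: "crq_vector_space ?S" using a by (intro term_sum_crq_vector_space[OF q]) auto
  have \<phi>: "bij_betw \<phi> (crq_U X) (Usum q ls ?N)" "linear_on (crq_U X) \<phi>"
    using i by (auto simp: crq_iso_def crq_linear_def term_sum_sel)
  show ?thesis
  proof (rule crq_iso_semilinear[OF X S i \<sigma> m])
    fix f \<alpha> assume "\<alpha> \<in> Aut_quat" "semilinear (crq_E X) \<sigma> (crq_E ?S) (ssum a ls ?N) \<alpha> f" "bij_betw f (crq_E X) (crq_E ?S)"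
      "\<And>u. u \<in> crq_U X \<Longrightarrow> f (crq_\<iota> X u) = crq_\<iota> ?S (\<phi> u)"
    then show thesis using that \<phi> a unfolding term_sum_sel by blast
  qed
qed

lemma crq_W_bij:
  assumes "bij_betw \<phi> (crq_U X) (Usum q ls {..<length ls})"
  shows "bij_betw \<phi> {u \<in> crq_U X. \<phi> u \<in> Usum q ls (upto_pos ls n)} (Usum q ls (upto_pos ls n))"
proof -
  have "\<phi> ` {u \<in> crq_U X. \<phi> u \<in> Usum q ls (upto_pos ls n)} = Usum q ls (upto_pos ls n)"
  proof
    show "Usum q ls (upto_pos ls n) \<subseteq> \<phi> ` {u \<in> crq_U X. \<phi> u \<in> Usum q ls (upto_pos ls n)}"
    proof
      fix v assume v: "v \<in> Usum q ls (upto_pos ls n)"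
      then have "v \<in> \<phi> ` crq_U X"
        using subsetD[OF Usum_mono[OF upto_pos(2)] v] assms by (simp add: bij_betw_def)
      then show "v \<in> \<phi> ` {u \<in> crq_U X. \<phi> u \<in> Usum q ls (upto_pos ls n)}" using v by blast
    qed
  qed blast
  moreover have "inj_on \<phi> {u \<in> crq_U X. \<phi> u \<in> Usum q ls (upto_pos ls n)}"
    using assms by (auto simp: bij_betw_def inj_on_def)
  ultimately show ?thesis by (simp add: bij_betw_def)
qed

lemma crq_W_subspace:
  assumes "subspace (crq_U X)" "linear_on (crq_U X) \<phi>"
  shows "subspace {u \<in> crq_U X. \<phi> u \<in> Usum q ls I}"
  unfolding subspace_def
  using assms linear_on_zero[OF assms(2,1)] subspace_0[OF Usum_subspace] subspace_add[OF Usum_subspace]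
    subspace_scale[OF Usum_subspace]
  by (auto simp: linear_on_def subspace_add subspace_scale subspace_0)

text \<open>The ambient map of the inclusion is the inverse of \<open>f\<close>, restricted to the
  partial sum \<open>Esum ls (upto_pos ls n)\<close>.\<close>

lemma crq_W_crq_subspace:
  assumes X: "crq_vector_space X" and q: "admissible_choice q" and d: "crq_decomposition q X a ls \<phi>"
  shows "crq_subspace (crq_W q X a ls \<phi> n) X"
proof -
  obtain \<sigma> where \<sigma>: "\<sigma> \<in> quat_morphisms (crq_E X)" "crq_Q X = quat_class (crq_E X) \<sigma>"
    using quat_structure_class X unfolding crq_vector_space_def by metis
  obtain f \<alpha> where f: "\<alpha> \<in> Aut_quat"
    "semilinear (crq_E X) \<sigma> (Esum ls {..<length ls}) (ssum a ls {..<length ls}) \<alpha> f"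
    "bij_betw f (crq_E X) (Esum ls {..<length ls})"
    "\<forall>u\<in>crq_U X. f (crq_\<iota> X u) = \<phi> u"
    and \<phi>: "bij_betw \<phi> (crq_U X) (Usum q ls {..<length ls})" "linear_on (crq_U X) \<phi>"
    and a: "\<forall>i<length ls. a i \<in> Aut_quat"
    by (rule crq_decomposition_semilinear[OF X q d \<sigma>])
  let ?I = "upto_pos ls n" and ?W = "crq_W q X a ls \<phi> n"
  let ?U = "{u \<in> crq_U X. \<phi> u \<in> Usum q ls ?I}"
  have XU: "subspace (crq_U X)" "fin_dim (crq_U X)" "subspace (crq_E X)" "crq_\<iota> X \<in> crq_U X \<rightarrow> crq_E X"
    using X by (auto simp: crq_vector_space_def)
  have aI: "a i \<in> Aut_quat" if "i \<in> ?I" for i using a that by (auto simp: upto_pos_def)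
  have m: "ssum a ls ?I \<in> quat_morphisms (Esum ls ?I)" by (rule ssum_morphism) (rule aI)
  have sU: "subspace ?U" by (rule crq_W_subspace[OF XU(1) \<phi>(2)])
  note bU = crq_W_bij[OF \<phi>(1), of n]
  have S: "crq_vector_space (term_sum q a ls ?I)" by (rule term_sum_crq_vector_space[OF q upto_pos(1)]) (rule aI)
  have gen: "{x + J y | x y. x \<in> Usum q ls ?I \<and> y \<in> Usum q ls ?I} = Esum ls ?I"
    if "J \<in> admissible (quat_class (Esum ls ?I) (ssum a ls ?I))" for J
    using S that by (simp add: crq_vector_space_def term_sum_sel)
  have im: "crq_\<iota> ?W ` ?U = Usum q ls ?I"
    using bU by (auto simp: bij_betw_def crq_W_sel(4))
  have W: "crq_vector_space ?W"
    unfolding crq_vector_space_def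
  proof (intro conjI ballI)
    show "subspace (crq_U ?W)" using sU by (simp add: crq_W_sel)
    then show "fin_dim (crq_U ?W)" by (rule fin_dim_subset(1)[OF XU(2)]) (auto simp: crq_W_sel)
    show "subspace (crq_E ?W)" "fin_dim (crq_E ?W)" by (simp_all add: crq_W_sel Esum_subspace Esum_dim upto_pos)
    show "crq_Q ?W \<in> quat_structures (crq_E ?W)"
      using quat_class_structure[OF m] by (simp add: crq_W_sel)
    show "crq_\<iota> ?W \<in> crq_U ?W \<rightarrow> crq_E ?W" using Usum_subset[of q ls ?I] by (auto simp: crq_W_sel)
    show "linear_on (crq_U ?W) (crq_\<iota> ?W)" using \<phi>(2) by (auto simp: linear_on_def crq_W_sel)
    show "inj_on (crq_\<iota> ?W) (crq_U ?W)" using bU by (simp add: bij_betw_def crq_W_sel inj_on_def)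
    fix J assume "J \<in> admissible (crq_Q ?W)"
    then show "{x + J y | x y. x \<in> crq_\<iota> ?W ` crq_U ?W \<and> y \<in> crq_\<iota> ?W ` crq_U ?W} = crq_E ?W"
      using gen unfolding crq_W_sel(1-3) im by blast
  qed
  have gf: "inv_into (crq_E X) f (f x) = x" if "x \<in> crq_E X" for x using f(3) that by (simp add: bij_betw_def)
  have "crq_linear ?W X (\<lambda>u. u)"
  proof (rule semilinear_crq_linear[OF _ _ \<sigma>])
    show "ssum a ls ?I \<in> quat_morphisms (crq_E ?W)" unfolding crq_W_sel by (rule m)
    show "crq_Q ?W = quat_class (crq_E ?W) (ssum a ls ?I)" by (simp add: crq_W_sel)
    show "inv \<alpha> \<circ> id \<in> Aut_quat" using Aut_inv[OF f(1)] by simp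
    show "semilinear (crq_E ?W) (ssum a ls ?I) (crq_E X) \<sigma> (inv \<alpha> \<circ> id) (\<lambda>x. inv_into (crq_E X) f x)"
      unfolding crq_W_sel
      by (rule semilinear_compose[OF semilinear_inclusion[OF upto_pos(2)] semilinear_inverse[OF \<sigma>(1) XU(3) Esum_subspace f(1-3)]])
    show "(\<lambda>u. u) \<in> crq_U ?W \<rightarrow> crq_U X" by (auto simp: crq_W_sel)
    show "linear_on (crq_U ?W) (\<lambda>u. u)" by (simp add: linear_on_def)
    fix u assume "u \<in> crq_U ?W"
    then have u: "u \<in> crq_U X" by (simp add: crq_W_sel)
    then have "crq_\<iota> X u \<in> crq_E X" using XU(4) by blast
    then have "inv_into (crq_E X) f (f (crq_\<iota> X u)) = crq_\<iota> X u" by (rule gf)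
    then show "crq_\<iota> X u = inv_into (crq_E X) f (crq_\<iota> ?W u)" using f(4) u by (simp add: crq_W_sel)
  qed
  then show ?thesis using W by (auto simp: crq_subspace_def crq_W_sel)
qed

text \<open>The transition map \<open>?F\<close> from one decomposition to the other carries
  \<open>\<phi> u\<close> to \<open>\<phi>' u\<close> and respects the filtration by
  \<open>semilinear_filtered\<close>; restricted to the partial sums it is the ambient map of the
  inclusion.\<close>

lemma crq_W_subset_and_linear:
  assumes X: "crq_vector_space X" and q: "admissible_choice q"
    and d: "crq_decomposition q X a ls \<phi>" and d': "crq_decomposition q X a' ls' \<phi>'"
  shows "crq_U (crq_W q X a ls \<phi> n) \<subseteq> crq_U (crq_W q X a' ls' \<phi>' n)"
    and "crq_linear (crq_W q X a ls \<phi> n) (crq_W q X a' ls' \<phi>' n) (\<lambda>u. u)"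
proof -
  obtain \<sigma> where \<sigma>: "\<sigma> \<in> quat_morphisms (crq_E X)" "crq_Q X = quat_class (crq_E X) \<sigma>"
    using quat_structure_class X unfolding crq_vector_space_def by metis
  obtain f \<alpha> where f: "\<alpha> \<in> Aut_quat"
    "semilinear (crq_E X) \<sigma> (Esum ls {..<length ls}) (ssum a ls {..<length ls}) \<alpha> f"
    "bij_betw f (crq_E X) (Esum ls {..<length ls})"
    "\<forall>u\<in>crq_U X. f (crq_\<iota> X u) = \<phi> u"
    and \<phi>: "bij_betw \<phi> (crq_U X) (Usum q ls {..<length ls})" "linear_on (crq_U X) \<phi>"
    and a: "\<forall>i<length ls. a i \<in> Aut_quat"
    by (rule crq_decomposition_semilinear[OF X q d \<sigma>])
  obtain f' \<alpha>' where f': "\<alpha>' \<in> Aut_quat"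
    "semilinear (crq_E X) \<sigma> (Esum ls' {..<length ls'}) (ssum a' ls' {..<length ls'}) \<alpha>' f'"
    "bij_betw f' (crq_E X) (Esum ls' {..<length ls'})"
    "\<forall>u\<in>crq_U X. f' (crq_\<iota> X u) = \<phi>' u"
    and \<phi>': "bij_betw \<phi>' (crq_U X) (Usum q ls' {..<length ls'})" "linear_on (crq_U X) \<phi>'"
    and a': "\<forall>i<length ls'. a' i \<in> Aut_quat"
    by (rule crq_decomposition_semilinear[OF X q d' \<sigma>])
  let ?N = "{..<length ls}" and ?N' = "{..<length ls'}"
  let ?W = "crq_W q X a ls \<phi> n" and ?W' = "crq_W q X a' ls' \<phi>' n"
  let ?F = "\<lambda>x. f' (inv_into (crq_E X) f x)"
  have XE: "subspace (crq_E X)" "crq_\<iota> X \<in> crq_U X \<rightarrow> crq_E X" using X by (auto simp: crq_vector_space_def)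
  have \<beta>: "\<alpha>' \<circ> inv \<alpha> \<in> Aut_quat" by (rule Aut_comp[OF f'(1) Aut_inv[OF f(1)]])
  have F: "semilinear (Esum ls ?N) (ssum a ls ?N) (Esum ls' ?N') (ssum a' ls' ?N') (\<alpha>' \<circ> inv \<alpha>) ?F"
    by (rule semilinear_compose[OF semilinear_inverse[OF \<sigma>(1) XE(1) Esum_subspace f(1-3)] f'(2)])
  have F\<phi>: "?F (\<phi> u) = \<phi>' u" if u: "u \<in> crq_U X" for u
  proof -
    have "crq_\<iota> X u \<in> crq_E X" using XE(2) u by blast
    then have "inv_into (crq_E X) f (f (crq_\<iota> X u)) = crq_\<iota> X u" using f(3) by (simp add: bij_betw_def)
    then show ?thesis using f(4) f'(4) u by simp
  qed
  have FU: "?F ` Usum q ls ?N \<subseteq> Usum q ls' ?N'"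
  proof
    fix y assume "y \<in> ?F ` Usum q ls ?N"
    then obtain x where x: "x \<in> Usum q ls ?N" "y = ?F x" by blast
    then obtain u where "u \<in> crq_U X" "x = \<phi> u" using \<phi>(1) unfolding bij_betw_def by blast
    then have "u \<in> crq_U X" "y = ?F (\<phi> u)" using x by auto
    then show "y \<in> Usum q ls' ?N'" using F\<phi> \<phi>'(1) by (auto simp: bij_betw_def)
  qed
  have filt: "?F v \<in> Esum ls' (upto_pos ls' n)" if "v \<in> Esum ls (upto_pos ls n)" for v
    by (rule semilinear_filtered[OF q _ _ \<beta> F FU that]) (use a a' in auto)
  show sub: "crq_U ?W \<subseteq> crq_U ?W'"
  proof
    fix u assume "u \<in> crq_U ?W"
    then have u: "u \<in> crq_U X" "\<phi> u \<in> Usum q ls (upto_pos ls n)" by (auto simp: crq_W_sel)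
    then have "\<phi>' u \<in> Esum ls' (upto_pos ls' n)" using filt[of "\<phi> u"] F\<phi> Usum_subset by fastforce
    moreover have "\<phi>' u \<in> Usum q ls' ?N'" using \<phi>'(1) u(1) by (auto simp: bij_betw_def)
    ultimately have "\<phi>' u \<in> Usum q ls' (upto_pos ls' n)" using Usum_inter_Esum[OF upto_pos(2)[of ls' n]] by blast
    then show "u \<in> crq_U ?W'" using u(1) by (simp add: crq_W_sel)
  qed
  have m: "ssum a ls (upto_pos ls n) \<in> quat_morphisms (crq_E ?W)" "ssum a' ls' (upto_pos ls' n) \<in> quat_morphisms (crq_E ?W')"
    unfolding crq_W_sel by (rule ssum_morphism, use a a' upto_pos(2) in blast)+
  have c: "crq_Q ?W = quat_class (crq_E ?W) (ssum a ls (upto_pos ls n))"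
    "crq_Q ?W' = quat_class (crq_E ?W') (ssum a' ls' (upto_pos ls' n))" by (simp_all add: crq_W_sel)
  show "crq_linear ?W ?W' (\<lambda>u. u)"
  proof (rule semilinear_crq_linear[OF m(1) c(1) m(2) c(2) \<beta>])
    show "semilinear (crq_E ?W) (ssum a ls (upto_pos ls n)) (crq_E ?W') (ssum a' ls' (upto_pos ls' n)) (\<alpha>' \<circ> inv \<alpha>) ?F"
      unfolding semilinear_def crq_W_sel
    proof (intro conjI ballI allI)
      note inc = semilinear_inclusion[OF upto_pos(2)[of ls n], of ls a] semilinear_inclusion[OF upto_pos(2)[of ls' n], of ls' a']
      have s: "Esum ls (upto_pos ls n) \<subseteq> Esum ls ?N" by (rule Esum_mono[OF upto_pos(2)])
      show "?F \<in> Esum ls (upto_pos ls n) \<rightarrow> Esum ls' (upto_pos ls' n)" using filt by blast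
      show "linear_on (Esum ls (upto_pos ls n)) ?F"
        by (rule linear_on_subset[OF _ s]) (use F in \<open>simp add: semilinear_def\<close>)
      fix p x assume x: "x \<in> Esum ls (upto_pos ls n)"
      then have xN: "x \<in> Esum ls ?N" using s by blast
      have "?F (ssum a ls (upto_pos ls n) p x) = ?F (ssum a ls ?N p x)"
        using inc(1) x by (simp add: semilinear_def)
      also have "\<dots> = ssum a' ls' ?N' ((\<alpha>' \<circ> inv \<alpha>) p) (?F x)"
        using F xN unfolding semilinear_def by blast
      also have "\<dots> = ssum a' ls' (upto_pos ls' n) ((\<alpha>' \<circ> inv \<alpha>) p) (?F x)"
        using inc(2) filt[OF x] by (simp add: semilinear_def)
      finally show "?F (ssum a ls (upto_pos ls n) p x) = ssum a' ls' (upto_pos ls' n) ((\<alpha>' \<circ> inv \<alpha>) p) (?F x)" .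
    qed
    show "(\<lambda>u. u) \<in> crq_U ?W \<rightarrow> crq_U ?W'" using sub by blast
    show "linear_on (crq_U ?W) (\<lambda>u. u)" by (simp add: linear_on_def)
    fix u assume "u \<in> crq_U ?W"
    then show "crq_\<iota> ?W' u = ?F (crq_\<iota> ?W u)" using F\<phi> by (simp add: crq_W_sel)
  qed
qed

text \<open>Needed because \<open>crq_iso\<close> speaks of \<open>inv_into\<close>, which agrees
  with the identity only on the carrier.\<close>

lemma crq_linear_cong:
  assumes "crq_linear X Y t" "subspace (crq_U X)" "\<And>u. u \<in> crq_U X \<Longrightarrow> t' u = t u"
  shows "crq_linear X Y t'"
proof -
  have "linear_on (crq_U X) t'"
    using assms unfolding crq_linear_def linear_on_def by (simp add: subspace_add subspace_scale)
  then show ?thesis using assms unfolding crq_linear_def by auto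
qed

lemma crq_W_canonical:
  assumes X: "crq_vector_space X" and q: "admissible_choice q"
    and d: "crq_decomposition q X a ls \<phi>" and d': "crq_decomposition q X a' ls' \<phi>'"
  shows "crq_U (crq_W q X a ls \<phi> n) = crq_U (crq_W q X a' ls' \<phi>' n)"
    and "crq_iso (crq_W q X a ls \<phi> n) (crq_W q X a' ls' \<phi>' n) (\<lambda>u. u)"
proof -
  let ?W = "crq_W q X a ls \<phi> n" and ?W' = "crq_W q X a' ls' \<phi>' n"
  note 1 = crq_W_subset_and_linear[OF X q d d', of n] and 2 = crq_W_subset_and_linear[OF X q d' d, of n]
  show eq: "crq_U ?W = crq_U ?W'" using 1(1) 2(1) by blast
  have inv: "inv_into (crq_U ?W) (\<lambda>u. u) u = u" if "u \<in> crq_U ?W'" for u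
    using inv_into_f_f[of "\<lambda>u. u" "crq_U ?W" u] that eq by simp
  have "crq_linear ?W' ?W (inv_into (crq_U ?W) (\<lambda>u. u))"
  proof (rule crq_linear_cong[OF 2(2) _ inv])
    show "subspace (crq_U ?W')"
      using crq_W_crq_subspace[OF X q d'] by (simp add: crq_subspace_def crq_vector_space_def)
  qed
  then show "crq_iso ?W ?W' (\<lambda>u. u)"
    using 1(2) eq by (simp add: crq_iso_def bij_betw_def)
qed

section \<open>Uniqueness of the terms\<close>

lemma label_pos_inj: "label_pos l = label_pos l' \<Longrightarrow> l = l'"
  by (cases l; cases l') (auto, presburger+)

text \<open>Positions determine labels, so the step of the filtration at \<open>label_pos l\<close>
  grows exactly by the copies of \<open>l\<close>; their number is the growth in dimension divided
  by \<open>dim (label_U q l)\<close>.\<close>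

lemma decomposition_terms_unique:
  assumes X: "crq_vector_space X" and q: "admissible_choice q"
    and d: "crq_decomposition q X a ls \<phi>" and d': "crq_decomposition q X a' ls' \<phi>'"
  shows "mset ls = mset ls'"
proof -
  have XU: "subspace (crq_U X)" "fin_dim (crq_U X)" using X by (auto simp: crq_vector_space_def)
  define w where "w ls n = (\<Sum>i\<in>upto_pos ls n. dim (label_U q (ls ! i)))" for ls n
  have dimW: "w ls n = dim (crq_U (crq_W q X a ls \<phi> n))" if d: "crq_decomposition q X a ls \<phi>" for a ls \<phi> n
  proof -
    have \<phi>: "bij_betw \<phi> (crq_U X) (Usum q ls {..<length ls})" "linear_on (crq_U X) \<phi>"
      using d by (auto simp: crq_decomposition_def crq_iso_def crq_linear_def term_sum_sel)
    let ?U = "{u \<in> crq_U X. \<phi> u \<in> Usum q ls (upto_pos ls n)}"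
    note b = crq_W_bij[OF \<phi>(1), of n]
    have s: "subspace ?U" by (rule crq_W_subspace[OF XU(1) \<phi>(2)])
    have "fin_dim ?U" by (rule fin_dim_subset(1)[OF XU(2) s]) auto
    moreover have "linear_on ?U \<phi>" by (rule linear_on_subset[OF \<phi>(2)]) auto
    ultimately have "dim (\<phi> ` ?U) = dim ?U" using b by (intro linear_on_inj_dim) (auto simp: bij_betw_def)
    then show ?thesis using b Usum_dim(2)[OF upto_pos(1)] by (simp add: w_def bij_betw_def crq_W_sel)
  qed
  have weq: "w ls n = w ls' n" for n
    using dimW[OF d] dimW[OF d'] crq_W_canonical(1)[OF X q d d'] by simp
  \<comment> \<open>For the first position, \<open>label_pos l - 1\<close> is \<open>0\<close> and
    the partial sum there is empty.\<close>
  have cnt: "w ls (label_pos l) = w ls (label_pos l - 1) + count (mset ls) l * dim (label_U q l)" for ls l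
  proof -
    have pos: "1 \<le> label_pos l" by (cases l) auto
    let ?C = "{i. i < length ls \<and> l = ls ! i}"
    have "upto_pos ls (label_pos l) = upto_pos ls (label_pos l - 1) \<union> ?C"
    proof -
      have "k \<le> label_pos l \<longleftrightarrow> k \<le> label_pos l - 1 \<or> k = label_pos l" for k using pos by auto
      moreover have "label_pos (ls ! i) = label_pos l \<longleftrightarrow> l = ls ! i" for i using label_pos_inj by metis
      ultimately show ?thesis unfolding upto_pos_def by blast
    qed
    moreover have "upto_pos ls (label_pos l - 1) \<inter> ?C = {}" using pos by (auto simp: upto_pos_def)
    ultimately have "w ls (label_pos l) = w ls (label_pos l - 1) + (\<Sum>i\<in>?C. dim (label_U q (ls ! i)))"
      unfolding w_def by (simp add: sum.union_disjoint upto_pos)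
    also have "(\<Sum>i\<in>?C. dim (label_U q (ls ! i))) = (\<Sum>i\<in>?C. dim (label_U q l))" by (rule sum.cong) auto
    also have "\<dots> = count (mset ls) l * dim (label_U q l)"
      unfolding sum_constant by (simp add: count_mset count_list_eq_length_filter length_filter_conv_card)
    finally show ?thesis .
  qed
  show ?thesis
  proof (rule multiset_eqI)
    fix l
    have "count (mset ls) l * dim (label_U q l) = count (mset ls') l * dim (label_U q l)"
      using cnt[of ls l] cnt[of ls' l] weq[of "label_pos l"] weq[of "label_pos l - 1"] by linarith
    then show "count (mset ls) l = count (mset ls') l" using dim_label_U_pos[OF q, of l] by simp
  qed
qed

section \<open>Existence of decompositions\<close>

text \<open>After transport to \<open>quat_space m\<close> the dual pair is decomposed into blocks,
  each isomorphic to a model. The adjoints of the block embeddings, taken together, give the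
  isomorphism from the original space to the sum of models.\<close>

lemma crq_decomposition_exists:
  fixes X :: "('u::real_vector, 'e::real_vector) crq"
  assumes X: "crq_vector_space X" and q: "admissible_choice q"
  shows "\<exists>ls \<phi>. crq_decomposition q X (\<lambda>_. id) ls \<phi>"
proof -
  obtain \<sigma> where \<sigma>: "\<sigma> \<in> quat_morphisms (crq_E X)" "crq_Q X = quat_class (crq_E X) \<sigma>"
    using quat_structure_class X unfolding crq_vector_space_def by metis
  let ?U = "crq_U X" and ?E = "crq_E X" and ?\<iota> = "crq_\<iota> X"
  have sU: "subspace ?U" and fU: "fin_dim ?U" and sE: "subspace ?E" and fE: "fin_dim ?E"
    and \<iota>: "?\<iota> \<in> ?U \<rightarrow> ?E" "linear_on ?U ?\<iota>" "inj_on ?\<iota> ?U"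
    using X by (simp_all add: crq_vector_space_def)
  have genX: "\<forall>J\<in>admissible (crq_Q X). {x + J y | x y. x \<in> ?\<iota> ` ?U \<and> y \<in> ?\<iota> ` ?U} = ?E"
    using X unfolding crq_vector_space_def by (elim conjE)
  obtain m \<theta> where \<theta>: "linear_on (quat_space m) \<theta>" "bij_betw \<theta> (quat_space m) ?E"
    "\<And>p v. v \<in> quat_space m \<Longrightarrow> \<theta> (p \<star> v) = \<sigma> p (\<theta> v)"
    using quat_space_coordinates[OF fE \<sigma>(1)] by metis
  let ?\<tau> = "inv_into (quat_space m) \<theta>"
  have \<tau>: "?\<tau> e \<in> quat_space m" "\<theta> (?\<tau> e) = e" if "e \<in> ?E" for e
    using \<theta>(2) that by (auto simp: bij_betw_def inv_into_into f_inv_into_f)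
  have \<tau>\<theta>: "?\<tau> (\<theta> v) = v" if "v \<in> quat_space m" for v using \<theta>(2) that by (simp add: bij_betw_def)
  have \<theta>E: "\<theta> v \<in> ?E" if "v \<in> quat_space m" for v using \<theta>(2) that by (auto simp: bij_betw_def)
  have \<tau>add: "?\<tau> (x + y) = ?\<tau> x + ?\<tau> y" if "x \<in> ?E" "y \<in> ?E" for x y
  proof -
    have "\<theta> (?\<tau> x + ?\<tau> y) = x + y" using \<theta>(1) \<tau> that unfolding linear_on_def by simp
    then show ?thesis using \<tau>\<theta>[of "?\<tau> x + ?\<tau> y"] subspace_add[OF quat_space_subspace] \<tau>(1) that by metis
  qed
  have \<tau>scale: "?\<tau> (c *\<^sub>R x) = c *\<^sub>R ?\<tau> x" if "x \<in> ?E" for c x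
  proof -
    have "\<theta> (c *\<^sub>R ?\<tau> x) = c *\<^sub>R x" using \<theta>(1) \<tau> that unfolding linear_on_def by simp
    then show ?thesis using \<tau>\<theta>[of "c *\<^sub>R ?\<tau> x"] subspace_scale[OF quat_space_subspace] \<tau>(1) that by metis
  qed
  have \<tau>\<sigma>: "?\<tau> (\<sigma> p x) = p \<star> ?\<tau> x" if "x \<in> ?E" for p x
  proof -
    have "\<theta> (p \<star> ?\<tau> x) = \<sigma> p x" using \<theta>(3) \<tau> that by simp
    then show ?thesis using \<tau>\<theta>[of "p \<star> ?\<tau> x"] hsm_quat_space \<tau>(1) that by metis
  qed
  define U1 where "U1 = (\<lambda>u. ?\<tau> (?\<iota> u)) ` ?U"
  have \<iota>E: "?\<iota> u \<in> ?E" if "u \<in> ?U" for u using \<iota>(1) that by blast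
  have l1: "linear_on ?U (\<lambda>u. ?\<tau> (?\<iota> u))"
    using \<iota>(2) \<iota>E \<tau>add \<tau>scale by (simp add: linear_on_def)
  have U1: "subspace U1" "U1 \<subseteq> quat_space m"
    unfolding U1_def using linear_on_image_subspace[OF sU l1] \<tau>(1) \<iota>E by auto
  have gen1: "\<exists>w1 w2. w1 \<in> U1 \<and> w2 \<in> U1 \<and> v = w1 + J \<star> w2"
    if J: "J \<in> Im_quat_sphere" and v: "v \<in> quat_space m" for J v
  proof -
    have "\<sigma> J \<in> admissible (crq_Q X)" using J admissible_quat_class[OF \<sigma>(1)] \<sigma>(2) by simp
    from bspec[OF genX this] have "\<theta> v \<in> {x + \<sigma> J y | x y. x \<in> ?\<iota> ` ?U \<and> y \<in> ?\<iota> ` ?U}" using \<theta>E[OF v] by simp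
    then have "\<exists>x y. \<theta> v = x + \<sigma> J y \<and> x \<in> ?\<iota> ` ?U \<and> y \<in> ?\<iota> ` ?U" unfolding mem_Collect_eq .
    then obtain u1 u2 where u: "u1 \<in> ?U" "u2 \<in> ?U" "\<theta> v = ?\<iota> u1 + \<sigma> J (?\<iota> u2)" by (elim exE conjE imageE) simp
    then have "v = ?\<tau> (?\<iota> u1 + \<sigma> J (?\<iota> u2))" using \<tau>\<theta>[OF v] by simp
    also have "\<dots> = ?\<tau> (?\<iota> u1) + J \<star> ?\<tau> (?\<iota> u2)"
      using \<tau>add \<tau>\<sigma> \<iota>E u(1,2) quat_morphismsD(1)[OF \<sigma>(1)] by simp
    finally show ?thesis using u(1,2) unfolding U1_def by blast
  qed
  define V where "V = orth_compl m U1"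
  have VU: "orth_compl m V = U1" unfolding V_def by (rule orth_compl_orth_compl[OF U1])
  \<comment> \<open>If \<open>x\<close> and \<open>J x\<close> are both orthogonal to
    \<open>U1\<close>, then \<open>x\<close> is orthogonal to \<open>U1\<close> and
    \<open>J U1\<close>, which generate the whole space.\<close>
  have gV: "gpair V (quat_space m)" unfolding gpair_def
  proof (intro conjI ballI impI)
    show "hsub (quat_space m)" by (rule hsub_quat_space)
    show "subspace V" unfolding V_def by (rule orth_compl_subspace)
    show "V \<subseteq> quat_space m" by (auto simp: V_def orth_compl_iff)
    fix J x assume J: "J \<in> Im_quat_sphere" and x: "x \<in> V" "J \<star> x \<in> V"
    show "x = 0"
    proof (rule ip_nondegenerate[of _ m])
      show "x \<in> quat_space m" using x by (simp add: V_def orth_compl_iff)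
      fix v assume "v \<in> quat_space m"
      then obtain w1 w2 where w: "w1 \<in> U1" "w2 \<in> U1" "v = w1 + J \<star> w2" using gen1[OF J] by blast
      have "ip m x (J \<star> w2) = ip m (qcnj J \<star> x) w2" by (simp add: ip_hsm)
      also have "\<dots> = - ip m (J \<star> x) w2"
        using ip_simps(5)[of m "-1" "J \<star> x" w2] by (simp add: sphere_qcnj[OF J] hsm_simps)
      also have "\<dots> = 0" using x w by (simp add: V_def orth_compl_iff)
      finally show "ip m x v = 0" using x w by (simp add: V_def orth_compl_iff ip_simps)
    qed
  qed
  obtain bs where bs: "\<forall>(l, W, F)\<in>set bs. lab_pair l W F \<and> W \<subseteq> V \<and> F \<subseteq> quat_space m"
     "sum_list (map (\<lambda>(l, W, F). dim F) bs) = dim (quat_space m)"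
     "quat_space m \<subseteq> span (\<Union>(l, W, F)\<in>set bs. F)" "V \<subseteq> span (\<Union>(l, W, F)\<in>set bs. W)"
    using gpair_decomposes[OF gV] by (elim exE conjE)
  define ls where "ls = map fst bs"
  define W where "W i = fst (snd (bs ! i))" for i
  define F where "F i = snd (snd (bs ! i))" for i
  let ?n = "length ls"
  let ?Q = "\<lambda>i. quat_space (label_dim (ls ! i))"
  have blk: "lab_pair (ls ! i) (W i) (F i)" "W i \<subseteq> V" "F i \<subseteq> quat_space m" if "i < ?n" for i
  proof -
    have "bs ! i \<in> set bs" "bs ! i = (ls ! i, W i, F i)" using that by (auto simp: ls_def W_def F_def)
    then show "lab_pair (ls ! i) (W i) (F i)" "W i \<subseteq> V" "F i \<subseteq> quat_space m" using bs(1) by fastforce+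
  qed
  have UN: "(\<Union>(l, W, F)\<in>set bs. F) = (\<Union>i<?n. F i)" "(\<Union>(l, W, F)\<in>set bs. W) = (\<Union>i<?n. W i)"
    by (auto simp: set_conv_nth ls_def W_def F_def split_beta)
  have dims: "(\<Sum>i<?n. dim (F i)) = 4 * m"
    using bs(2) by (simp add: sum_list_sum_nth ls_def F_def split_beta dim_quat_space atLeast0LessThan)
  have "\<exists>c. hlin (?Q i) c \<and> c ` ?Q i = F i \<and> inj_on c (?Q i) \<and> c ` label_V q (ls ! i) = W i" if i: "i < ?n" for i
  proof -
    obtain c c' where c: "hlin (?Q i) c" "c ` ?Q i \<subseteq> F i" "c' ` F i \<subseteq> ?Q i" "c ` label_V q (ls ! i) \<subseteq> W i"
      "c' ` W i \<subseteq> label_V q (ls ! i)" "\<forall>x\<in>?Q i. c' (c x) = x" "\<forall>y\<in>F i. c (c' y) = y"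
      using lab_pair_unique[OF lab_pair_label_V[OF q] blk(1)[OF i]] unfolding pair_iso_def by (elim exE conjE) (rule that; assumption)
    have "F i \<subseteq> c ` ?Q i"
    proof
      fix y assume "y \<in> F i"
      then have "c' y \<in> ?Q i" "y = c (c' y)" using c(3,7) by auto
      then show "y \<in> c ` ?Q i" by blast
    qed
    moreover have "W i \<subseteq> c ` label_V q (ls ! i)"
    proof
      fix y assume y: "y \<in> W i"
      then have "y \<in> F i" using gpairD(3)[OF lab_pair_gpair[OF blk(1)[OF i]]] by blast
      then have "c' y \<in> label_V q (ls ! i)" "y = c (c' y)" using y c(5,7) by auto
      then show "y \<in> c ` label_V q (ls ! i)" by blast
    qed
    moreover have "inj_on c (?Q i)" by (rule inj_on_inverseI[of _ c']) (use c(6) in blast)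
    ultimately show ?thesis using c(1,2,4) by blast
  qed
  then obtain em where em: "\<And>i. i < ?n \<Longrightarrow> hlin (?Q i) (em i) \<and> em i ` ?Q i = F i \<and> inj_on (em i) (?Q i) \<and>
      em i ` label_V q (ls ! i) = W i" by metis
  have "\<exists>g. (\<forall>S. hlin S g) \<and> (\<forall>w. g w \<in> ?Q i) \<and> (\<forall>u\<in>?Q i. \<forall>w. ip m (em i u) w = ip (label_dim (ls ! i)) u (g w))"
    if i: "i < ?n" for i
  proof -
    have c: "hlin (?Q i) (em i)" "em i ` ?Q i \<subseteq> quat_space m" using em[OF i] blk(3)[OF i] by auto
    show ?thesis by (rule adjoint_exists[OF c]) blast
  qed
  then obtain g where g: "\<And>i. i < ?n \<Longrightarrow> (\<forall>S. hlin S (g i)) \<and> (\<forall>w. g i w \<in> ?Q i) \<and>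
      (\<forall>u\<in>?Q i. \<forall>w. ip m (em i u) w = ip (label_dim (ls ! i)) u (g i w))" by metis
  \<comment> \<open>The embeddings \<open>em i\<close> add up to a map from the sum of models to
    \<open>quat_space m\<close>; its adjoint is \<open>\<psi>\<close>. Passing to adjoints exchanges
    conditions on \<open>V\<close> for conditions on \<open>U\<close>.\<close>
  define \<psi> where "\<psi> w = (\<Sum>i<?n. sg i (g i w))" for w
  have lk\<psi>: "lk (\<psi> w) i = (if i < ?n then g i w else 0)" for w i
    by (simp add: \<psi>_def lookup_sum lk_sg)
  have \<psi>E: "\<psi> w \<in> Esum ls {..<?n}" for w using g by (auto simp: Esum_iff lk\<psi>)
  have g_lin: "g i (x + y) = g i x + g i y" "g i (p \<star> x) = p \<star> g i x" "g i (c *\<^sub>R x) = c *\<^sub>R g i x"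
    if "i < ?n" for i x y p c
    using hlinD[of UNIV "g i"] hlin_linear_on[of UNIV "g i"] g[OF that] by (auto simp: linear_on_def)
  have orth: "w = 0" if w: "w \<in> quat_space m" and ip0: "\<And>i x. i < ?n \<Longrightarrow> x \<in> F i \<Longrightarrow> ip m x w = 0" for w
  proof (rule ip_nondegenerate[OF w])
    fix v assume "v \<in> quat_space m"
    then have v: "v \<in> span (\<Union>i<?n. F i)" using bs(3) UN(1) by auto
    have "linear (ip m w)" by (rule linearI) (simp_all add: ip_simps)
    then show "ip m w v = 0" by (rule linear_eq_0_on_span[OF _ _ v]) (use ip0 in \<open>auto simp: ip_commute[of m w]\<close>)
  qed
  have \<psi>lin: "linear_on (quat_space m) \<psi>" unfolding linear_on_def
    by (auto intro!: poly_mapping_eqI[where ?'a = nat and ?'b = qvec]) (simp_all add: lk\<psi> g_lin)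
  \<comment> \<open>A vector in the kernel is orthogonal to every block \<open>F i\<close>, and the
    blocks span.\<close>
  have \<psi>inj: "w = 0" if w: "w \<in> quat_space m" "\<psi> w = 0" for w
  proof (rule orth[OF w(1)])
    fix i x assume i: "i < ?n" and "x \<in> F i"
    then obtain u where u: "u \<in> ?Q i" "x = em i u" using em[OF i] by blast
    have "g i w = 0" using lk\<psi>[of w i] w(2) i by simp
    then show "ip m x w = 0" using g[OF i] u by (simp add: ip_simps)
  qed
  have \<psi>im: "\<psi> ` quat_space m = Esum ls {..<?n}"
  proof (rule fin_dim_subset_eq[OF Esum_dim(1)])
    show "subspace (\<psi> ` quat_space m)" by (rule linear_on_image_subspace[OF quat_space_subspace \<psi>lin])
    show "\<psi> ` quat_space m \<subseteq> Esum ls {..<?n}" using \<psi>E by blast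
    have "dim (F i) = 4 * label_dim (ls ! i)" if i: "i < ?n" for i
      using linear_on_inj_dim[OF dim_quat_space(1) hlin_linear_on, of "label_dim (ls ! i)" "em i"] em[OF i]
      by (simp add: dim_quat_space)
    then have "dim (Esum ls {..<?n}) = 4 * m" using dims by (simp add: Esum_dim)
    \<comment> \<open>Equality of total dimensions, recorded with the decomposition, turns
      injectivity into surjectivity.\<close>
    then show "dim (Esum ls {..<?n}) \<le> dim (\<psi> ` quat_space m)"
      using fin_dim_image_inj(1)[OF dim_quat_space(1) \<psi>lin \<psi>inj] by (simp add: dim_quat_space)
  qed simp
  have \<psi>bij: "bij_betw \<psi> (quat_space m) (Esum ls {..<?n})"
    using fin_dim_image_inj(2)[OF dim_quat_space(1) \<psi>lin \<psi>inj] \<psi>im by (simp add: bij_betw_def)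
  \<comment> \<open>\<open>w\<close> belongs to \<open>U1\<close> exactly when it is orthogonal to
    \<open>V\<close>, hence to every \<open>W i = em i (label_V q (ls ! i))\<close>; by adjointness
    this says that \<open>g i w\<close> is orthogonal to \<open>label_V q (ls ! i)\<close>.\<close>
  have \<psi>U: "w \<in> U1 \<longleftrightarrow> \<psi> w \<in> Usum q ls {..<?n}" if w: "w \<in> quat_space m" for w
  proof
    assume "w \<in> U1"
    then have wV: "w \<in> orth_compl m V" using VU by simp
    have "g i w \<in> label_U q (ls ! i)" if i: "i < ?n" for i
      unfolding label_U_orth_compl orth_compl_iff
    proof (intro conjI ballI)
      show "g i w \<in> ?Q i" using g[OF i] by blast
      fix v assume v: "v \<in> label_V q (ls ! i)"
      then have "em i v \<in> V" using em[OF i] blk(2)[OF i] by blast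
      then have "ip m w (em i v) = 0" using wV by (simp add: orth_compl_iff)
      then have "ip m (em i v) w = 0" by (simp add: ip_commute)
      moreover have "v \<in> ?Q i" using v gpairD(3)[OF lab_pair_gpair[OF lab_pair_label_V[OF q]]] by blast
      ultimately show "ip (label_dim (ls ! i)) (g i w) v = 0" using g[OF i] by (simp add: ip_commute)
    qed
    then show "\<psi> w \<in> Usum q ls {..<?n}" by (simp add: Usum_iff lk\<psi>)
  next
    assume "\<psi> w \<in> Usum q ls {..<?n}"
    then have gU: "g i w \<in> label_U q (ls ! i)" if "i < ?n" for i using that by (auto simp: Usum_iff lk\<psi>)
    have 0: "ip m w x = 0" if i: "i < ?n" and x: "x \<in> W i" for i x
    proof -
      obtain v where v: "v \<in> label_V q (ls ! i)" "x = em i v" using em[OF i] x by blast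
      have "v \<in> ?Q i" using v gpairD(3)[OF lab_pair_gpair[OF lab_pair_label_V[OF q]]] by blast
      then have "ip m x w = ip (label_dim (ls ! i)) v (g i w)" using g[OF i] v(2) by simp
      also have "\<dots> = ip (label_dim (ls ! i)) (g i w) v" by (rule ip_commute)
      also have "\<dots> = 0" using gU[OF i] v(1) by (simp add: label_U_orth_compl orth_compl_iff)
      finally show ?thesis by (simp add: ip_commute)
    qed
    have "ip m w v = 0" if "v \<in> V" for v
    proof -
      have v: "v \<in> span (\<Union>i<?n. W i)" using bs(4) UN(2) \<open>v \<in> V\<close> by auto
      have "linear (ip m w)" by (rule linearI) (simp_all add: ip_simps)
      then show ?thesis by (rule linear_eq_0_on_span[OF _ _ v]) (use 0 in auto)
    qed
    then have "w \<in> orth_compl m V" using w by (simp add: orth_compl_iff)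
    then show "w \<in> U1" using VU by simp
  qed
  let ?S = "term_sum q (\<lambda>_. id) ls {..<?n}"
  let ?f = "\<lambda>e. \<psi> (?\<tau> e)"
  let ?\<phi> = "\<lambda>u. \<psi> (?\<tau> (?\<iota> u))"
  have fbij: "bij_betw ?f ?E (Esum ls {..<?n})"
    using bij_betw_trans[OF bij_betw_inv_into[OF \<theta>(2)] \<psi>bij] by (simp add: o_def)
  have fsl: "semilinear ?E \<sigma> (Esum ls {..<?n}) (ssum (\<lambda>_. id) ls {..<?n}) id ?f"
    unfolding semilinear_def
  proof (intro conjI ballI allI)
    show "?f \<in> ?E \<rightarrow> Esum ls {..<?n}" using \<psi>E by blast
    show "linear_on ?E ?f"
      using \<psi>lin \<tau>(1) \<tau>add \<tau>scale unfolding linear_on_def by simp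
    fix p x assume x: "x \<in> ?E"
    show "?f (\<sigma> p x) = ssum (\<lambda>_. id) ls {..<?n} (id p) (?f x)"
      by (rule poly_mapping_eqI) (simp add: lk_ssum[OF \<psi>E] \<tau>\<sigma>[OF x] lk\<psi> g_lin hsm_simps)
  qed
  have \<phi>bij: "bij_betw ?\<phi> ?U (Usum q ls {..<?n})"
    unfolding bij_betw_def
  proof
    have "inj_on ?f ?E" using fbij by (simp add: bij_betw_def)
    then show "inj_on ?\<phi> ?U" using \<iota>(3) \<iota>E unfolding inj_on_def by blast
    show "?\<phi> ` ?U = Usum q ls {..<?n}"
    proof
      show "?\<phi> ` ?U \<subseteq> Usum q ls {..<?n}"
      proof
        fix y assume "y \<in> ?\<phi> ` ?U"
        then obtain w where w: "w \<in> U1" "y = \<psi> w" unfolding U1_def by blast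
        then have "w \<in> quat_space m" using U1(2) by blast
        then show "y \<in> Usum q ls {..<?n}" using \<psi>U w by blast
      qed
      show "Usum q ls {..<?n} \<subseteq> ?\<phi> ` ?U"
      proof
        fix y assume y: "y \<in> Usum q ls {..<?n}"
        then have "y \<in> \<psi> ` quat_space m" using \<psi>im Usum_subset by blast
        then obtain w where w: "w \<in> quat_space m" "y = \<psi> w" by blast
        then have "w \<in> U1" using \<psi>U y by blast
        then show "y \<in> ?\<phi> ` ?U" using w(2) unfolding U1_def by blast
      qed
    qed
  qed
  have "crq_iso X ?S ?\<phi>"
  proof (rule semilinear_crq_iso[OF \<sigma>, of "ssum (\<lambda>_. id) ls {..<?n}" _ id ?f])
    show "ssum (\<lambda>_. id) ls {..<?n} \<in> quat_morphisms (crq_E ?S)"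
      unfolding term_sum_sel by (rule ssum_morphism) (rule Aut_id)
    show "linear_on ?U ?\<phi>" using \<psi>lin l1 \<tau>(1) \<iota>E unfolding linear_on_def by simp
  qed (use sE sU Esum_subspace Aut_id fsl fbij \<phi>bij \<iota>(1) in \<open>simp_all add: term_sum_sel\<close>)
  then have "crq_decomposition q X (\<lambda>_. id) ls ?\<phi>" using Aut_id by (simp add: crq_decomposition_def)
  then show ?thesis by blast
qed

text \<open>Existence is proved with the standard identification of all spheres, while uniqueness
  and canonicity cover arbitrary identifications. Canonicity concerns the CR quaternionic structures
  of the filtration steps as well as their underlying subspaces.\<close>

theorem corollary3p7:
  fixes X :: "('u::real_vector, 'e::real_vector) crq"
    and q :: "nat \<Rightarrow> nat \<Rightarrow> quat"
  assumes "crq_vector_space X"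
    and "admissible_choice q"
  shows "(\<exists>ls \<phi>. crq_decomposition q X (\<lambda>_. id) ls \<phi>) \<and>
    (\<forall>a ls \<phi> a' ls' \<phi>'.
       crq_decomposition q X a ls \<phi> \<and> crq_decomposition q X a' ls' \<phi>' \<longrightarrow>
       mset ls = mset ls') \<and>
    (\<forall>a ls \<phi>. crq_decomposition q X a ls \<phi> \<longrightarrow>
       (\<forall>n>1. crq_subspace (crq_W q X a ls \<phi> n) X \<and>
              crq_U (crq_W q X a ls \<phi> n) \<subseteq> crq_U (crq_W q X a ls \<phi> (n + 1)))) \<and>
    (\<forall>a ls \<phi> a' ls' \<phi>'.
       crq_decomposition q X a ls \<phi> \<and> crq_decomposition q X a' ls' \<phi>' \<longrightarrow>
       (\<forall>n>1. crq_U (crq_W q X a ls \<phi> n) = crq_U (crq_W q X a' ls' \<phi>' n) \<and>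
              crq_iso (crq_W q X a ls \<phi> n) (crq_W q X a' ls' \<phi>' n) (\<lambda>u. u)))"
proof (intro conjI allI impI)
  show "\<exists>ls \<phi>. crq_decomposition q X (\<lambda>_. id) ls \<phi>" by (rule crq_decomposition_exists[OF assms])
next
  fix a ls \<phi> a' ls' \<phi>'
  assume "crq_decomposition q X a ls \<phi> \<and> crq_decomposition q X a' ls' \<phi>'"
  then show "mset ls = mset ls'" using decomposition_terms_unique[OF assms] by (elim conjE)
next
  fix a ls \<phi> and n :: nat assume "crq_decomposition q X a ls \<phi>"
  then show "crq_subspace (crq_W q X a ls \<phi> n) X" by (rule crq_W_crq_subspace[OF assms])
next
  fix a ls \<phi> and n :: nat
  have "upto_pos ls n \<subseteq> upto_pos ls (n + 1)" by (auto simp: upto_pos_def)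
  then show "crq_U (crq_W q X a ls \<phi> n) \<subseteq> crq_U (crq_W q X a ls \<phi> (n + 1))"
    using Usum_mono unfolding crq_W_sel by blast
next
  fix a ls \<phi> a' ls' \<phi>' and n :: nat
  assume d: "crq_decomposition q X a ls \<phi> \<and> crq_decomposition q X a' ls' \<phi>'"
  show "crq_U (crq_W q X a ls \<phi> n) = crq_U (crq_W q X a' ls' \<phi>' n)"
    by (rule crq_W_canonical(1)[OF assms conjunct1[OF d] conjunct2[OF d]])
  show "crq_iso (crq_W q X a ls \<phi> n) (crq_W q X a' ls' \<phi>' n) (\<lambda>u. u)"
    by (rule crq_W_canonical(2)[OF assms conjunct1[OF d] conjunct2[OF d]])
qed

end
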